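(* Let $X_1,\dots,X_n\subset\mathbb{R}^d$ be compact and let $\mu_i\in\mathcal{P}(X_i)$ satisfy $\mu_1\preceq_c\dots\preceq_c\mu_n$. For each $i=2,\dots,n$ let $c_i:X_1\times X_i\to\mathbb{R}$ be continuous. Suppose that for each $i=2,\dots,n$ there exists a martingale coupling $\pi^*_{1,i}=\mu_1\otimes\kappa_1^i\in\Pi_M(\mu_1,\mu_i)$ which is optimal for the two-period problem with cost $c_i$ (i.e. minimizes $\int c_i\,d\pi$ over $\pi\in\Pi_M(\mu_1,\mu_i)$), and such that $\kappa_1^i(x_1,\cdot)\preceq_c\kappa_1^{i+1}(x_1,\cdot)$ for $\mu_1$-a.e. $x_1$ and all $i=2,\dots,n-1$. Then any coupling $\pi^*\in\Pi_M(\mu_1,\dots,\mu_n)$ obtained by gluing the $\pi^*_{1,i}$, that is, any $\pi^*\in\Pi_M(\mu_1,\dots,\mu_n)$ with $\mathrm{Proj}_{1i}(\pi^* )=\pi^*_{1,i}$ for all $i=2,\dots,n$, is optimal for the multi-period martingale optimal transport problem (minimize $\int c\,d\pi$ over $\pi\in\Pi_M(\mu_1,\dots,\mu_n)$) with cost $$c(x_1,\dots,x_n)=\sum_{i=2}^{n}c_i(x_1,x_i).$$ Conversely, if $\pi^*$ is optimal for this multi-period problem, then each of its projections $\mathrm{Proj}_{1i}(\pi^* )$, $i=2,\dots,n$, is optimal for the corresponding two-period problem with cost $c_i$ between $\mu_1$ and $\mu_i$.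
   Context: $\mathcal{P}(X)$ is the set of Borel probability measures on $X$. Convex order: $\mu\preceq_c\nu$ means $\int\varphi\,d\mu\le\int\varphi\,d\nu$ for all convex $\varphi:\mathbb{R}^d\to\mathbb{R}$. $\Pi(\mu_1,\dots,\mu_n)$ is the set of probability measures on $X_1\times\dots\times X_n$ with $i$-th marginal $\mu_i$. $\mathrm{Proj}_I(\pi)$ is the marginal of $\pi$ on the coordinates indexed by $I$. $\mu\otimes\kappa$ denotes the joint measure with marginal $\mu$ and conditional probability kernel $\kappa$; $\kappa_1^i(x_1,dx_i)$ is the conditional probability of $x_i$ given $x_1$. Martingale couplings: $\Pi_M(\mu_1,\dots,\mu_n)$ is the set of $\pi\in\Pi(\mu_1,\dots,\mu_n)$ such that for each $i=1,\dots,n-1$, disintegrating $\pi=\mathrm{Proj}_{1\dots i}(\pi)\otimes\kappa_{1\dots i}^{i+1,\dots,n}$, one has $\int x_{i+1}\,\kappa_{1\dots i}^{i+1,\dots,n}(x_1,\dots,x_i,dx_{i+1},\dots,dx_n)=x_i$ for $\mathrm{Proj}_{1\dots i}(\pi)$-almost every $(x_1,\dots,x_i)$. (For $\Pi_M(\mu_1,\mu_i)$ the same definition is used with the two marginals $\mu_1,\mu_i$.) *)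

theory Defs
  imports "HOL-Probability.Probability"
begin

text \<open>
  A path with times in \<open>I\<close> is an extensional function \<open>x\<close> on \<open>I\<close> with \<open>x i \<in> X i\<close>. Working with
  index sets of times covers \<open>X\<^sub>1 \<times> \<dots> \<times> X\<^sub>n\<close> (\<open>I = {1..n}\<close>) as well as
  \<open>X\<^sub>1 \<times> X\<^sub>i\<close> (\<open>I = {1, i}\<close>) and the factors of a disintegration.
\<close>

abbreviation borel_on :: "'a::topological_space set \<Rightarrow> 'a measure" where
  "borel_on A \<equiv> restrict_space borel A"

definition path_space ::
  "(nat \<Rightarrow> 'a::euclidean_space set) \<Rightarrow> nat set \<Rightarrow> (nat \<Rightarrow> 'a) measure" where
  "path_space X I = (\<Pi>\<^sub>M i\<in>I. borel_on (X i))"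

definition Proj ::
  "(nat \<Rightarrow> 'a::euclidean_space set) \<Rightarrow> nat set \<Rightarrow> (nat \<Rightarrow> 'a) measure \<Rightarrow> (nat \<Rightarrow> 'a) measure" where
  "Proj X J \<pi> = distr \<pi> (path_space X J) (\<lambda>x. restrict x J)"

text \<open>
  Only used for measures on compact sets, where every convex \<open>\<phi>\<close> is integrable, so the default
  value of the Bochner integral of a non-integrable function plays no role. The same remark applies
  to the other integrals below.
\<close>

definition convex_order :: "'a::euclidean_space measure \<Rightarrow> 'a measure \<Rightarrow> bool"
    (infix "\<preceq>\<^sub>c" 50) where
  "\<mu> \<preceq>\<^sub>c \<nu> \<longleftrightarrow> (\<forall>\<phi>::'a \<Rightarrow> real. convex_on UNIV \<phi> \<longrightarrow> (\<integral>x. \<phi> x \<partial>\<mu>) \<le> (\<integral>x. \<phi> x \<partial>\<nu>))"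

text \<open>The joint law \<open>\<mu> \<otimes> \<kappa>\<close> of a measure \<open>\<mu>\<close> and a kernel \<open>\<kappa>\<close> from \<open>\<mu>\<close> to \<open>N\<close>.\<close>

definition kernel_prod ::
  "'a measure \<Rightarrow> 'b measure \<Rightarrow> ('a \<Rightarrow> 'b measure) \<Rightarrow> ('a \<times> 'b) measure" where
  "kernel_prod \<mu> N \<kappa> = \<mu> \<bind> (\<lambda>x. distr (\<kappa> x) (\<mu> \<Otimes>\<^sub>M N) (Pair x))"

definition couplings ::
  "(nat \<Rightarrow> 'a::euclidean_space set) \<Rightarrow> nat set \<Rightarrow> (nat \<Rightarrow> 'a measure) \<Rightarrow> (nat \<Rightarrow> 'a) measure set" where
  "couplings X I \<mu> =
     {\<pi> \<in> space (prob_algebra (path_space X I)).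
        \<forall>i\<in>I. distr \<pi> (borel_on (X i)) (\<lambda>x. x i) = \<mu> i}"

text \<open>
  \<open>\<kappa>\<close> is a regular conditional law under \<open>\<pi>\<close> of the coordinates in \<open>I\<close> after time \<open>i\<close> given those
  up to time \<open>i\<close>. A path on \<open>I\<close> is identified with the pair of its restrictions.
\<close>

definition disintegrates ::
  "(nat \<Rightarrow> 'a::euclidean_space set) \<Rightarrow> nat set \<Rightarrow> nat \<Rightarrow> (nat \<Rightarrow> 'a) measure \<Rightarrow>
     ((nat \<Rightarrow> 'a) \<Rightarrow> (nat \<Rightarrow> 'a) measure) \<Rightarrow> bool" where
  "disintegrates X I i \<pi> \<kappa> \<longleftrightarrow>
     (let J = {k\<in>I. k \<le> i}; K = {k\<in>I. i < k} in
        \<kappa> \<in> path_space X J \<rightarrow>\<^sub>M prob_algebra (path_space X K) \<and>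
        distr \<pi> (path_space X J \<Otimes>\<^sub>M path_space X K) (\<lambda>x. (restrict x J, restrict x K))
          = kernel_prod (Proj X J \<pi>) (path_space X K) \<kappa>)"

text \<open>
  Here \<open>j\<close> is the time in \<open>I\<close> that follows \<open>i\<close>; for \<open>I = {1..n}\<close> this is \<open>j = i + 1\<close>. On the spaces
  considered a disintegration exists and is almost everywhere unique, so it does not matter which
  one is used.
\<close>

definition mart_couplings ::
  "(nat \<Rightarrow> 'a::euclidean_space set) \<Rightarrow> nat set \<Rightarrow> (nat \<Rightarrow> 'a measure) \<Rightarrow> (nat \<Rightarrow> 'a) measure set" where
  "mart_couplings X I \<mu> =
     {\<pi> \<in> couplings X I \<mu>.
        \<forall>i\<in>I. \<forall>j\<in>I. i < j \<and> {i<..<j} \<inter> I = {} \<longrightarrow>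
          (\<exists>\<kappa>. disintegrates X I i \<pi> \<kappa> \<and>
               (AE x in Proj X {k\<in>I. k \<le> i} \<pi>. (\<integral>y. y j \<partial>\<kappa> x) = x i))}"

definition mot_optimal ::
  "(nat \<Rightarrow> 'a::euclidean_space set) \<Rightarrow> nat set \<Rightarrow> (nat \<Rightarrow> 'a measure) \<Rightarrow> ((nat \<Rightarrow> 'a) \<Rightarrow> real) \<Rightarrow>
     (nat \<Rightarrow> 'a) measure \<Rightarrow> bool" where
  "mot_optimal X I \<mu> c \<pi> \<longleftrightarrow>
     \<pi> \<in> mart_couplings X I \<mu> \<and>
     (\<forall>\<rho>\<in>mart_couplings X I \<mu>. (\<integral>x. c x \<partial>\<pi>) \<le> (\<integral>x. c x \<partial>\<rho>))"

end

theory Submission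
  imports Defs
begin

text \<open>
  Projecting to the times \<open>1, i\<close> preserves the martingale property, so the multi-period value is at
  least the sum of the two-period values; the theorem follows once some martingale coupling has all
  the \<open>P i\<close> as bivariate projections. Such a coupling is found by duality instead of by a measurable
  choice of Strassen couplings of the kernels. Being a martingale with projections \<open>P i\<close> means
  annihilating a linear space of continuous functions on the compact path space, and a probability
  measure annihilating such a space exists as soon as none of its members is strictly negative. For
  fixed \<open>x\<^sub>1\<close> the latter is a backward induction along the convex order of the kernels.

  The annihilating measure is a weak limit of empirical measures of a sequence chosen by Blackwell's
  approachability argument. To apply Helly's selection theorem on the real line, the path space is
  written as a continuous image of a compact set of reals. The same parametrisation reduces the
  disintegrations required by the definition of a martingale coupling to conditional laws of real
  random variables.
\<close>

section \<open>Compact metric spaces as images of compact sets of reals\<close>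

text \<open>Only the converse needs a glued coupling. For the direct statement the projections are
  given and the lower bound by the two-period values suffices; for the converse that bound must be
  attained, after which each summand has to be minimal separately. Strassen couplings of successive
  kernels would have to depend measurably on the starting point. The tests avoid this because they
  see the whole path, with x_1 as an ordinary coordinate: a strictly negative test is refuted by an
  inequality for each fixed x_1 that is then integrated over x_1, and only integrals of the kernels
  must be measurable in x_1. The convex order of the kernels starts at time 2. The first step, from
  x_1 to x_2, is covered by the barycenter of \<open>\<kappa> 2 x\<close>, which comes from the
  martingale property of \<open>P 2\<close>. Since the tests form a linear space, excluding strictly
  negative members also excludes strictly positive ones, and every finite combination is nonpositive
  somewhere. This is what the greedy choice of points uses. Countably many tests suffice by
  separability in the uniform norm.\<close>

lemma continuous_on_binary_series:
  fixes w :: "nat \<Rightarrow> real" and p :: "nat \<Rightarrow> nat"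
  assumes "summable (\<lambda>k. \<bar>w k\<bar>)"
  shows "continuous_on UNIV (\<lambda>b::nat \<Rightarrow> bool. \<Sum>k. w k * of_bool (b (p k)))"
proof -
  have "uniform_limit UNIV (\<lambda>n (b::nat \<Rightarrow> bool). \<Sum>k<n. w k * of_bool (b (p k)))
      (\<lambda>b. \<Sum>k. w k * of_bool (b (p k))) sequentially"
    by (rule Weierstrass_m_test[OF _ assms]) (auto simp: of_bool_def)
  moreover have "continuous_on UNIV (\<lambda>b::nat \<Rightarrow> bool. \<Sum>k<n. w k * of_bool (b (p k)))" for n
  proof -
    have "continuous_on UNIV (\<lambda>b::nat \<Rightarrow> bool. of_bool (b j) :: real)" for j
    proof (rule continuous_on_compose2[of UNIV of_bool])
      show "continuous_on UNIV (of_bool :: bool \<Rightarrow> real)"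
        by (rule Topological_Spaces.continuous_on_discrete)
    qed (auto intro: continuous_on_product_coordinates)
    then show ?thesis by (intro continuous_intros)
  qed
  ultimately show ?thesis
    by (intro uniform_limit_theorem) auto
qed

text \<open>Greedy digits: \<open>r n\<close> is the remainder after n digits, scaled up by 2^n. It
  stays in [0, 1], the right end included since 1 has all digits 1, so the remainder itself is at
  most 2^-n.\<close>

lemma binary_expansion_exists:
  fixes x :: real
  assumes "0 \<le> x" "x \<le> 1"
  shows "\<exists>b::nat \<Rightarrow> bool. (\<lambda>k. (1/2) ^ Suc k * of_bool (b k)) sums x"
proof -
  define r where "r = rec_nat x (\<lambda>_ y. 2 * y - of_bool (1/2 \<le> y))"
  have r0: "r 0 = x" and rS: "\<And>n. r (Suc n) = 2 * r n - of_bool (1/2 \<le> r n)"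
    by (simp_all add: r_def)
  have bd: "0 \<le> r n \<and> r n \<le> 1" for n
    by (induction n) (use assms in \<open>auto simp: r0 rS\<close>)
  have eq: "x = (\<Sum>k<n. (1/2) ^ Suc k * of_bool (1/2 \<le> r k)) + (1/2)^n * r n" for n
  proof (induction n)
    case (Suc n)
    show ?case by (subst Suc) (simp add: rS algebra_simps)
  qed (simp add: r0)
  have lim: "(\<lambda>n. (1/2)^n * r n) \<longlonglongrightarrow> 0"
  proof (rule tendsto_sandwich[of "\<lambda>_. 0" _ _ "\<lambda>n. (1/2::real)^n"])
    show "(\<lambda>n. (1/2::real)^n) \<longlonglongrightarrow> 0" by (rule LIMSEQ_power_zero) simp
  qed (use bd in \<open>auto intro!: always_eventually mult_left_le\<close>)
  have "(\<lambda>n. x - (1/2)^n * r n) \<longlonglongrightarrow> x - 0" by (intro tendsto_intros lim)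
  moreover have "(\<lambda>n. x - (1/2)^n * r n) = (\<lambda>n. \<Sum>k<n. (1/2) ^ Suc k * of_bool (1/2 \<le> r k))"
    using eq by (metis add_diff_cancel_right')
  ultimately show ?thesis unfolding sums_def by (intro exI[of _ "\<lambda>k. 1/2 \<le> r k"]) simp
qed

text \<open>Ternary expansion with digits 0 and 2, the usual parametrisation of the Cantor set.
  Unlike binary digits, these digits are determined by the sum.\<close>

definition cantor_code :: "(nat \<Rightarrow> bool) \<Rightarrow> real" where
  "cantor_code b = (\<Sum>k. 2 * (1/3) ^ Suc k * of_bool (b k))"

lemma summable_cantor_code: "summable (\<lambda>k. 2 * (1/3::real) ^ Suc k * of_bool (b k))"
  by (rule summable_comparison_test'[where g = "\<lambda>k. 2 * (1/3::real) ^ Suc k" and N = 0])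
     (auto simp: of_bool_def intro!: summable_mult)

lemma cantor_code_bounds: "0 \<le> cantor_code b" "cantor_code b \<le> 1"
proof -
  show "0 \<le> cantor_code b" unfolding cantor_code_def
    by (rule suminf_nonneg[OF summable_cantor_code]) auto
  have s: "(\<lambda>k. 2/3 * (1/3::real) ^ k) sums (2/3 * (1 / (1 - 1/3)))"
    by (intro sums_mult geometric_sums) auto
  have "cantor_code b \<le> (\<Sum>k. 2/3 * (1/3::real) ^ k)" unfolding cantor_code_def
    by (rule suminf_le[OF _ summable_cantor_code sums_summable[OF s]]) (auto simp: of_bool_def)
  then show "cantor_code b \<le> 1" using sums_unique[OF s] by simp
qed

lemma cantor_code_shift:
  "cantor_code b = 2/3 * of_bool (b 0) + cantor_code (\<lambda>k. b (Suc k)) / 3"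
proof -
  have "cantor_code b = 2/3 * of_bool (b 0) + (\<Sum>k. 1/3 * (2 * (1/3) ^ Suc k * of_bool (b (Suc k))))"
    unfolding cantor_code_def using suminf_split_head[OF summable_cantor_code[of b]] by simp
  also have "\<dots> = 2/3 * of_bool (b 0) + 1/3 * (\<Sum>k. 2 * (1/3) ^ Suc k * of_bool (b (Suc k)))"
    by (subst suminf_mult[OF summable_cantor_code]) simp
  finally show ?thesis by (simp add: cantor_code_def)
qed

text \<open>By self-similarity a code lies in [0, 1/3] or in [2/3, 1] according to its first digit.
  So the code determines the first digit, then the code of the remaining sequence, and one proceeds
  by induction on the position.\<close>

lemma inj_cantor_code: "inj cantor_code"
proof (rule injI, rule ext)
  fix b b' k assume "cantor_code b = cantor_code b'"
  then show "b k = b' k"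
  proof (induction k arbitrary: b b')
    have z: "b 0 = b' 0" if "cantor_code b = cantor_code b'" for b b'
      using that cantor_code_shift[of b] cantor_code_shift[of b']
        cantor_code_bounds[of "\<lambda>k. b (Suc k)"] cantor_code_bounds[of "\<lambda>k. b' (Suc k)"]
      by (auto simp: of_bool_def split: if_splits)
    {
      case 0 then show ?case by (rule z)
    next
      case (Suc k)
      have "cantor_code (\<lambda>k. b (Suc k)) = cantor_code (\<lambda>k. b' (Suc k))"
        using Suc.prems cantor_code_shift[of b] cantor_code_shift[of b'] z[OF Suc.prems] by simp
      then show ?case by (rule Suc.IH)
    }
  qed
qed

lemma compact_UNIV_bool_seq: "compact (UNIV :: (nat \<Rightarrow> bool) set)"
proof -
  have "compactin (product_topology (\<lambda>i::nat. euclidean :: bool topology) UNIV)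
      (PiE UNIV (\<lambda>_. UNIV))"
    unfolding compactin_PiE by (auto intro: finite_imp_compact)
  then show ?thesis
    by (simp add: euclidean_product_topology PiE_UNIV_domain)
qed

text \<open>Distances to a dense sequence embed \<open>S\<close> in the Hilbert cube, and binary
  digits map the Cantor space onto that cube. The bit sequences landing in the image of
  \<open>S\<close> form a closed set \<open>B\<close>, which the Cantor code embeds in the reals.
  Taking only \<open>B\<close>, and not the whole Cantor set, makes a retraction
  unnecessary.\<close>

lemma Hausdorff_Alexandroff:
  fixes S :: "'b::{metric_space, second_countable_topology} set"
  assumes S: "compact S"
  shows "\<exists>C T. compact C \<and> C \<subseteq> {0..1::real} \<and> continuous_on C T \<and> T ` C = S"
proof (cases "S = {}")
  case True
  then show ?thesis by (intro exI[of _ "{}"]) auto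
next
  case False
  obtain D where D: "countable D" "D \<subseteq> S" "S \<subseteq> closure D"
    using separable by blast
  with False have "D \<noteq> {}" by auto
  define d where "d = from_nat_into D"
  have dD: "range d = D" using D \<open>D \<noteq> {}\<close> by (simp add: d_def)
  define E where "E = (\<lambda>x j. min 1 (dist x (d j)))"
  have contE: "continuous_on S E"
    unfolding E_def by (intro continuous_on_coordinatewise_then_product continuous_intros)
  have injE: "inj_on E S"
  proof (rule inj_onI, rule ccontr)
    fix x y assume xy: "x \<in> S" "y \<in> S" "E x = E y" "x \<noteq> y"
    \<comment> \<open>Below 1 the truncation in \<open>E\<close> is inactive, so a dense point
      closer than e to x is equally close to y. Half the distance of x and y then contradicts the
      triangle inequality.\<close>
    define e where "e = min 1 (dist x y / 2)"
    have "e > 0" using xy by (auto simp: e_def)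
    then obtain z where z: "z \<in> D" "dist z x < e"
      using D(3) xy(1) by (meson closure_approachable subsetD)
    then obtain j where j: "z = d j" using dD by auto
    have "min 1 (dist x z) = min 1 (dist y z)"
      using fun_cong[OF xy(3), of j] by (simp add: E_def j)
    then have "dist y z < e" using z(2) by (auto simp: e_def dist_commute min_def split: if_splits)
    moreover have "dist x y \<le> dist z x + dist y z" by (metis dist_commute dist_triangle add.commute)
    ultimately show False using z(2) by (auto simp: e_def)
  qed
  \<comment> \<open>\<open>prod_encode\<close> splits one bit sequence into countably many; the j-th
    of them holds the binary digits of the j-th coordinate.\<close>
  define \<beta> where "\<beta> = (\<lambda>(b::nat \<Rightarrow> bool) j. \<Sum>k. (1/2) ^ Suc k * of_bool (b (prod_encode (j, k))) :: real)"
  have cont\<beta>: "continuous_on UNIV \<beta>"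
    unfolding \<beta>_def
    by (intro continuous_on_coordinatewise_then_product continuous_on_binary_series)
       (auto intro!: summable_mult)
  have surj\<beta>: "\<exists>b. \<beta> b = v" if v: "\<And>j. 0 \<le> v j \<and> v j \<le> 1" for v
  proof -
    have "\<forall>j. \<exists>b::nat \<Rightarrow> bool. (\<lambda>k. (1/2) ^ Suc k * of_bool (b k)) sums v j"
      using v binary_expansion_exists by blast
    then obtain a where a: "\<And>j. (\<lambda>k. (1/2) ^ Suc k * of_bool (a j k :: bool)) sums v j"
      by metis
    have "\<beta> (\<lambda>m. case prod_decode m of (j, k) \<Rightarrow> a j k) = v"
      unfolding \<beta>_def using sums_unique[OF a] by (auto simp: fun_eq_iff)
    then show ?thesis by blast
  qed
  define B where "B = \<beta> -` (E ` S)"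
  have "closed (E ` S)" using compact_continuous_image[OF contE S] compact_imp_closed by blast
  then have "closed B" unfolding B_def using cont\<beta> by (auto intro: closed_vimage)
  then have compB: "compact B" using closed_Int_compact[OF _ compact_UNIV_bool_seq] by simp
  have "continuous_on UNIV cantor_code"
  proof -
    have "continuous_on UNIV (\<lambda>b. \<Sum>k. (2 * (1/3::real) ^ Suc k) * of_bool (b (id k)))"
      by (intro continuous_on_binary_series) (auto intro!: summable_mult)
    then show ?thesis by (simp add: cantor_code_def[abs_def])
  qed
  then have contc: "continuous_on B cantor_code" by (rule continuous_on_subset) auto
  define C where "C = cantor_code ` B"
  define T where "T = (\<lambda>t. inv_into S E (\<beta> (inv cantor_code t)))"
  have inv: "inv cantor_code (cantor_code b) = b" for b by (simp add: inj_cantor_code)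
  have "continuous_on C (inv cantor_code)"
    unfolding C_def by (rule continuous_on_inv[OF contc compB]) (simp add: inv)
  moreover have "continuous_on (E ` S) (inv_into S E)"
    by (rule continuous_on_inv[OF contE S]) (simp add: injE)
  moreover have "\<beta> ` inv cantor_code ` C \<subseteq> E ` S"
    by (auto simp: C_def inv B_def)
  ultimately have "continuous_on C T"
    unfolding T_def
    using continuous_on_compose2[of "E ` S" "inv_into S E" C "\<lambda>t. \<beta> (inv cantor_code t)"]
      continuous_on_compose2[OF cont\<beta>, of C "inv cantor_code"] by (simp add: image_image)
  moreover have "T ` C = S"
  proof
    show "T ` C \<subseteq> S" by (auto simp: T_def C_def inv B_def inv_into_into)
    show "S \<subseteq> T ` C"
    proof
      fix x assume x: "x \<in> S"
      obtain b where b: "\<beta> b = E x" using surj\<beta>[of "E x"] by (auto simp: E_def)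
      then have "b \<in> B" using x by (auto simp: B_def)
      moreover have "T (cantor_code b) = x" by (simp add: T_def inv b injE x)
      ultimately show "x \<in> T ` C" by (auto simp: C_def intro!: rev_image_eqI[of "cantor_code b"])
    qed
  qed
  moreover have "compact C" unfolding C_def by (rule compact_continuous_image[OF contc compB])
  moreover have "C \<subseteq> {0..1}" by (auto simp: C_def cantor_code_bounds)
  ultimately show ?thesis by blast
qed

section \<open>Annihilating measures\<close>

text \<open>Weierstrass approximation within e/2, then rounding of the m + 1 coefficients. As the
  powers of t are at most 1 on [0, 1], an error of e / (2 (m + 1)) in each is affordable. Lists of
  rationals form a countable type.\<close>

lemma rational_polynomial_approx:
  fixes f :: "real \<Rightarrow> real"
  assumes C: "compact C" "C \<subseteq> {0..1}" and f: "continuous_on C f" and e: "0 < e"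
  shows "\<exists>l::rat list. \<forall>t\<in>C. \<bar>f t - (\<Sum>i<length l. of_rat (l ! i) * t ^ i)\<bar> < e"
proof -
  obtain g where g: "real_polynomial_function g" "\<And>t. t \<in> C \<Longrightarrow> \<bar>f t - g t\<bar> < e/2"
    using Stone_Weierstrass_real_polynomial_function[OF C(1) f, of "e/2"] e by auto
  obtain a m where a: "g = (\<lambda>t. \<Sum>i\<le>m. a i * t ^ i)"
    using g(1) real_polynomial_function_iff_sum by blast
  have "\<exists>q. \<bar>a i - of_rat q\<bar> < e / (2 * (real m + 1))" for i
  proof -
    have "a i < a i + e / (2 * (real m + 1))" using e by (simp add: add_pos_nonneg)
    from of_rat_dense[OF this] obtain q where q: "a i < of_rat q" "of_rat q < a i + e / (2 * (real m + 1))" by blast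
    then show ?thesis by (intro exI[of _ q]) (simp add: abs_if)
  qed
  then obtain q where q: "\<And>i. \<bar>a i - of_rat (q i)\<bar> < e / (2 * (real m + 1))" by metis
  define l where "l = map q [0..<Suc m]"
  have "\<bar>f t - (\<Sum>i<length l. of_rat (l ! i) * t ^ i)\<bar> < e" if t: "t \<in> C" for t
  proof -
    have t01: "0 \<le> t" "t \<le> 1" using t C by auto
    have "(\<Sum>i<length l. of_rat (l ! i) * t ^ i) = (\<Sum>i\<le>m. of_rat (q i) * t ^ i)"
      unfolding l_def by (intro sum.cong) (auto simp del: upt_Suc)
    then have "\<bar>g t - (\<Sum>i<length l. of_rat (l ! i) * t ^ i)\<bar> = \<bar>\<Sum>i\<le>m. (a i - of_rat (q i)) * t ^ i\<bar>"
      by (simp add: a sum_subtractf left_diff_distrib)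
    also have "\<dots> \<le> (\<Sum>i\<le>m. \<bar>(a i - of_rat (q i)) * t ^ i\<bar>)" by (rule sum_abs)
    also have "\<dots> \<le> (\<Sum>i\<le>m. e / (2 * (real m + 1)))"
    proof (rule sum_mono)
      fix i
      have "\<bar>(a i - of_rat (q i)) * t ^ i\<bar> \<le> \<bar>a i - of_rat (q i)\<bar> * 1"
        unfolding abs_mult using t01 by (intro mult_left_mono) (auto simp: power_le_one)
      then show "\<bar>(a i - of_rat (q i)) * t ^ i\<bar> \<le> e / (2 * (real m + 1))" using q[of i] by simp
    qed
    also have "\<dots> = e / 2" by (simp add: field_simps)
    finally show ?thesis using g(2)[OF t] by linarith
  qed
  then show ?thesis by blast
qed

text \<open>The rational polynomials are dense but need not lie in \<open>H\<close>. For each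
  polynomial and each precision 1 / (n + 1) a nearby member of \<open>H\<close> is picked if there
  is one, which doubles the error.\<close>

lemma dense_sequence_of_continuous_functions:
  fixes H :: "(real \<Rightarrow> real) set"
  assumes C: "compact C" "C \<subseteq> {0..1}" and H: "\<And>h. h \<in> H \<Longrightarrow> continuous_on C h" "H \<noteq> {}"
  shows "\<exists>d :: nat \<Rightarrow> real \<Rightarrow> real. range d \<subseteq> H \<and>
           (\<forall>h\<in>H. \<forall>e>0. \<exists>j. \<forall>t\<in>C. \<bar>h t - d j t\<bar> < e)"
proof -
  define p where "p = (\<lambda>(l::rat list) (t::real). \<Sum>i<length l. of_rat (l ! i) * t ^ i :: real)"
  define near where "near = (\<lambda>l n h. h \<in> H \<and> (\<forall>t\<in>C. \<bar>h t - p l t\<bar> < 1 / real (Suc n)))"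
  define s where "s = (\<lambda>l n. if \<exists>h. near l n h then SOME h. near l n h else SOME h. h \<in> H)"
  define d where "d = (\<lambda>j. case from_nat j of (l, n) \<Rightarrow> s l n)"
  have near_s: "near l n (s l n)" if "near l n h" for l n h
    using that someI[of "near l n" h] by (auto simp: s_def)
  have sH: "s l n \<in> H" for l n
  proof (cases "\<exists>h. near l n h")
    case True then show ?thesis using near_s[of l n] by (auto simp: near_def)
  next
    case False
    then have "s l n = (SOME h. h \<in> H)" unfolding s_def by (rule if_not_P)
    then show ?thesis using H(2) some_in_eq[of H] by simp
  qed
  show ?thesis
  proof (intro exI[of _ d] conjI ballI allI impI)
    show "range d \<subseteq> H" using sH by (auto simp: d_def split: prod.split)
    fix h and e :: real assume h: "h \<in> H" and e: "e > 0"
    obtain n where n: "1 / real (Suc n) < e / 2" using e nat_approx_posE[of "e/2"] by auto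
    obtain l where l: "\<forall>t\<in>C. \<bar>h t - p l t\<bar> < 1 / real (Suc n)"
      using rational_polynomial_approx[OF C H(1)[OF h], of "1 / real (Suc n)"] unfolding p_def by auto
    then have "near l n h" using h by (simp add: near_def)
    then have near: "near l n (s l n)" by (rule near_s)
    have "\<bar>h t - d (to_nat (l, n)) t\<bar> < e" if "t \<in> C" for t
    proof -
      have "\<bar>s l n t - p l t\<bar> < 1 / real (Suc n)" using near that by (simp add: near_def)
      moreover have "\<bar>h t - p l t\<bar> < 1 / real (Suc n)" using l that by blast
      ultimately show ?thesis using n by (simp add: d_def)
    qed
    then show "\<exists>j. \<forall>t\<in>C. \<bar>h t - d j t\<bar> < e" by blast
  qed
qed

text \<open>
  The greedy choice in Blackwell's approachability argument: when the point chosen at time \<open>t\<close> makes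
  a nonnegative angle with minus the vector of partial sums, the weighted squared norm of that vector
  grows at most linearly, so the averages tend to zero.
\<close>

lemma approachability:
  fixes d :: "nat \<Rightarrow> 'b \<Rightarrow> real"
  assumes bdd: "\<And>j. \<exists>B. \<forall>x\<in>S. \<bar>d j x\<bar> \<le> B"
    and pos: "\<And>a n. \<exists>x\<in>S. (\<Sum>j<n. a j * d j x) \<le> 0"
  shows "\<exists>u. range u \<subseteq> S \<and> (\<forall>j. (\<lambda>n. (\<Sum>k<n. d j (u k)) / real n) \<longlonglongrightarrow> 0)"
proof -
  obtain B0 where B0: "\<And>j x. x \<in> S \<Longrightarrow> \<bar>d j x\<bar> \<le> B0 j" using bdd by metis
  define B where "B j = 1 + \<bar>B0 j\<bar>" for j
  have B: "\<And>j x. x \<in> S \<Longrightarrow> \<bar>d j x\<bar> \<le> B j" "\<And>j. B j > 0"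
  proof -
    show "\<bar>d j x\<bar> \<le> B j" if "x \<in> S" for j x using B0[OF that, of j] by (simp add: B_def)
  qed (simp add: B_def)
  \<comment> \<open>The factor \<open>real (Suc j)\<close> serves the coordinate j that enters the
    norm at time j + 1: its partial sum is then at most \<open>real (Suc j) * B j\<close>. With
    these weights that entry, like any single squared increment, costs at most (1/2)^j.\<close>
  define w where "w j = (1/2)^j / (real (Suc j) * B j)\<^sup>2" for j
  have w: "w j > 0" for j using B(2)[of j] by (simp add: w_def)
  \<comment> \<open>The weights \<open>w j * s j\<close> are, up to a factor 2, the gradient of the
    weighted squared norm at s. At stage n only the first n coordinates are controlled, because
    \<open>pos\<close> speaks of finite combinations.\<close>
  define pick where "pick = (\<lambda>n s. SOME x. x \<in> S \<and> (\<Sum>j<n. w j * s j * d j x) \<le> 0)"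
  define V where "V = rec_nat (\<lambda>_. 0) (\<lambda>n s j. s j + d j (pick n s))"
  define u where "u n = pick n (V n)" for n
  have V0: "V 0 = (\<lambda>_. 0)" and VS: "V (Suc n) j = V n j + d j (u n)" for n j
    by (simp_all add: V_def u_def)
  have u: "u n \<in> S" "(\<Sum>j<n. w j * V n j * d j (u n)) \<le> 0" for n
    unfolding u_def pick_def
    using someI_ex[of "\<lambda>x. x \<in> S \<and> (\<Sum>j<n. w j * V n j * d j x) \<le> 0"]
      pos[where n = n and a = "\<lambda>j. w j * V n j"] by auto
  have w_le: "w j * z \<le> (1/2)^j" if "z \<le> (real (Suc j) * B j)\<^sup>2" for j z
  proof -
    have "w j * z = (1/2)^j * (z / (real (Suc j) * B j)\<^sup>2)" by (simp add: w_def)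
    also have "\<dots> \<le> (1/2)^j * 1"
      using that B(2)[of j] by (intro mult_left_mono) (auto intro!: divide_le_eq_1_pos[THEN iffD2])
    finally show ?thesis by simp
  qed
  have Vsum: "V n j = (\<Sum>k<n. d j (u k))" for n j
    by (induction n) (simp_all add: V0 VS)
  have Vle: "\<bar>V n j\<bar> \<le> real n * B j" for n j
  proof -
    have "\<bar>V n j\<bar> \<le> (\<Sum>k<n. \<bar>d j (u k)\<bar>)" unfolding Vsum by (rule sum_abs)
    also have "\<dots> \<le> (\<Sum>k<n. B j)" by (intro sum_mono B u)
    finally show ?thesis by simp
  qed
  have wd: "w j * (d j (u n))\<^sup>2 \<le> (1/2)^j" for j n
  proof -
    have "(d j (u n))\<^sup>2 \<le> (real (Suc j) * B j)\<^sup>2"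
    proof (rule power2_le_iff_abs_le[THEN iffD2])
      have "1 * B j \<le> real (Suc j) * B j" using B(2)[of j] by (intro mult_right_mono) auto
      then show "\<bar>d j (u n)\<bar> \<le> real (Suc j) * B j" using B(1)[OF u(1), of j n] by linarith
    qed (use B(2)[of j] in simp)
    then show ?thesis by (rule w_le)
  qed
  have wV: "w n * (V (Suc n) n)\<^sup>2 \<le> 1" for n
  proof -
    have "(V (Suc n) n)\<^sup>2 \<le> (real (Suc n) * B n)\<^sup>2"
      by (rule power2_le_iff_abs_le[THEN iffD2, OF _ Vle]) (use B(2)[of n] in simp)
    then have "w n * (V (Suc n) n)\<^sup>2 \<le> (1/2)^n" by (rule w_le)
    also have "\<dots> \<le> 1" by (simp add: power_le_one)
    finally show ?thesis .
  qed
  have geo: "(\<Sum>j<n. (1/2::real)^j) \<le> 2" for n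
    by (subst sum_gp_strict) auto
  \<comment> \<open>The constant 3: the cross term is nonpositive by the choice of
    \<open>u n\<close>, the squared increments add at most 2 by the geometric series, and the
    entering coordinate adds at most 1.\<close>
  have Q: "(\<Sum>j<n. w j * (V n j)\<^sup>2) \<le> 3 * real n" for n
  proof (induction n)
    case (Suc n)
    have "(\<Sum>j<n. w j * (V (Suc n) j)\<^sup>2)
        = (\<Sum>j<n. w j * (V n j)\<^sup>2) + 2 * (\<Sum>j<n. w j * V n j * d j (u n)) + (\<Sum>j<n. w j * (d j (u n))\<^sup>2)"
      by (simp add: VS power2_eq_square algebra_simps sum.distrib sum_distrib_left)
    also have "\<dots> \<le> 3 * real n + 2 * 0 + 2"
      using Suc u(2)[of n] sum_mono[of "{..<n}" "\<lambda>j. w j * (d j (u n))\<^sup>2" "\<lambda>j. (1/2)^j", OF wd] geo[of n]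
      by (intro add_mono mult_left_mono) auto
    finally show ?case using wV[of n] by simp
  qed simp
  have lim: "(\<lambda>n. V n j / real n) \<longlonglongrightarrow> 0" for j
  proof (rule Lim_null_comparison)
    show "\<forall>\<^sub>F n in sequentially. norm (V n j / real n) \<le> sqrt (3 / w j) * inverse (sqrt (real n))"
      \<comment> \<open>Coordinate j belongs to the norm only for n > j. From then on
        \<open>Q\<close> bounds its partial sum by a multiple of the square root of n.\<close>
      using eventually_gt_at_top[of j]
    proof eventually_elim
      case (elim n)
      have "w j * (V n j)\<^sup>2 \<le> (\<Sum>j<n. w j * (V n j)\<^sup>2)"
        using elim by (intro member_le_sum mult_nonneg_nonneg less_imp_le[OF w]) auto
      also have "\<dots> \<le> 3 * real n" by (rule Q)
      finally have "(V n j)\<^sup>2 \<le> 3 / w j * real n" using w[of j] by (simp add: field_simps)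
      then have "\<bar>V n j\<bar> \<le> sqrt (3 / w j * real n)" by (metis real_sqrt_abs real_sqrt_le_iff)
      then have "\<bar>V n j\<bar> \<le> sqrt (3 / w j) * sqrt (real n)" by (simp only: real_sqrt_mult)
      then have "\<bar>V n j\<bar> / real n \<le> sqrt (3 / w j) * (sqrt (real n) / real n)"
        unfolding times_divide_eq_right by (rule divide_right_mono) simp
      also have "sqrt (real n) / real n = inverse (sqrt (real n))"
        using elim by (simp add: inverse_eq_divide frac_eq_eq)
      finally show ?case by simp
    qed
    have "(\<lambda>n. sqrt (3 / w j) * inverse (sqrt (real n))) \<longlonglongrightarrow> sqrt (3 / w j) * 0"
      by (intro tendsto_intros tendsto_inverse_0_at_top filterlim_compose[OF sqrt_at_top] filterlim_real_sequentially)
    then show "(\<lambda>n. sqrt (3 / w j) * inverse (sqrt (real n))) \<longlonglongrightarrow> 0" by simp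
  qed
  show ?thesis using lim u(1) by (intro exI[of _ u]) (auto simp: Vsum)
qed

text \<open>Empirical measures of points of \<open>C\<close> are tight, and a weak limit is still
  carried by the closed set \<open>C\<close>. A function continuous only on \<open>C\<close> is
  extended by Tietze before weak convergence is applied; the conditional in the limit removes its
  arbitrary values off \<open>C\<close>. \<open>Suc\<close> keeps every empirical measure a
  probability.\<close>

lemma weak_limit_of_averages:
  fixes u :: "nat \<Rightarrow> real"
  assumes C: "compact C" "C \<subseteq> {0..1}" and u: "range u \<subseteq> C"
  shows "\<exists>L r. real_distribution L \<and> (AE t in L. t \<in> C) \<and> strict_mono (r :: nat \<Rightarrow> nat) \<and>
     (\<forall>f. continuous_on C f \<longrightarrow>
        (\<lambda>n. (\<Sum>k<Suc (r n). f (u k)) / real (Suc (r n))) \<longlonglongrightarrow> (\<integral>t. (if t \<in> C then f t else 0) \<partial>L))"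
proof -
  define m where "m n = distr (uniform_count_measure {..<Suc n}) borel u" for n
  have um: "u \<in> borel_measurable (uniform_count_measure {..<Suc n})" for n
    by (auto simp: measurable_def sets_uniform_count_measure space_uniform_count_measure)
  have pm: "prob_space (m n)" for n
    unfolding m_def by (intro prob_space.prob_space_distr[OF prob_space_uniform_count_measure um]) auto
  have rd: "real_distribution (m n)" for n
    unfolding real_distribution_def real_distribution_axioms_def using pm by (simp add: m_def)
  have int_m: "(\<integral>t. f t \<partial>m n) = (\<Sum>k<Suc n. f (u k)) / real (Suc n)" if "f \<in> borel_measurable borel" for f :: "real \<Rightarrow> real" and n
    unfolding m_def by (subst integral_distr[OF um that]) (simp add: integral_uniform_count_measure)
  have u01: "0 \<le> u k" "u k \<le> 1" "u k \<in> C" for k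
  proof -
    show "u k \<in> C" using u by auto
    then show "0 \<le> u k" "u k \<le> 1" using C(2) by auto
  qed
  have "tight m" unfolding tight_def
  proof (intro conjI allI impI rd)
    fix e :: real assume "e > 0"
    \<comment> \<open>Tightness is stated with intervals open on the left, so the left end must lie
      below 0.\<close>
    have "measure (m n) {-1<..1} = 1" for n
    proof -
      interpret prob_space "m n" by (rule pm)
      have "{-1<..1} \<in> sets (m n)" by (simp add: m_def)
      moreover have "AE t in m n. t \<in> {-1<..1}"
        unfolding m_def using u01 by (subst AE_distr_iff[OF um]) (auto intro!: AE_I2 intro: less_le_trans[of _ 0])
      ultimately show ?thesis by (simp add: prob_eq_1)
    qed
    then have "(-1::real) < 1 \<and> (\<forall>n. 1 - e < measure (m n) {-1<..1})" using \<open>e > 0\<close> by simp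
    then show "\<exists>a b. a < b \<and> (\<forall>n. 1 - e < measure (m n) {a<..b})" by blast
  qed
  from tight_imp_convergent_subsubsequence[OF this strict_mono_id]
  obtain r L where r: "strict_mono r" and L: "real_distribution L" and wc: "weak_conv_m (m \<circ> id \<circ> r) L"
    by blast
  interpret L: real_distribution L by fact
  have lim: "(\<lambda>n. (\<Sum>k<Suc (r n). f (u k)) / real (Suc (r n))) \<longlonglongrightarrow> (\<integral>t. f t \<partial>L)"
    if f: "continuous_on UNIV f" and B: "\<And>t. norm (f t) \<le> B" for f :: "real \<Rightarrow> real" and B
  proof -
    have "(\<lambda>n. \<integral>t. f t \<partial>m (r n)) \<longlonglongrightarrow> (\<integral>t. f t \<partial>L)"
      using weak_conv_imp_integral_bdd_continuous_conv[of "m \<circ> id \<circ> r" L f B] rd L wc f B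
      by (simp add: continuous_on_eq_continuous_at)
    then show ?thesis using int_m[OF borel_measurable_continuous_onI[OF f]] by simp
  qed
  have "closed C" using C compact_imp_closed by blast
  have "C \<noteq> {}" using u by auto
  have AE_C: "AE t in L. t \<in> C"
  proof -
    \<comment> \<open>A bounded continuous function vanishing exactly on \<open>C\<close>: its
      averages along \<open>u\<close> are 0, hence so is its integral under the limit.\<close>
    define f where "f t = min 1 (infdist t C)" for t
    have f: "continuous_on UNIV f" unfolding f_def by (intro continuous_intros)
    have "(\<lambda>n. (\<Sum>k<Suc (r n). f (u k)) / real (Suc (r n))) \<longlonglongrightarrow> (\<integral>t. f t \<partial>L)"
      by (rule lim[OF f, of 1]) (auto simp: f_def infdist_nonneg)
    moreover have "f (u k) = 0" for k using u01 by (simp add: f_def)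
    ultimately have "(\<integral>t. f t \<partial>L) = 0" by (simp add: LIMSEQ_const_iff)
    moreover have int: "integrable L f"
      by (rule L.integrable_const_bound[of _ 1])
         (use borel_measurable_continuous_onI[OF f] in \<open>auto simp: f_def infdist_nonneg intro!: AE_I2\<close>)
    moreover have "(\<integral>t. f t \<partial>L) = 0 \<longleftrightarrow> (AE t in L. f t = 0)"
      by (rule integral_nonneg_eq_0_iff_AE[OF int]) (simp add: f_def infdist_nonneg)
    ultimately have "AE t in L. f t = 0" by blast
    then show ?thesis
    proof (rule eventually_mono)
      fix t assume "f t = 0"
      then have "infdist t C = 0" by (auto simp: f_def min_def split: if_splits)
      then show "t \<in> C" using in_closed_iff_infdist_zero[OF \<open>closed C\<close> \<open>C \<noteq> {}\<close>] by simp
    qed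
  qed
  have "(\<lambda>n. (\<Sum>k<Suc (r n). f (u k)) / real (Suc (r n))) \<longlonglongrightarrow> (\<integral>t. (if t \<in> C then f t else 0) \<partial>L)"
    if f: "continuous_on C f" for f
  proof -
    have "bounded (f ` C)" using compact_continuous_image[OF f C(1)] compact_imp_bounded by blast
    then obtain B where B: "\<And>t. t \<in> C \<Longrightarrow> norm (f t) \<le> B" "0 < B"
      by (auto simp: bounded_pos)
    obtain g where g: "continuous_on UNIV g" "\<And>t. t \<in> C \<Longrightarrow> g t = f t" "\<And>t. norm (g t) \<le> B"
      using Tietze[of C f UNIV B] f B \<open>closed C\<close> by (metis UNIV_I closed_closedin less_imp_le subtopology_UNIV)
    have [measurable]: "C \<in> sets borel" using \<open>closed C\<close> by simp
    have [measurable]: "g \<in> borel_measurable borel" using g(1) by (rule borel_measurable_continuous_onI)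
    have eq: "(\<lambda>t. if t \<in> C then f t else 0) = (\<lambda>t. if t \<in> C then g t else 0)" using g(2) by auto
    have "(\<integral>t. (if t \<in> C then f t else 0) \<partial>L) = (\<integral>t. g t \<partial>L)"
      unfolding eq by (intro integral_cong_AE eventually_mono[OF AE_C]) auto
    moreover have "f (u k) = g (u k)" for k using g(2) u01 by simp
    ultimately show ?thesis using lim[OF g(1,3)] by simp
  qed
  with L AE_C r show ?thesis by blast
qed

text \<open>A separation theorem with a constructive proof: \<open>approachability\<close> yields
  points whose averages vanish on a dense sequence of tests, a weak limit inherits this, and uniform
  density gives the remaining tests. The measure is delivered as the law of a Borel map
  \<open>T\<close> of a real variable, the form from which disintegrations are obtained
  later.\<close>

lemma annihilating_measure_exists:
  fixes S :: "'b::{metric_space, second_countable_topology} set" and H :: "('b \<Rightarrow> real) set"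
  assumes S: "compact S" and cont: "\<And>h. h \<in> H \<Longrightarrow> continuous_on S h"
    and zero: "(\<lambda>_. 0) \<in> H"
    and add: "\<And>g h. g \<in> H \<Longrightarrow> h \<in> H \<Longrightarrow> (\<lambda>x. g x + h x) \<in> H"
    and scale: "\<And>a h. h \<in> H \<Longrightarrow> (\<lambda>x. a * h x) \<in> H"
    and nonneg: "\<And>h. h \<in> H \<Longrightarrow> \<exists>x\<in>S. 0 \<le> h x"
  shows "\<exists>L T. real_distribution L \<and> (AE t in L. 0 \<le> t \<and> t \<le> 1) \<and>
           T \<in> borel_measurable borel \<and> range T \<subseteq> S \<and> (\<forall>h\<in>H. (\<integral>t. h (T t) \<partial>L) = 0)"
proof -
  obtain C T where C: "compact C" "C \<subseteq> {0..1::real}" and T: "continuous_on C T" "T ` C = S"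
    using Hausdorff_Alexandroff[OF S] by blast
  obtain x0 where x0: "x0 \<in> S" using nonneg[OF zero] by blast
  have contT: "continuous_on C (\<lambda>t. h (T t))" if "h \<in> H" for h
    using continuous_on_compose2[OF cont[OF that] T(1)] T(2) by simp
  have "\<exists>d :: nat \<Rightarrow> real \<Rightarrow> real. range d \<subseteq> (\<lambda>h t. h (T t)) ` H \<and>
      (\<forall>h\<in>(\<lambda>h t. h (T t)) ` H. \<forall>e>0. \<exists>j. \<forall>t\<in>C. \<bar>h t - d j t\<bar> < e)"
    by (rule dense_sequence_of_continuous_functions[OF C]) (use contT zero in auto)
  then obtain d :: "nat \<Rightarrow> real \<Rightarrow> real" where d: "range d \<subseteq> (\<lambda>h t. h (T t)) ` H"
    and d_dense: "\<forall>h\<in>(\<lambda>h t. h (T t)) ` H. \<forall>e>0. \<exists>j. \<forall>t\<in>C. \<bar>h t - d j t\<bar> < e"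
    by (elim exE conjE) (rule that, assumption+)
  have dense: "\<exists>j. \<forall>t\<in>C. \<bar>h (T t) - d j t\<bar> < e" if "h \<in> H" "e > 0" for h e
    using d_dense that by simp
  obtain D where D: "\<And>j. D j \<in> H" "\<And>j. d j = (\<lambda>t. D j (T t))"
  proof -
    have "\<forall>j. \<exists>h\<in>H. d j = (\<lambda>t. h (T t))" using d by auto
    then show ?thesis using that by metis
  qed
  have lin: "(\<lambda>x. \<Sum>j<n. a j * D j x) \<in> H" for a :: "nat \<Rightarrow> real" and n
    by (induction n) (use zero add scale D in auto)
  have "\<exists>u. range u \<subseteq> C \<and> (\<forall>j. (\<lambda>n. (\<Sum>k<n. d j (u k)) / real n) \<longlonglongrightarrow> 0)"
  proof (rule approachability)
    fix j
    have "bounded (d j ` C)"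
      unfolding D(2) by (rule compact_imp_bounded[OF compact_continuous_image[OF contT[OF D(1)] C(1)]])
    then show "\<exists>B. \<forall>t\<in>C. \<bar>d j t\<bar> \<le> B" by (auto simp: bounded_iff)
  next
    fix a :: "nat \<Rightarrow> real" and n
    \<comment> \<open>The assumption \<open>nonneg\<close> is applied to minus the combination,
      which is again a test.\<close>
    obtain x where x: "x \<in> S" "0 \<le> - 1 * (\<Sum>j<n. a j * D j x)" using nonneg[OF scale[OF lin[of a n], of "-1"]] by blast
    then obtain t where "t \<in> C" "x = T t" using T(2) by blast
    then show "\<exists>t\<in>C. (\<Sum>j<n. a j * d j t) \<le> 0" using x by (auto simp: D(2))
  qed
  then obtain u where u: "range u \<subseteq> C" and u0: "\<And>j. (\<lambda>n. (\<Sum>k<n. d j (u k)) / real n) \<longlonglongrightarrow> 0" by blast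
  obtain L r where L: "real_distribution L" "AE t in L. t \<in> C" and r: "strict_mono (r :: nat \<Rightarrow> nat)"
    and lim: "\<And>f. continuous_on C f \<Longrightarrow>
        (\<lambda>n. (\<Sum>k<Suc (r n). f (u k)) / real (Suc (r n))) \<longlonglongrightarrow> (\<integral>t. (if t \<in> C then f t else 0) \<partial>L)"
    using weak_limit_of_averages[OF C u] by blast
  interpret L: real_distribution L by fact
  have [measurable]: "C \<in> sets borel" using C compact_imp_closed by (blast intro: borel_closed)
  \<comment> \<open>Off \<open>C\<close>, a null set for \<open>L\<close>, any point of
    \<open>S\<close> will do; this makes the parametrisation total and Borel.\<close>
  define T' where "T' t = (if t \<in> C then T t else x0)" for t
  have "T' \<in> borel_measurable borel" unfolding T'_def
    by (intro borel_measurable_continuous_on_if T(1)) auto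
  moreover have "range T' \<subseteq> S" using T x0 by (auto simp: T'_def)
  moreover have "(\<integral>t. h (T' t) \<partial>L) = 0" if h: "h \<in> H" for h
  proof -
    define I where "I f = (\<integral>t. (if t \<in> C then f t else 0) \<partial>L)" for f :: "real \<Rightarrow> real"
    have "(\<integral>t. h (T' t) \<partial>L) = I (\<lambda>t. h (T t))"
    proof -
      have m: "(\<lambda>t. if t \<in> C then h (T t) else c) \<in> borel_measurable borel" for c
        by (intro borel_measurable_continuous_on_if contT h) auto
      have "(\<lambda>t. h (T' t)) = (\<lambda>t. if t \<in> C then h (T t) else h x0)" by (auto simp: T'_def)
      then show ?thesis unfolding I_def using m by (intro integral_cong_AE eventually_mono[OF L(2)]) (auto simp: T'_def)
    qed
    moreover have "\<bar>I (\<lambda>t. h (T t))\<bar> \<le> e" if e: "e > 0" for e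
    proof -
      obtain j where j: "\<And>t. t \<in> C \<Longrightarrow> \<bar>h (T t) - d j t\<bar> < e" using dense[OF h e] by blast
      let ?avg = "\<lambda>f n. (\<Sum>k<Suc (r n). f (u k)) / real (Suc (r n))"
      have "(\<lambda>n. ?avg (d j) n) \<longlonglongrightarrow> 0"
        using LIMSEQ_subseq_LIMSEQ[OF u0[of j], of "\<lambda>n. Suc (r n)"] r by (simp add: strict_mono_def o_def)
      then have l: "(\<lambda>n. \<bar>?avg (\<lambda>t. h (T t)) n - ?avg (d j) n\<bar>) \<longlonglongrightarrow> \<bar>I (\<lambda>t. h (T t)) - 0\<bar>"
        using lim[OF contT[OF h]] unfolding I_def by (intro tendsto_intros)
      have "\<bar>?avg (\<lambda>t. h (T t)) n - ?avg (d j) n\<bar> \<le> e" for n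
      proof -
        have "\<bar>\<Sum>k<Suc (r n). h (T (u k)) - d j (u k)\<bar> \<le> (\<Sum>k<Suc (r n). e)"
          using u j by (intro order_trans[OF sum_abs] sum_mono) (auto intro!: less_imp_le)
        then have "\<bar>\<Sum>k<Suc (r n). h (T (u k)) - d j (u k)\<bar> / real (Suc (r n)) \<le> e"
          by (simp add: pos_divide_le_eq mult.commute del: sum.lessThan_Suc)
        then show ?thesis
          by (simp add: sum_subtractf diff_divide_distrib[symmetric] del: sum.lessThan_Suc of_nat_Suc)
      qed
      then have "\<bar>I (\<lambda>t. h (T t)) - 0\<bar> \<le> e" by (intro LIMSEQ_le_const2[OF l]) blast
      then show ?thesis by simp
    qed
    ultimately have "\<bar>\<integral>t. h (T' t) \<partial>L\<bar> \<le> 0 + e" if "e > 0" for e using that by simp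
    then have "\<bar>\<integral>t. h (T' t) \<partial>L\<bar> \<le> 0" by (rule field_le_epsilon)
    then show ?thesis by simp
  qed
  moreover have "AE t in L. 0 \<le> t \<and> t \<le> 1" using C(2) by (intro eventually_mono[OF L(2)]) auto
  ultimately show ?thesis using L(1) by blast
qed

section \<open>Kernels and conditional laws\<close>

lemma kernel_prod_measurable:
  assumes [measurable]: "\<kappa> \<in> M \<rightarrow>\<^sub>M prob_algebra N"
  shows "(\<lambda>x. distr (\<kappa> x) (M \<Otimes>\<^sub>M N) (Pair x)) \<in> M \<rightarrow>\<^sub>M prob_algebra (M \<Otimes>\<^sub>M N)"
  by measurable

lemma sets_kernel_prod:
  assumes "prob_space M" "\<kappa> \<in> M \<rightarrow>\<^sub>M prob_algebra N"
  shows "sets (kernel_prod M N \<kappa>) = sets (M \<Otimes>\<^sub>M N)"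
  unfolding kernel_prod_def
  by (rule sets_bind_measurable[OF measurable_prob_algebraD[OF kernel_prod_measurable[OF assms(2)]]])
     (use assms(1) in \<open>simp add: prob_space.not_empty\<close>)

lemma nn_integral_kernel_prod:
  assumes k: "\<kappa> \<in> M \<rightarrow>\<^sub>M prob_algebra N" and f: "f \<in> borel_measurable (M \<Otimes>\<^sub>M N)"
  shows "(\<integral>\<^sup>+z. f z \<partial>kernel_prod M N \<kappa>) = (\<integral>\<^sup>+x. \<integral>\<^sup>+y. f (x, y) \<partial>\<kappa> x \<partial>M)"
  unfolding kernel_prod_def
proof (subst nn_integral_bind[OF f measurable_prob_algebraD[OF kernel_prod_measurable[OF k]]],
    intro nn_integral_cong)
  fix x assume x: "x \<in> space M"
  have "sets (\<kappa> x) = sets N"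
    using measurable_space[OF k x] by (simp add: space_prob_algebra)
  then show "(\<integral>\<^sup>+z. f z \<partial>distr (\<kappa> x) (M \<Otimes>\<^sub>M N) (Pair x)) = (\<integral>\<^sup>+y. f (x, y) \<partial>\<kappa> x)"
    using x f by (subst nn_integral_distr) (auto cong: measurable_cong_sets)
qed

lemma prob_space_kernel_prod:
  assumes "prob_space M" "\<kappa> \<in> M \<rightarrow>\<^sub>M prob_algebra N"
  shows "prob_space (kernel_prod M N \<kappa>)"
proof -
  have M: "M \<in> space (prob_algebra M)" using assms(1) by (simp add: space_prob_algebra)
  have "kernel_prod M N \<kappa> \<in> space (prob_algebra (M \<Otimes>\<^sub>M N))"
    unfolding kernel_prod_def
    using measurable_bind_prob_space[OF measurable_const[OF M] kernel_prod_measurable[OF assms(2)], of "count_space UNIV"] 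
    by (auto dest: measurable_space)
  then show ?thesis by (simp add: space_prob_algebra)
qed

lemma kernel_integral_measurable:
  fixes f :: "'a \<times> 'b \<Rightarrow> 'c::{banach, second_countable_topology}"
  assumes k: "\<kappa> \<in> M \<rightarrow>\<^sub>M prob_algebra N" and f: "f \<in> borel_measurable (M \<Otimes>\<^sub>M N)"
  shows "(\<lambda>x. \<integral>y. f (x, y) \<partial>\<kappa> x) \<in> borel_measurable M"
proof -
  have "(\<lambda>x. \<integral>z. f z \<partial>distr (\<kappa> x) (M \<Otimes>\<^sub>M N) (Pair x)) \<in> borel_measurable M"
    by (rule measurable_compose[OF measurable_prob_algebraD[OF kernel_prod_measurable[OF k]]
          integral_measurable_subprob_algebra[OF f]])
  moreover have "(\<integral>z. f z \<partial>distr (\<kappa> x) (M \<Otimes>\<^sub>M N) (Pair x)) = (\<integral>y. f (x, y) \<partial>\<kappa> x)" if x: "x \<in> space M" for x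
  proof -
    have "sets (\<kappa> x) = sets N"
      using measurable_space[OF k x] by (simp add: space_prob_algebra)
    then show ?thesis
      using x f by (subst integral_distr) (auto cong: measurable_cong_sets)
  qed
  ultimately show ?thesis by (simp cong: measurable_cong)
qed

text \<open>Adding the bound B makes the integrand nonnegative and reduces the claim to
  \<open>nn_integral_kernel_prod\<close>. All measures involved are probabilities, so both sides
  gain the same constant.\<close>

lemma integral_kernel_prod:
  fixes f :: "'a \<times> 'b \<Rightarrow> real"
  assumes M: "prob_space M" and k: "\<kappa> \<in> M \<rightarrow>\<^sub>M prob_algebra N"
    and f: "f \<in> borel_measurable (M \<Otimes>\<^sub>M N)" and bdd: "\<And>z. z \<in> space (M \<Otimes>\<^sub>M N) \<Longrightarrow> \<bar>f z\<bar> \<le> B"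
  shows "(\<integral>z. f z \<partial>kernel_prod M N \<kappa>) = (\<integral>x. \<integral>y. f (x, y) \<partial>\<kappa> x \<partial>M)"
proof -
  interpret M: prob_space M by fact
  interpret P: prob_space "kernel_prod M N \<kappa>" by (rule prob_space_kernel_prod[OF M k])
  note sets_P[measurable_cong] = sets_kernel_prod[OF M k]
  have spP: "space (kernel_prod M N \<kappa>) = space (M \<Otimes>\<^sub>M N)" by (rule sets_eq_imp_space_eq[OF sets_P])
  have fP: "f \<in> borel_measurable (kernel_prod M N \<kappa>)" using f by measurable
  have k1: "prob_space (\<kappa> x)" "sets (\<kappa> x) = sets N" "space (\<kappa> x) = space N" if "x \<in> space M" for x
    using measurable_space[OF k that] by (auto simp: space_prob_algebra dest: sets_eq_imp_space_eq)
  have bd: "\<bar>f (x, y)\<bar> \<le> B" if "x \<in> space M" "y \<in> space N" for x y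
    using that by (intro bdd) (simp add: space_pair_measure)
  have kf: "integrable (\<kappa> x) (\<lambda>y. f (x, y))" if x: "x \<in> space M" for x
  proof -
    interpret K: prob_space "\<kappa> x" by (rule k1[OF x])
    note k1(2)[OF x, measurable_cong]
    show ?thesis
      by (rule K.integrable_const_bound[of _ B]) (use f x bd k1(3)[OF x] in \<open>auto intro!: AE_I2\<close>)
  qed
  have inner: "(\<integral>\<^sup>+y. ennreal (f (x, y) + B) \<partial>\<kappa> x) = ennreal ((\<integral>y. f (x, y) \<partial>\<kappa> x) + B)" if x: "x \<in> space M" for x
  proof -
    interpret K: prob_space "\<kappa> x" by (rule k1[OF x])
    have "(\<integral>\<^sup>+y. ennreal (f (x, y) + B) \<partial>\<kappa> x) = ennreal (\<integral>y. f (x, y) + B \<partial>\<kappa> x)"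
      using x bd k1(3)[OF x] kf[OF x] by (intro nn_integral_eq_integral) (force intro!: AE_I2)+
    then show ?thesis using kf[OF x] by (simp add: K.prob_space)
  qed
  have ge: "0 \<le> (\<integral>y. f (x, y) \<partial>\<kappa> x) + B" "\<bar>\<integral>y. f (x, y) \<partial>\<kappa> x\<bar> \<le> B" if x: "x \<in> space M" for x
  proof -
    interpret K: prob_space "\<kappa> x" by (rule k1[OF x])
    have "- B \<le> (\<integral>y. f (x, y) \<partial>\<kappa> x)"
      using x bd k1(3)[OF x] by (intro K.integral_ge_const kf) (force intro!: AE_I2)+
    moreover have "(\<integral>y. f (x, y) \<partial>\<kappa> x) \<le> B"
      using x bd k1(3)[OF x] by (intro K.integral_le_const kf) (force intro!: AE_I2)+
    ultimately show "0 \<le> (\<integral>y. f (x, y) \<partial>\<kappa> x) + B" "\<bar>\<integral>y. f (x, y) \<partial>\<kappa> x\<bar> \<le> B" by auto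
  qed
  have iP: "integrable (kernel_prod M N \<kappa>) f"
    by (rule P.integrable_const_bound[of _ B]) (use fP bdd spP in \<open>auto intro!: AE_I2\<close>)
  have iM: "integrable M (\<lambda>x. \<integral>y. f (x, y) \<partial>\<kappa> x)"
    by (rule M.integrable_const_bound[of _ B])
       (use ge(2) kernel_integral_measurable[OF k f] in \<open>auto intro!: AE_I2\<close>)
  have "ennreal ((\<integral>z. f z \<partial>kernel_prod M N \<kappa>) + B) = ennreal (\<integral>z. f z + B \<partial>kernel_prod M N \<kappa>)"
    using iP by (simp add: P.prob_space)
  also have "\<dots> = (\<integral>\<^sup>+z. ennreal (f z + B) \<partial>kernel_prod M N \<kappa>)"
    using iP bdd spP by (intro nn_integral_eq_integral[symmetric]) (force intro!: AE_I2)+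
  also have "\<dots> = (\<integral>\<^sup>+x. \<integral>\<^sup>+y. ennreal (f (x, y) + B) \<partial>\<kappa> x \<partial>M)"
    using f by (subst nn_integral_kernel_prod[OF k]) auto
  also have "\<dots> = (\<integral>\<^sup>+x. ennreal ((\<integral>y. f (x, y) \<partial>\<kappa> x) + B) \<partial>M)"
    by (intro nn_integral_cong inner)
  also have "\<dots> = ennreal (\<integral>x. (\<integral>y. f (x, y) \<partial>\<kappa> x) + B \<partial>M)"
    using iM ge by (intro nn_integral_eq_integral) (auto intro!: AE_I2)
  also have "(\<integral>x. (\<integral>y. f (x, y) \<partial>\<kappa> x) + B \<partial>M) = (\<integral>x. \<integral>y. f (x, y) \<partial>\<kappa> x \<partial>M) + B"
    using iM by (simp add: M.prob_space)
  finally have "ennreal ((\<integral>z. f z \<partial>kernel_prod M N \<kappa>) + B) = ennreal ((\<integral>x. \<integral>y. f (x, y) \<partial>\<kappa> x \<partial>M) + B)" .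
  moreover have "- B \<le> (\<integral>z. f z \<partial>kernel_prod M N \<kappa>)"
    using bdd spP iP by (intro P.integral_ge_const) (force intro!: AE_I2)+
  moreover have "- B \<le> (\<integral>x. \<integral>y. f (x, y) \<partial>\<kappa> x \<partial>M)"
    using ge by (intro M.integral_ge_const iM) (force intro!: AE_I2)+
  ultimately show ?thesis by (simp add: ennreal_inj)
qed

section \<open>Conditional laws of a real random variable\<close>

lemma AE_le_if_set_nn_integral_le:
  assumes [measurable]: "f \<in> borel_measurable M" "g \<in> borel_measurable M"
    and fin: "(\<integral>\<^sup>+x. g x \<partial>M) \<noteq> \<infinity>"
    and le: "\<And>A. A \<in> sets M \<Longrightarrow> (\<integral>\<^sup>+x. f x * indicator A x \<partial>M) \<le> (\<integral>\<^sup>+x. g x * indicator A x \<partial>M)"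
  shows "AE x in M. f x \<le> g x"
proof -
  \<comment> \<open>The exceptional set is itself the test set; finiteness of the integral of g
    turns a failure into a strict inequality of integrals.\<close>
  define A where "A = {x \<in> space M. g x < f x}"
  have [measurable]: "A \<in> sets M" by (simp add: A_def)
  have "(\<integral>\<^sup>+x. g x * indicator A x \<partial>M) \<le> (\<integral>\<^sup>+x. g x \<partial>M)"
    by (intro nn_integral_mono) (auto simp: indicator_def)
  then have f: "(\<integral>\<^sup>+x. g x * indicator A x \<partial>M) \<noteq> \<infinity>" using fin by (auto simp: top_unique)
  have "AE x in M. f x * indicator A x \<le> g x * indicator A x"
  proof (rule ccontr)
    assume "\<not> (AE x in M. f x * indicator A x \<le> g x * indicator A x)"
    then have "(\<integral>\<^sup>+x. g x * indicator A x \<partial>M) < (\<integral>\<^sup>+x. f x * indicator A x \<partial>M)"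
      by (intro nn_integral_less f) (auto simp: A_def indicator_def intro!: AE_I2)
    with le[of A] show False by auto
  qed
  then show ?thesis
    by (rule AE_mp) (auto intro!: AE_I2 simp: A_def indicator_def split: if_splits)
qed

text \<open>
  The kernel is the law of the quantile \<open>Y x w\<close> under a uniformly distributed \<open>w\<close>, where the
  conditional tail probabilities at rational levels are Radon-Nikodym densities. Taking the supremum
  over rational levels only makes a correction on null sets unnecessary.
\<close>

lemma conditional_law_exists:
  fixes L :: "real measure" and G :: "real \<Rightarrow> 'b"
  assumes L: "real_distribution L" and supp: "AE t in L. 0 \<le> t \<and> t \<le> 1"
    and G: "G \<in> borel \<rightarrow>\<^sub>M N"
  shows "\<exists>\<eta>. \<eta> \<in> N \<rightarrow>\<^sub>M prob_algebra borel \<and>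
           distr L (N \<Otimes>\<^sub>M borel) (\<lambda>t. (G t, t)) = kernel_prod (distr L N G) borel \<eta>"
proof -
  interpret L: real_distribution L by fact
  have [measurable]: "G \<in> L \<rightarrow>\<^sub>M N" using G by measurable
  define \<mu> where "\<mu> = distr L N G"
  have [measurable_cong, simp]: "sets \<mu> = sets N" by (simp add: \<mu>_def)
  have [simp]: "space \<mu> = space N" by (simp add: \<mu>_def)
  interpret M: prob_space \<mu> unfolding \<mu>_def by (rule L.prob_space_distr) simp
  \<comment> \<open>The part of the law of \<open>G\<close> coming from t \<ge> q. Its density
    \<open>f q\<close> is a version of the conditional probability of t \<ge> q given
    \<open>G\<close>.\<close>
  define \<nu> where "\<nu> q = distr (density L (indicator {of_rat q..})) N G" for q :: rat
  have \<nu>: "emeasure (\<nu> q) A = emeasure L (G -` A \<inter> {of_rat q..})" if A[measurable]: "A \<in> sets N" for q A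
  proof -
    have [measurable]: "G -` A \<in> sets borel" using measurable_sets[OF G A] by simp
    show ?thesis unfolding \<nu>_def
      by (simp add: emeasure_distr emeasure_restricted Int_commute)
  qed
  have \<mu>: "emeasure \<mu> A = emeasure L (G -` A)" if "A \<in> sets N" for A
    using that by (simp add: \<mu>_def emeasure_distr)
  have [measurable]: "A \<in> sets N \<Longrightarrow> G -` A \<in> sets borel" for A using measurable_sets[OF G, of A] by simp
  have "\<exists>f\<in>borel_measurable \<mu>. density \<mu> f = \<nu> q" for q
  proof (rule M.Radon_Nikodym)
    show "absolutely_continuous \<mu> (\<nu> q)" unfolding absolutely_continuous_def
    proof
      fix A assume "A \<in> null_sets \<mu>"
      then have "A \<in> sets N" "emeasure L (G -` A) = 0" by (auto simp: null_sets_def \<mu>)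
      moreover from this have "emeasure L (G -` A \<inter> {of_rat q..}) \<le> 0"
        by (metis emeasure_mono Int_lower1 L.M_is_borel \<open>\<And>A. A \<in> sets N \<Longrightarrow> G -` A \<in> sets borel\<close>)
      ultimately show "A \<in> null_sets (\<nu> q)" by (auto simp: null_sets_def \<nu>) (simp add: \<nu>_def)
    qed
  qed (simp add: \<nu>_def)
  then obtain f where f[measurable]: "\<And>q. f q \<in> borel_measurable \<mu>" and df: "\<And>q. density \<mu> (f q) = \<nu> q"
    by metis
  have [measurable]: "f q \<in> borel_measurable N" for q using f[of q] by simp
  have int_f: "(\<integral>\<^sup>+x. f q x * indicator A x \<partial>\<mu>) = emeasure L (G -` A \<inter> {of_rat q..})" if "A \<in> sets N" for q A
    using that df[of q] \<nu>[of A q] emeasure_density[of "f q" \<mu> A] by simp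
  have f1: "AE x in \<mu>. f q x \<le> 1" for q
  proof (rule AE_le_if_set_nn_integral_le)
    fix A assume A: "A \<in> sets \<mu>"
    have "emeasure L (G -` A \<inter> {of_rat q..}) \<le> emeasure L (G -` A)"
      using A by (intro emeasure_mono) auto
    then show "(\<integral>\<^sup>+x. f q x * indicator A x \<partial>\<mu>) \<le> (\<integral>\<^sup>+x. 1 * indicator A x \<partial>\<mu>)"
      using A by (simp add: int_f \<mu>)
  qed (auto simp: M.emeasure_space_1[simplified])
  have fmono: "AE x in \<mu>. f q x \<le> f p x" if "p \<le> q" for p q
  proof (rule AE_le_if_set_nn_integral_le)
    have "(\<integral>\<^sup>+x. f p x \<partial>\<mu>) = (\<integral>\<^sup>+x. f p x * indicator (space N) x \<partial>\<mu>)"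
      by (intro nn_integral_cong) simp
    then show "(\<integral>\<^sup>+x. f p x \<partial>\<mu>) \<noteq> \<infinity>" by (simp add: int_f)
    fix A assume A: "A \<in> sets \<mu>"
    have "emeasure L (G -` A \<inter> {of_rat q..}) \<le> emeasure L (G -` A \<inter> {of_rat p..})"
      using A that by (intro emeasure_mono) (auto simp: of_rat_less_eq intro: order_trans[rotated])
    then show "(\<integral>\<^sup>+x. f q x * indicator A x \<partial>\<mu>) \<le> (\<integral>\<^sup>+x. f p x * indicator A x \<partial>\<mu>)"
      using A by (simp add: int_f)
  qed auto
  define U :: "real measure" where "U = uniform_measure lborel {0..1}"
  have [measurable_cong, simp]: "sets U = sets borel" by (simp add: U_def)
  have [simp]: "space U = UNIV" by (simp add: U_def)
  interpret U: prob_space U unfolding U_def by (rule prob_space_uniform_measure) auto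
  have U: "emeasure U A = emeasure lborel ({0..1} \<inter> A)" if "A \<in> sets borel" for A
    using that by (simp add: U_def divide_ennreal_def)
  \<comment> \<open>A generalised inverse of the conditional tail: the supremum of the levels whose
    tail probability is at least w. The cap 1 bounds the supremum and the alternative value 0 keeps
    it nonnegative; both fit the support of \<open>L\<close>.\<close>
  define Y where "Y = (\<lambda>x w. SUP q::rat. if of_rat q \<le> (1::real) \<and> ennreal w \<le> f q x then of_rat q else 0 :: real)"
  have bdd: "bdd_above (range (\<lambda>q::rat. if of_rat q \<le> (1::real) \<and> ennreal w \<le> f q x then of_rat q else 0 :: real))" for x w
    by (intro bdd_aboveI2[of _ _ 1]) auto
  have Ym: "(\<lambda>(x, w). Y x w) \<in> borel_measurable (N \<Otimes>\<^sub>M U)"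
    unfolding Y_def split_beta' by (intro borel_measurable_cSUP bdd) auto
  have Ygt: "Y x w > r \<longleftrightarrow> (\<exists>q. r < of_rat q \<and> of_rat q \<le> (1::real) \<and> ennreal w \<le> f q x)" if "r \<ge> 0" for x w r
    unfolding Y_def using that by (subst less_cSUP_iff[OF _ bdd]) (auto split: if_splits)
  have Yneg: "Y x w > r" if "r < 0" for x w r
  proof -
    \<comment> \<open>The level 2 exceeds the cap, so its term is 0 and bounds the supremum from
      below.\<close>
    have "(\<lambda>q::rat. if of_rat q \<le> (1::real) \<and> ennreal w \<le> f q x then of_rat q else 0 :: real) 2 \<le> Y x w"
      unfolding Y_def by (rule cSUP_upper[OF _ bdd]) auto
    then show ?thesis using that by simp
  qed
  define \<eta> where "\<eta> = (\<lambda>x. distr U borel (Y x))"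
  have \<eta>: "\<eta> \<in> N \<rightarrow>\<^sub>M prob_algebra borel" unfolding \<eta>_def
    by (rule measurable_distr_prob_space2[OF _ Ym]) (simp add: space_prob_algebra U.prob_space_axioms)
  then have \<eta>\<mu>: "\<eta> \<in> \<mu> \<rightarrow>\<^sub>M prob_algebra borel" by measurable
  have Yx[measurable]: "Y x \<in> borel_measurable U" if "x \<in> space N" for x
    using measurable_compose[OF measurable_Pair1'[OF that] Ym] by simp
  have em\<eta>: "emeasure (\<eta> x) {r<..} = emeasure U {w. Y x w > r}" if "x \<in> space N" for x r
    unfolding \<eta>_def using that by (subst emeasure_distr) (auto intro!: arg_cong[where f = "emeasure U"])
  have tail: "(\<integral>\<^sup>+x. emeasure (\<eta> x) {r<..} * indicator A x \<partial>\<mu>) = emeasure L (G -` A \<inter> {r<..})"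
    if A[measurable]: "A \<in> sets N" for A r
  \<comment> \<open>Negative levels are separate because \<open>Y\<close> never drops below 0. There
    both sides are the full mass of \<open>A\<close>, as \<open>L\<close> lives on [0, 1].\<close>
  proof (cases "r < 0")
    case True
    have "emeasure (\<eta> x) {r<..} = 1" if "x \<in> space N" for x
      using em\<eta>[OF that, of r] Yneg[OF True] U.emeasure_space_1 by simp
    then have "(\<integral>\<^sup>+x. emeasure (\<eta> x) {r<..} * indicator A x \<partial>\<mu>) = (\<integral>\<^sup>+x. indicator A x \<partial>\<mu>)"
      by (intro nn_integral_cong) simp
    also have "\<dots> = emeasure L (G -` A)" by (simp add: \<mu>)
    also have "\<dots> = emeasure L (G -` A \<inter> {r<..})"
      using True by (intro emeasure_eq_AE eventually_mono[OF supp]) auto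
    finally show ?thesis .
  next
    case False
    then have r: "r \<ge> 0" by simp
    define R where "R = {q::rat. r < of_rat q \<and> of_rat q \<le> (1::real)}"
    have sup: "AE x in \<mu>. emeasure (\<eta> x) {r<..} = (SUP q\<in>R. f q x)"
    proof -
      have "AE x in \<mu>. \<forall>q. f q x \<le> 1" using f1 by (simp add: AE_all_countable)
      then show ?thesis
      proof (rule AE_mp, intro AE_I2 impI)
        fix x assume x: "x \<in> space \<mu>" and le1: "\<forall>q. f q x \<le> 1"
        define s where "s = (SUP q\<in>R. f q x)"
        have s1: "s \<le> 1" using le1 unfolding s_def by (intro SUP_least) auto
        define s' where "s' = enn2real s"
        have s': "s = ennreal s'" "0 \<le> s'" "s' \<le> 1"
          using s1 by (auto simp: s'_def ennreal_enn2real_if top_unique enn2real_leI)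
        have eq: "{w. Y x w > r} = {w. \<exists>q\<in>R. ennreal w \<le> f q x}"
          using Ygt[OF r] by (auto simp: R_def)
        have m: "{w. Y x w > r} \<in> sets borel"
          using measurable_sets[OF Yx, of x "{r<..}"] x by (simp add: vimage_def)
        \<comment> \<open>The event in w lies between {0..<s'} and {0..s'}, depending on whether the
          supremum is attained. Both intervals have length s'.\<close>
        have "emeasure lborel ({0..1} \<inter> {w. Y x w > r}) \<le> emeasure lborel {0..s'}"
        proof (rule emeasure_mono)
          show "{0..1} \<inter> {w. Y x w > r} \<subseteq> {0..s'}"
          proof
            fix w assume "w \<in> {0..1} \<inter> {w. Y x w > r}"
            then obtain q where "0 \<le> w" "q \<in> R" "ennreal w \<le> f q x" unfolding eq by auto
            then have "ennreal w \<le> ennreal s'"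
              unfolding s'(1)[symmetric] s_def by (intro SUP_upper2[of q])
            then show "w \<in> {0..s'}" using \<open>0 \<le> w\<close> s' by (simp add: ennreal_le_iff)
          qed
        qed simp
        moreover have "emeasure lborel {0..<s'} \<le> emeasure lborel ({0..1} \<inter> {w. Y x w > r})"
        proof (rule emeasure_mono)
          show "{0..<s'} \<subseteq> {0..1} \<inter> {w. Y x w > r}"
          proof
            fix w assume w: "w \<in> {0..<s'}"
            then have "ennreal w < s" using s' by (simp add: ennreal_lessI)
            then obtain q where "q \<in> R" "ennreal w < f q x" unfolding s_def less_SUP_iff by auto
            then show "w \<in> {0..1} \<inter> {w. Y x w > r}" using w s' unfolding eq by force
          qed
        qed (use m in simp)
        ultimately show "emeasure (\<eta> x) {r<..} = (SUP q\<in>R. f q x)"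
          using x s' m by (simp add: em\<eta> U flip: s_def)
      qed
    qed
    have "(\<integral>\<^sup>+x. (SUP q\<in>R. f q x) * indicator A x \<partial>\<mu>) = emeasure L (G -` A \<inter> {r<..})"
    \<comment> \<open>If no rational level lies in (r, 1], then 1 \<le> r; the empty supremum is 0
      and \<open>L\<close> has no mass above 1.\<close>
    proof (cases "R = {}")
      case True
      have "1 \<le> r"
      proof (rule ccontr)
        assume "\<not> 1 \<le> r"
        then have "r < of_rat 1" by simp
        then show False using True by (force simp: R_def)
      qed
      then have "emeasure L (G -` A \<inter> {r<..}) = emeasure L {}"
        by (intro emeasure_eq_AE eventually_mono[OF supp]) auto
      then show ?thesis using True by (simp add: bot_ennreal)
    next
      case False
      \<comment> \<open>An enumeration of \<open>R\<close> has no order. Its running minima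
        \<open>p n\<close> decrease, so the densities \<open>f (p n)\<close> increase almost
        everywhere and monotone convergence applies.\<close>
      define e where "e = from_nat_into R"
      have e: "range e = R" using False by (simp add: e_def)
      define p where "p n = Min (e ` {..n})" for n
      have pR: "p n \<in> R" for n
      proof -
        have "p n \<in> e ` {..n}" unfolding p_def by (rule Min_in) auto
        then show ?thesis using e by auto
      qed
      have p_le: "p n \<le> e n" for n unfolding p_def by (intro Min_le) auto
      have p_dec: "p (Suc n) \<le> p n" for n unfolding p_def by (intro Min_antimono) auto
      have "AE x in \<mu>. \<forall>n. f (p n) x \<le> f (p (Suc n)) x \<and> f (e n) x \<le> f (p n) x"
        using fmono p_le p_dec by (auto simp: AE_all_countable)
      then have mono: "AE x in \<mu>. \<forall>n. f (p n) x \<le> f (p (Suc n)) x \<and> f (e n) x \<le> f (p n) x" .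
      then have "AE x in \<mu>. (SUP q\<in>R. f q x) = (SUP n. f (p n) x)"
      proof (rule AE_mp, intro AE_I2 impI antisym SUP_least)
        fix x q assume h: "\<forall>n. f (p n) x \<le> f (p (Suc n)) x \<and> f (e n) x \<le> f (p n) x" and "q \<in> R"
        then obtain n where "q = e n" using e by auto
        then show "f q x \<le> (SUP n. f (p n) x)" using h by (auto intro: SUP_upper2[of n])
      next
        fix x n show "f (p n) x \<le> (SUP q\<in>R. f q x)" using pR by (intro SUP_upper) auto
      qed
      then have "(\<integral>\<^sup>+x. (SUP q\<in>R. f q x) * indicator A x \<partial>\<mu>) = (\<integral>\<^sup>+x. (SUP n. f (p n) x * indicator A x) \<partial>\<mu>)"
        by (intro nn_integral_cong_AE) (auto elim!: eventually_mono simp: SUP_mult_right_ennreal[symmetric])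
      also have "\<dots> = (SUP n. \<integral>\<^sup>+x. f (p n) x * indicator A x \<partial>\<mu>)"
        by (rule nn_integral_monotone_convergence_SUP_AE)
           (use mono in \<open>auto elim!: eventually_mono intro!: mult_right_mono\<close>)
      also have "\<dots> = (SUP n. emeasure L (G -` A \<inter> {of_rat (p n)..}))" by (simp add: int_f)
      also have "\<dots> = emeasure L (\<Union>n. G -` A \<inter> {of_rat (p n)..})"
      proof (rule SUP_emeasure_incseq)
        show "incseq (\<lambda>n. G -` A \<inter> {real_of_rat (p n)..})"
        proof (rule incseq_SucI)
          fix n
          have "real_of_rat (p (Suc n)) \<le> of_rat (p n)" using p_dec by (simp add: of_rat_less_eq)
          then show "G -` A \<inter> {real_of_rat (p n)..} \<subseteq> G -` A \<inter> {real_of_rat (p (Suc n))..}" by auto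
        qed
      qed auto
      also have "\<dots> = emeasure L (G -` A \<inter> {r<..})"
      proof (rule emeasure_eq_AE)
        show "AE t in L. t \<in> (\<Union>n. G -` A \<inter> {of_rat (p n)..}) \<longleftrightarrow> t \<in> G -` A \<inter> {r<..}"
          using supp
        proof (rule AE_mp, intro AE_I2 impI)
          fix t :: real assume t: "0 \<le> t \<and> t \<le> 1"
          have "(\<exists>n. of_rat (p n) \<le> t) \<longleftrightarrow> r < t"
          proof
            assume "\<exists>n. of_rat (p n) \<le> t"
            then obtain n where "of_rat (p n) \<le> t" by blast
            moreover have "r < of_rat (p n)" using pR[of n] by (simp add: R_def)
            ultimately show "r < t" by linarith
          next
            assume "r < t"
            then obtain q where q: "r < of_rat q" "of_rat q < t" using of_rat_dense by blast
            moreover have "real_of_rat q \<le> 1" using q t by linarith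
            ultimately have "q \<in> R" by (simp add: R_def)
            then obtain n where "q = e n" using e by auto
            then have "p n \<le> q" using p_le by simp
            then have "real_of_rat (p n) \<le> of_rat q" by (simp add: of_rat_less_eq)
            then show "\<exists>n. of_rat (p n) \<le> t" using q by (intro exI[of _ n]) linarith
          qed
          then show "t \<in> (\<Union>n. G -` A \<inter> {of_rat (p n)..}) \<longleftrightarrow> t \<in> G -` A \<inter> {r<..}" by auto
        qed
      qed auto
      finally show ?thesis .
    qed
    then show ?thesis using sup
      by (subst nn_integral_cong_AE[where v = "\<lambda>x. (SUP q\<in>R. f q x) * indicator A x"]) (auto elim!: eventually_mono)
  qed
  have rect: "emeasure (kernel_prod \<mu> borel \<eta>) (A \<times> B) = (\<integral>\<^sup>+x. emeasure (\<eta> x) B * indicator A x \<partial>\<mu>)"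
    if [measurable]: "A \<in> sets N" "B \<in> sets borel" for A B
  proof -
    have "emeasure (kernel_prod \<mu> borel \<eta>) (A \<times> B) = (\<integral>\<^sup>+z. indicator (A \<times> B) z \<partial>kernel_prod \<mu> borel \<eta>)"
      using sets_kernel_prod[OF M.prob_space_axioms \<eta>\<mu>] by (intro nn_integral_indicator[symmetric]) simp
    also have "\<dots> = (\<integral>\<^sup>+x. \<integral>\<^sup>+y. indicator (A \<times> B) (x, y) \<partial>\<eta> x \<partial>\<mu>)"
      by (rule nn_integral_kernel_prod[OF \<eta>\<mu>]) measurable
    also have "\<dots> = (\<integral>\<^sup>+x. emeasure (\<eta> x) B * indicator A x \<partial>\<mu>)"
    proof (rule nn_integral_cong)
      fix x assume "x \<in> space \<mu>"
      then have "sets (\<eta> x) = sets borel" using measurable_space[OF \<eta>, of x] by (simp add: space_prob_algebra)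
      then show "(\<integral>\<^sup>+y. indicator (A \<times> B) (x, y) \<partial>\<eta> x) = emeasure (\<eta> x) B * indicator A x"
        by (simp add: indicator_times nn_integral_cmult_indicator mult.commute)
    qed
    finally show ?thesis .
  qed
  have "distr L (N \<Otimes>\<^sub>M borel) (\<lambda>t. (G t, t)) = kernel_prod \<mu> borel \<eta>"
  proof (rule measure_eqI_generator_eq[OF Int_stable_pair_measure_generator pair_measure_closed, of N borel])
    show "sets (distr L (N \<Otimes>\<^sub>M borel) (\<lambda>t. (G t, t))) = sigma_sets (space N \<times> space borel) {a \<times> b |a b. a \<in> sets N \<and> b \<in> sets borel}"
      by (simp add: sets_pair_measure)
    show "sets (kernel_prod \<mu> borel \<eta>) = sigma_sets (space N \<times> space borel) {a \<times> b |a b. a \<in> sets N \<and> b \<in> sets (borel :: real measure)}"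
      using sets_kernel_prod[OF M.prob_space_axioms \<eta>\<mu>] by (simp add: sets_pair_measure cong: sets_pair_measure_cong)
    show "range (\<lambda>_. space N \<times> (UNIV::real set)) \<subseteq> {a \<times> b |a b. a \<in> sets N \<and> b \<in> sets borel}"
    proof -
      have "space N \<in> sets N" "(UNIV :: real set) \<in> sets borel" by auto
      then show ?thesis by blast
    qed
    show "(\<Union>i::nat. space N \<times> (UNIV::real set)) = space N \<times> space borel" by auto
    show "emeasure (distr L (N \<Otimes>\<^sub>M borel) (\<lambda>t. (G t, t))) (space N \<times> UNIV) \<noteq> \<infinity>"
      by (subst emeasure_distr) (auto)
    fix Z :: "('b \<times> real) set" assume "Z \<in> {a \<times> b |a b. a \<in> sets N \<and> b \<in> sets borel}"
    then obtain A B where AB[measurable]: "A \<in> sets N" "B \<in> sets borel" and Z: "Z = A \<times> B" by auto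
    note [measurable_cong] = sets_kernel_prod[OF M.prob_space_axioms \<eta>\<mu>]
    \<comment> \<open>For fixed A both sides are finite measures in the second factor. On the reals
      such measures are determined by open upper half-lines, where \<open>tail\<close>
      applies.\<close>
    let ?P = "distr (density L (indicator (G -` A))) borel (\<lambda>t. t)"
    let ?Q = "distr (density (kernel_prod \<mu> borel \<eta>) (indicator (A \<times> UNIV))) borel snd"
    have P: "emeasure ?P C = emeasure L (G -` A \<inter> C)" if [measurable]: "C \<in> sets borel" for C
      by (simp add: emeasure_distr emeasure_restricted)
    have Q: "emeasure ?Q C = emeasure (kernel_prod \<mu> borel \<eta>) (A \<times> C)" if C[measurable]: "C \<in> sets borel" for C
    proof -
      have s: "snd -` C \<inter> space (kernel_prod \<mu> borel \<eta>) = space N \<times> C"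
        using sets_eq_imp_space_eq[OF sets_kernel_prod[OF M.prob_space_axioms \<eta>\<mu>]] by (auto simp: space_pair_measure)
      have "A \<subseteq> space N" using sets.sets_into_space[OF AB(1)] .
      then have "(A \<times> UNIV) \<inter> (space N \<times> C) = A \<times> C" by auto
      then show ?thesis
        by (simp add: emeasure_distr emeasure_restricted s)
    qed
    have "?P = ?Q"
    proof (rule measure_eqI_lessThan)
      show "emeasure ?P {x<..} < \<infinity>" for x by (simp add: P less_top[symmetric])
      show "emeasure ?P {x<..} = emeasure ?Q {x<..}" for x
        using tail[OF AB(1), of x] by (simp add: P Q rect)
    qed auto
    then have "emeasure L (G -` A \<inter> B) = emeasure (kernel_prod \<mu> borel \<eta>) (A \<times> B)"
      using P[OF AB(2)] Q[OF AB(2)] by simp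
    moreover have "emeasure (distr L (N \<Otimes>\<^sub>M borel) (\<lambda>t. (G t, t))) Z = emeasure L (G -` A \<inter> B)"
      unfolding Z by (subst emeasure_distr) (auto intro!: arg_cong[where f = "emeasure L"])
    ultimately show "emeasure (distr L (N \<Otimes>\<^sub>M borel) (\<lambda>t. (G t, t))) Z = emeasure (kernel_prod \<mu> borel \<eta>) Z"
      unfolding Z by simp
  qed
  with \<eta> show ?thesis unfolding \<mu>_def by blast
qed

section \<open>Duality along a chain in convex order\<close>

lemma convex_on_SUP:
  fixes f :: "'i \<Rightarrow> 'a::real_vector \<Rightarrow> real"
  assumes "I \<noteq> {}" "\<And>i. i \<in> I \<Longrightarrow> convex_on UNIV (f i)" "\<And>y. bdd_above ((\<lambda>i. f i y) ` I)"
  shows "convex_on UNIV (\<lambda>y. SUP i\<in>I. f i y)"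
proof (rule convex_onI)
  fix t :: real and x y :: 'a
  assume t: "0 < t" "t < 1"
  show "(SUP i\<in>I. f i ((1 - t) *\<^sub>R x + t *\<^sub>R y)) \<le> (1 - t) * (SUP i\<in>I. f i x) + t * (SUP i\<in>I. f i y)"
  proof (rule cSUP_least[OF assms(1)])
    fix i assume i: "i \<in> I"
    have "f i ((1 - t) *\<^sub>R x + t *\<^sub>R y) \<le> (1 - t) * f i x + t * f i y"
      using convex_onD[OF assms(2)[OF i]] t by simp
    also have "\<dots> \<le> (1 - t) * (SUP i\<in>I. f i x) + t * (SUP i\<in>I. f i y)"
      using t i assms(3) by (intro add_mono mult_left_mono cSUP_upper) auto
    finally show "f i ((1 - t) *\<^sub>R x + t *\<^sub>R y) \<le> \<dots>" .
  qed
qed simp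

lemma integrable_bounded_borel_on:
  fixes f :: "'a::euclidean_space \<Rightarrow> real"
  assumes \<nu>: "\<nu> \<in> space (prob_algebra (borel_on S))"
    and f: "f \<in> borel_measurable (borel_on S)" and b: "bounded (f ` S)"
  shows "integrable \<nu> f"
proof -
  have sets[measurable_cong]: "sets \<nu> = sets (borel_on S)" using \<nu> by (simp add: space_prob_algebra)
  interpret prob_space \<nu> using \<nu> by (simp add: space_prob_algebra)
  obtain K where "\<And>x. x \<in> S \<Longrightarrow> norm (f x) \<le> K" using b by (auto simp: bounded_iff)
  then show ?thesis
    using sets_eq_imp_space_eq[OF sets] f
    by (intro integrable_const_bound[of _ K]) (auto intro!: AE_I2 simp: space_restrict_space)
qed

lemma integral_mono_borel_on:
  fixes f g :: "'a::euclidean_space \<Rightarrow> real"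
  assumes \<nu>: "\<nu> \<in> space (prob_algebra (borel_on S))"
    and "integrable \<nu> f" "integrable \<nu> g" "\<And>x. x \<in> S \<Longrightarrow> f x \<le> g x"
  shows "(\<integral>x. f x \<partial>\<nu>) \<le> (\<integral>x. g x \<partial>\<nu>)"
proof -
  have sets: "sets \<nu> = sets (borel_on S)" using \<nu> by (simp add: space_prob_algebra)
  show ?thesis
    using assms sets_eq_imp_space_eq[OF sets]
    by (intro integral_mono) (auto simp: space_restrict_space)
qed

text \<open>
  Backward induction on the last time: the function \<open>\<Phi>\<close> below, the upper envelope of the affine
  functions of the last position obtained by varying the past, is convex, and replacing it by its
  value at the previous position costs nothing by the convex order.
\<close>

lemma convex_order_chain_duality:
  fixes X :: "nat \<Rightarrow> 'a::euclidean_space set" and f :: "nat \<Rightarrow> 'a \<Rightarrow> real"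
    and g :: "nat \<Rightarrow> (nat \<Rightarrow> 'a) \<Rightarrow> 'a"
  assumes "s \<le> m"
    and X: "\<And>i. i \<in> {s..m} \<Longrightarrow> compact (X i)"
    and \<nu>: "\<And>i. i \<in> {s..m} \<Longrightarrow> \<nu> i \<in> space (prob_algebra (borel_on (X i)))"
    and ord: "\<And>i. i \<in> {s..<m} \<Longrightarrow> \<nu> i \<preceq>\<^sub>c \<nu> (Suc i)"
    and f: "\<And>i. i \<in> {s..m} \<Longrightarrow> f i \<in> borel_measurable (borel_on (X i))"
    and fb: "\<And>i. i \<in> {s..m} \<Longrightarrow> bounded (f i ` X i)"
    and g: "\<And>i x y. i \<in> {s..<m} \<Longrightarrow> (\<And>k. k \<in> {s..i} \<Longrightarrow> x k = y k) \<Longrightarrow> g i x = g i y"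
    and gb: "\<And>i. i \<in> {s..<m} \<Longrightarrow> bounded (g i ` {x. \<forall>k\<in>{s..i}. x k \<in> X k})"
    and le: "\<And>x. (\<And>i. i \<in> {s..m} \<Longrightarrow> x i \<in> X i) \<Longrightarrow>
        (\<Sum>i=s..m. f i (x i)) + (\<Sum>i=s..<m. g i x \<bullet> (x (Suc i) - x i)) \<le> e"
  shows "(\<Sum>i=s..m. \<integral>y. f i y \<partial>\<nu> i) \<le> e"
  using assms
proof (induction m arbitrary: f e rule: dec_induct)
  case base
  interpret prob_space "\<nu> s" using base.prems(2)[of s] by (simp add: space_prob_algebra)
  have "(\<integral>y. f s y \<partial>\<nu> s) \<le> (\<integral>y. e \<partial>\<nu> s)"
  proof (rule integral_mono_borel_on[OF base.prems(2)])
    show "integrable (\<nu> s) (f s)" using base.prems by (intro integrable_bounded_borel_on) auto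
    show "f s y \<le> e" if "y \<in> X s" for y using base.prems(8)[of "\<lambda>_. y"] that by simp
  qed auto
  then show ?case by (simp add: prob_space)
next
  case (step m)
  note X = step.prems(1) and \<nu> = step.prems(2) and ord = step.prems(3) and f = step.prems(4)
    and fb = step.prems(5) and g = step.prems(6) and gb = step.prems(7) and le = step.prems(8)
  have sm: "s \<le> m" "m \<in> {s..Suc m}" "Suc m \<in> {s..Suc m}" "m \<in> {s..<Suc m}" using step.hyps by auto
  define K where "K = {x. \<forall>i\<in>{s..m}. x i \<in> X i}"
  define B where "B x = (\<Sum>i=s..m. f i (x i)) + (\<Sum>i=s..<m. g i x \<bullet> (x (Suc i) - x i))" for x
  define \<Phi> where "\<Phi> y = (SUP x\<in>K. B x + g m x \<bullet> (y - x m))" for y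
  have ne: "X i \<noteq> {}" if "i \<in> {s..Suc m}" for i
  proof -
    have p: "prob_space (\<nu> i)" and "sets (\<nu> i) = sets (borel_on (X i))"
      using \<nu>[OF that] by (simp_all add: space_prob_algebra)
    then have "space (\<nu> i) = X i"
      using sets_eq_imp_space_eq[of "\<nu> i" "borel_on (X i)"] by (simp add: space_restrict_space)
    then show ?thesis using prob_space.not_empty[OF p] by simp
  qed
  define x0 where "x0 = (\<lambda>i. SOME y. y \<in> X i)"
  have "x0 i \<in> X i" if "i \<in> {s..Suc m}" for i using ne[OF that] unfolding x0_def by (rule some_in_eq[THEN iffD2])
  then have "x0 \<in> K" by (simp add: K_def)
  then have Kne: "K \<noteq> {}" by blast
  have upd: "B x + g m x \<bullet> (y - x m) + f (Suc m) y \<le> e" if x: "x \<in> K" and y: "y \<in> X (Suc m)" for x y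
  proof -
    \<comment> \<open>Changing the last position affects no \<open>g i\<close> with i \<le> m, since
      \<open>g i\<close> reads the times up to i only.\<close>
    define z where "z = x(Suc m := y)"
    have "z i \<in> X i" if "i \<in> {s..Suc m}" for i using x y that by (cases "i = Suc m") (auto simp: z_def K_def)
    then have "(\<Sum>i=s..Suc m. f i (z i)) + (\<Sum>i=s..<Suc m. g i z \<bullet> (z (Suc i) - z i)) \<le> e" by (rule le)
    moreover have gz: "g i z = g i x" if "i \<in> {s..m}" for i
      using that by (intro g) (auto simp: z_def)
    moreover have "(\<Sum>i=s..<m. g i z \<bullet> (z (Suc i) - z i)) = (\<Sum>i=s..<m. g i x \<bullet> (x (Suc i) - x i))"
      by (intro sum.cong) (auto simp: gz, simp add: z_def)
    moreover have "(\<Sum>i=s..m. f i (z i)) = (\<Sum>i=s..m. f i (x i))"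
      by (intro sum.cong) (auto simp: z_def)
    ultimately show ?thesis
      using sm gz[of m] by (simp add: B_def sum.atLeastLessThan_Suc z_def)
  qed
  \<comment> \<open>The envelope must be finite at every y, also outside \<open>X (Suc m)\<close>,
    because the convex order tests with convex functions on the whole space. At one admissible y0 it
    is bounded by \<open>upd\<close>; bounded slopes carry this to all y.\<close>
  have bdd: "bdd_above ((\<lambda>x. B x + g m x \<bullet> (y - x m)) ` K)" for y
  proof -
    obtain y0 where y0: "y0 \<in> X (Suc m)" using ne[OF sm(3)] by blast
    obtain G where G: "\<And>x. x \<in> K \<Longrightarrow> norm (g m x) \<le> G"
      using gb[OF sm(4)] unfolding bounded_iff K_def by auto
    show ?thesis
    proof (rule bdd_aboveI2)
      fix x assume x: "x \<in> K"
      have "B x + g m x \<bullet> (y - x m) = (B x + g m x \<bullet> (y0 - x m)) + g m x \<bullet> (y - y0)"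
        by (simp add: inner_diff_right)
      also have "\<dots> \<le> (e - f (Suc m) y0) + G * norm (y - y0)"
        using upd[OF x y0] G[OF x] norm_cauchy_schwarz[of "g m x" "y - y0"]
          mult_right_mono[OF G[OF x] norm_ge_zero[of "y - y0"]]
        by linarith
      finally show "B x + g m x \<bullet> (y - x m) \<le> (e - f (Suc m) y0) + G * norm (y - y0)" .
    qed
  qed
  have conv: "convex_on UNIV \<Phi>" unfolding \<Phi>_def
  proof (rule convex_on_SUP[OF Kne _ bdd])
    fix x
    have "g m x \<bullet> ((1 - t) *\<^sub>R y + t *\<^sub>R z - x m) = (1 - t) * (g m x \<bullet> (y - x m)) + t * (g m x \<bullet> (z - x m))" for t y z
      by (simp add: inner_diff_right inner_add_right algebra_simps)
    then show "convex_on UNIV (\<lambda>y. B x + g m x \<bullet> (y - x m))"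
      by (intro convex_onI) (auto simp: algebra_simps)
  qed
  have cont: "continuous_on UNIV \<Phi>" by (rule convex_on_continuous[OF open_UNIV conv])
  have \<Phi>m: "\<Phi> \<in> borel_measurable (borel_on S)" for S
    using borel_measurable_continuous_onI[OF cont] by (rule measurable_restrict_space1)
  have \<Phi>b: "bounded (\<Phi> ` X i)" if "i \<in> {s..Suc m}" for i
    by (intro compact_imp_bounded compact_continuous_image continuous_on_subset[OF cont] X that) auto
  have \<Phi>i: "integrable (\<nu> i) \<Phi>" if "i \<in> {s..Suc m}" for i
    by (rule integrable_bounded_borel_on[OF \<nu>[OF that] \<Phi>m \<Phi>b[OF that]])
  have fi: "integrable (\<nu> i) (f i)" if "i \<in> {s..Suc m}" for i
    by (rule integrable_bounded_borel_on[OF \<nu>[OF that] f[OF that] fb[OF that]])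
  have up: "(\<integral>y. \<Phi> y \<partial>\<nu> (Suc m)) \<le> e - (\<integral>y. f (Suc m) y \<partial>\<nu> (Suc m))"
  proof -
    interpret prob_space "\<nu> (Suc m)" using \<nu>[OF sm(3)] by (simp add: space_prob_algebra)
    have "(\<integral>y. \<Phi> y \<partial>\<nu> (Suc m)) \<le> (\<integral>y. e - f (Suc m) y \<partial>\<nu> (Suc m))"
    proof (rule integral_mono_borel_on[OF \<nu>[OF sm(3)] \<Phi>i[OF sm(3)]])
      show "\<Phi> y \<le> e - f (Suc m) y" if "y \<in> X (Suc m)" for y
        unfolding \<Phi>_def using upd[OF _ that] by (intro cSUP_least[OF Kne]) (simp add: le_diff_eq)
    qed (use fi[OF sm(3)] in simp)
    then show ?thesis using fi[OF sm(3)] by (simp add: prob_space)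
  qed
  \<comment> \<open>At y = x m the last increment vanishes, so \<open>B x \<le> \<Phi> (x m)\<close>
    and the shorter chain has bound 0. Its conclusion, the convex order applied to
    \<open>\<Phi>\<close> and the bound \<open>up\<close> then combine to the claim.\<close>
  define f' where "f' = f(m := \<lambda>y. f m y - \<Phi> y)"
  have "(\<Sum>i=s..m. \<integral>y. f' i y \<partial>\<nu> i) \<le> 0"
  proof (rule step.IH)
    show "f' i \<in> borel_measurable (borel_on (X i))" if "i \<in> {s..m}" for i
      using f[of i] \<Phi>m[of "X i"] that by (auto simp: f'_def)
    show "bounded (f' i ` X i)" if "i \<in> {s..m}" for i
      using fb[of i] \<Phi>b[of i] that by (auto simp: f'_def intro: bounded_minus_comp)
    show "(\<Sum>i=s..m. f' i (x i)) + (\<Sum>i=s..<m. g i x \<bullet> (x (Suc i) - x i)) \<le> 0"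
      if "\<And>i. i \<in> {s..m} \<Longrightarrow> x i \<in> X i" for x
    proof -
      have "x \<in> K" using that by (simp add: K_def)
      then have "B x + g m x \<bullet> (x m - x m) \<le> \<Phi> (x m)" unfolding \<Phi>_def by (rule cSUP_upper[OF _ bdd])
      moreover have "(\<Sum>i=s..m. f' i (x i)) = (\<Sum>i=s..m. f i (x i)) - \<Phi> (x m)"
        using sm by (simp add: f'_def sum.remove[of "{s..m}" m])
      ultimately show ?thesis by (simp add: B_def)
    qed
    show "compact (X i)" "\<nu> i \<in> space (prob_algebra (borel_on (X i)))" if "i \<in> {s..m}" for i
      using that by (auto intro: X \<nu>)
    show "\<nu> i \<preceq>\<^sub>c \<nu> (Suc i)" if "i \<in> {s..<m}" for i
      using that by (auto intro: ord)
    show "g i x = g i y" if "i \<in> {s..<m}" "\<And>k. k \<in> {s..i} \<Longrightarrow> x k = y k" for i x y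
      by (rule g) (use that in auto)
    show "bounded (g i ` {x. \<forall>k\<in>{s..i}. x k \<in> X k})" if "i \<in> {s..<m}" for i
      by (rule gb) (use that in auto)
  qed
  moreover have "(\<Sum>i=s..m. \<integral>y. f' i y \<partial>\<nu> i) = (\<Sum>i=s..m. \<integral>y. f i y \<partial>\<nu> i) - (\<integral>y. \<Phi> y \<partial>\<nu> m)"
    using sm fi[OF sm(2)] \<Phi>i[OF sm(2)] by (simp add: f'_def sum.remove[of "{s..m}" m])
  moreover have "(\<integral>y. \<Phi> y \<partial>\<nu> m) \<le> (\<integral>y. \<Phi> y \<partial>\<nu> (Suc m))"
    using ord[OF sm(4)] conv by (simp add: convex_order_def)
  ultimately show ?case using up sm by simp
qed

section \<open>Measures on path spaces\<close>

lemma bounded_pair_continuous: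
  assumes "compact A" "compact B" "continuous_on (A \<times> B) c"
  shows "\<exists>K. \<forall>x\<in>A. \<forall>y\<in>B. \<bar>c (x, y) :: real\<bar> \<le> K"
proof -
  have "bounded (c ` (A \<times> B))"
    by (intro compact_imp_bounded compact_continuous_image assms compact_Times)
  then obtain K where "\<forall>z\<in>A \<times> B. norm (c z) \<le> K" unfolding bounded_iff by auto
  then show ?thesis by auto
qed

text \<open>The maps \<open>min 1 (k * infdist x (- U))\<close> increase to the indicator of the open set \<open>U\<close>.\<close>

lemma finite_measure_eqI_continuous:
  fixes P Q :: "'b::metric_space measure"
  assumes fP: "finite_measure P" and fQ: "finite_measure Q"
    and sets[measurable_cong]: "sets P = sets borel" "sets Q = sets borel"
    and eq: "\<And>f :: 'b \<Rightarrow> real. continuous_on UNIV f \<Longrightarrow> (\<And>x. 0 \<le> f x \<and> f x \<le> 1) \<Longrightarrow>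
        (\<integral>x. f x \<partial>P) = (\<integral>x. f x \<partial>Q)"
  shows "P = Q"
proof (rule measure_eqI_generator_eq[where E = "{U. open U}" and \<Omega> = UNIV and A = "\<lambda>_. UNIV"])
  show "Int_stable {U::'b set. open U}" by (auto simp: Int_stable_def)
  show "sets P = sigma_sets UNIV {U. open U}" "sets Q = sigma_sets UNIV {U. open U}"
    by (simp_all add: sets sets_borel)
  show "emeasure P UNIV \<noteq> \<infinity>"
    using finite_measure.emeasure_finite[OF fP] by simp
  interpret P: finite_measure P by fact
  interpret Q: finite_measure Q by fact
  fix U :: "'b set" assume "U \<in> {U. open U}"
  then have U: "open U" by simp
  show "emeasure P U = emeasure Q U"
  \<comment> \<open>Here the complement is empty and \<open>infdist\<close> takes its default value
    0, so the whole space is treated by total mass.\<close>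
  proof (cases "U = UNIV")
    case True
    have "(\<integral>x. (1::real) \<partial>P) = (\<integral>x. 1 \<partial>Q)" using eq[of "\<lambda>_. 1"] by simp
    then show ?thesis
      using True sets_eq_imp_space_eq[OF sets(1)] sets_eq_imp_space_eq[OF sets(2)]
      by (simp add: P.emeasure_eq_measure Q.emeasure_eq_measure)
  next
    case False
    define f where "f k x = min 1 (real k * infdist x (- U))" for k x
    have f: "continuous_on UNIV (f k)" "\<And>x. 0 \<le> f k x \<and> f k x \<le> 1" for k
      unfolding f_def by (auto intro!: continuous_intros simp: infdist_nonneg)
    have lim: "(\<lambda>k. f k x) \<longlonglongrightarrow> indicator U x" for x
    proof (cases "x \<in> U")
      case True
      then have "infdist x (- U) \<noteq> 0"
        using in_closed_iff_infdist_zero[of "- U" x] U False by auto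
      then have pos: "infdist x (- U) > 0" using infdist_nonneg[of x "- U"] by linarith
      obtain N where N: "1 / infdist x (- U) < real N" using reals_Archimedean2 by blast
      have "f k x = 1" if "k \<ge> N" for k
      proof -
        have "1 / infdist x (- U) \<le> real k" using N that by linarith
        then show ?thesis using pos by (simp add: f_def pos_divide_le_eq)
      qed
      then have "\<forall>\<^sub>F k in sequentially. f k x = indicator U x"
        using True by (auto intro: eventually_sequentiallyI[of N])
      then show ?thesis by (rule tendsto_eventually)
    next
      case False
      then have "f k x = indicator U x" for k by (simp add: f_def)
      then show ?thesis by simp
    qed
    have lP: "(\<lambda>k. \<integral>x. f k x \<partial>R) \<longlonglongrightarrow> measure R U"
      if R: "finite_measure R" and [measurable_cong]: "sets R = sets borel" for R
    proof -
      interpret R: finite_measure R by fact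
      have [measurable]: "f k \<in> borel_measurable borel" for k
        using f(1) by (rule borel_measurable_continuous_onI)
      have [measurable]: "U \<in> sets borel" using U by simp
      have "(\<lambda>k. \<integral>x. f k x \<partial>R) \<longlonglongrightarrow> (\<integral>x. indicator U x \<partial>R)"
        by (rule integral_dominated_convergence[where w = "\<lambda>_. 1"]) (use f(2) lim in auto)
      moreover have "U \<inter> space R = U"
        using sets_eq_imp_space_eq[OF that(2)] by simp
      ultimately show ?thesis by simp
    qed
    have "measure P U = measure Q U"
      using LIMSEQ_unique[OF lP[OF fP sets(1)]] lP[OF fQ sets(2)] eq[OF f] by simp
    then show ?thesis by (simp add: P.emeasure_eq_measure Q.emeasure_eq_measure)
  qed
qed auto

lemma sets_borel_on_closed:
  "closed C \<Longrightarrow> A \<in> sets (borel_on C) \<Longrightarrow> A \<in> sets borel"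
  by (auto simp: sets_restrict_space)

text \<open>Links the product sigma-algebra on paths with the Borel sets of the full function space,
  so that continuous functions can serve as tests. Coordinates outside \<open>I\<close> are
  constantly \<open>undefined\<close>.\<close>

lemma measurable_path_borel:
  fixes X :: "nat \<Rightarrow> 'a::euclidean_space set"
  shows "(\<lambda>x. x) \<in> path_space X I \<rightarrow>\<^sub>M borel"
proof (rule measurable_coordinatewise_then_product)
  fix i
  show "(\<lambda>x. x i) \<in> borel_measurable (path_space X I)"
  proof (cases "i \<in> I")
    case True
    then have "(\<lambda>x. x i) \<in> path_space X I \<rightarrow>\<^sub>M borel_on (X i)"
      unfolding path_space_def by (rule measurable_component_singleton)
    then show ?thesis by (rule measurable_restrict_space2_iff[THEN iffD1, THEN conjunct1])
  next
    case False
    then have "x i = undefined" if "x \<in> space (path_space X I)" for x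
      using that by (auto simp: path_space_def space_PiM PiE_def extensional_def)
    then show ?thesis by (subst measurable_cong[where g = "\<lambda>_. undefined"]) auto
  qed
qed

text \<open>Images in the full function space are compared by
  \<open>finite_measure_eqI_continuous\<close>. A measurable rectangle of paths is the trace of a
  Borel cylinder \<open>Z\<close> there; closedness of the \<open>X i\<close> ensures that its sides
  are Borel in the ambient space.\<close>

lemma path_measure_eqI_continuous:
  fixes X :: "nat \<Rightarrow> 'a::euclidean_space set"
  assumes I: "finite I" and X: "\<And>i. i \<in> I \<Longrightarrow> closed (X i)"
    and fP: "finite_measure P" and fQ: "finite_measure Q"
    and sets: "sets P = sets (path_space X I)" "sets Q = sets (path_space X I)"
    and eq: "\<And>f :: (nat \<Rightarrow> 'a) \<Rightarrow> real. continuous_on UNIV f \<Longrightarrow> (\<And>x. 0 \<le> f x \<and> f x \<le> 1) \<Longrightarrow>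
        (\<integral>x. f x \<partial>P) = (\<integral>x. f x \<partial>Q)"
  shows "P = Q"
proof -
  note sets[measurable_cong]
  have m[measurable]: "(\<lambda>x. x) \<in> P \<rightarrow>\<^sub>M borel" "(\<lambda>x. x) \<in> Q \<rightarrow>\<^sub>M borel"
    using measurable_path_borel[of X I] by measurable
  have D: "distr P borel (\<lambda>x. x) = distr Q borel (\<lambda>x. x)"
  proof (rule finite_measure_eqI_continuous)
    show "finite_measure (distr P borel (\<lambda>x. x))" "finite_measure (distr Q borel (\<lambda>x. x))"
      by (intro finite_measure.finite_measure_distr fP fQ m)+
    fix f :: "(nat \<Rightarrow> 'a) \<Rightarrow> real" assume f: "continuous_on UNIV f" "\<And>x. 0 \<le> f x \<and> f x \<le> 1"
    then have "f \<in> borel_measurable borel" by (auto intro: borel_measurable_continuous_onI)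
    then show "(\<integral>x. f x \<partial>distr P borel (\<lambda>x. x)) = (\<integral>x. f x \<partial>distr Q borel (\<lambda>x. x))"
      using eq[OF f] by (simp add: integral_distr m)
  qed simp_all
  have sp: "space P = PiE I X" "space Q = PiE I X"
    using sets_eq_imp_space_eq[OF sets(1)] sets_eq_imp_space_eq[OF sets(2)]
    by (auto simp: path_space_def space_PiM space_restrict_space cong: PiE_cong)
  have R: "emeasure P (Pi\<^sub>E I A) = emeasure Q (Pi\<^sub>E I A)" if A: "\<And>i. i \<in> I \<Longrightarrow> A i \<in> sets (borel_on (X i))" for A
  proof -
    define Z where "Z = {x :: nat \<Rightarrow> 'a. \<forall>i\<in>I. x i \<in> A i}"
    have "A i \<in> sets borel" if "i \<in> I" for i using sets_borel_on_closed X A that by blast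
    then have "(\<lambda>x :: nat \<Rightarrow> 'a. x i) -` A i \<in> sets borel" if "i \<in> I" for i
      using that measurable_sets[OF borel_measurable_continuous_onI[OF continuous_on_product_coordinates[of i]], of "A i"] by simp
    then have "(\<Inter>i\<in>I. (\<lambda>x :: nat \<Rightarrow> 'a. x i) -` A i) \<in> sets borel" if "I \<noteq> {}"
      using I that by (intro sets.finite_INT) auto
    moreover have "Z = (if I = {} then UNIV else (\<Inter>i\<in>I. (\<lambda>x. x i) -` A i))" by (auto simp: Z_def)
    ultimately have Z: "Z \<in> sets borel" by auto
    have "Z \<inter> space P = Pi\<^sub>E I A" "Z \<inter> space Q = Pi\<^sub>E I A"
    proof -
      have "A i \<subseteq> X i" if "i \<in> I" for i
        using sets.sets_into_space[OF A[OF that]] by (simp add: space_restrict_space)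
      then have "Z \<inter> PiE I X = Pi\<^sub>E I A"
        by (auto simp: PiE_iff Z_def dest: subsetD)
      then show "Z \<inter> space P = Pi\<^sub>E I A" "Z \<inter> space Q = Pi\<^sub>E I A"
        unfolding sp by auto
    qed
    then show ?thesis
      using arg_cong[OF D, of "\<lambda>M. emeasure M Z"] Z by (simp add: emeasure_distr m)
  qed
  interpret P: finite_measure P by fact
  show ?thesis
  proof (rule measure_eqI_PiM_finite[OF I])
    show "sets P = sets (PiM I (\<lambda>i. borel_on (X i)))" "sets Q = sets (PiM I (\<lambda>i. borel_on (X i)))"
      using sets by (simp_all add: path_space_def)
    show "range (\<lambda>_::nat. space (PiM I (\<lambda>i. borel_on (X i)))) \<subseteq> prod_algebra I (\<lambda>i. borel_on (X i))"
      unfolding space_PiM using I by (auto intro!: prod_algebraI_finite)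
  qed (use R P.emeasure_finite in auto)
qed

section \<open>Martingale couplings\<close>

text \<open>Replaces a statement about conditional means by integrals against the joint law, in
  which the kernel occurs only through that law. The coordinates along \<open>Basis\<close> reduce
  it to the fact that an integrable real function is null if its integral over every set is.\<close>

lemma kernel_barycenter_iff:
  fixes u :: "'b \<Rightarrow> 'a::euclidean_space" and v :: "'c \<Rightarrow> 'a"
  assumes M: "prob_space M" and k: "\<kappa> \<in> M \<rightarrow>\<^sub>M prob_algebra N"
    and u[measurable]: "u \<in> borel_measurable M" and v[measurable]: "v \<in> borel_measurable N"
    and ub: "\<And>x. x \<in> space M \<Longrightarrow> norm (u x) \<le> B" and vb: "\<And>y. y \<in> space N \<Longrightarrow> norm (v y) \<le> B"
  shows "(AE x in M. (\<integral>y. v y \<partial>\<kappa> x) = u x) \<longleftrightarrow>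
    (\<forall>A\<in>sets M. \<forall>e\<in>Basis.
      (\<integral>z. indicator A (fst z) * ((v (snd z) - u (fst z)) \<bullet> e) \<partial>kernel_prod M N \<kappa>) = 0)"
proof -
  interpret M: prob_space M by fact
  define G where "G e x = ((\<integral>y. v y \<partial>\<kappa> x) - u x) \<bullet> e" for e x
  have k1: "prob_space (\<kappa> x)" "sets (\<kappa> x) = sets N" "space (\<kappa> x) = space N" if "x \<in> space M" for x
    using measurable_space[OF k that] by (auto simp: space_prob_algebra dest: sets_eq_imp_space_eq)
  have vint: "integrable (\<kappa> x) v" if x: "x \<in> space M" for x
  proof -
    interpret K: prob_space "\<kappa> x" by (rule k1[OF x])
    note k1(2)[OF x, measurable_cong]
    show ?thesis
      by (rule K.integrable_const_bound[of _ B]) (use vb k1(3)[OF x] in \<open>auto intro!: AE_I2\<close>)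
  qed
  have vkb: "norm (\<integral>y. v y \<partial>\<kappa> x) \<le> B" if x: "x \<in> space M" for x
  proof -
    interpret K: prob_space "\<kappa> x" by (rule k1[OF x])
    have "norm (\<integral>y. v y \<partial>\<kappa> x) \<le> (\<integral>y. norm (v y) \<partial>\<kappa> x)" by (rule integral_norm_bound)
    also have "\<dots> \<le> B"
      using vint[OF x] vb k1(3)[OF x] by (intro K.integral_le_const) (auto intro!: AE_I2)
    finally show ?thesis .
  qed
  have vm[measurable]: "(\<lambda>x. \<integral>y. v y \<partial>\<kappa> x) \<in> borel_measurable M"
    using kernel_integral_measurable[OF k, of "\<lambda>z. v (snd z)"] by simp
  have Gm[measurable]: "G e \<in> borel_measurable M" for e
    unfolding G_def by (intro borel_measurable_inner borel_measurable_diff vm u borel_measurable_const)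
  have Gi: "integrable M (G e)" if e: "e \<in> Basis" for e
  proof (rule M.integrable_const_bound[of _ "2 * B"])
    show "AE x in M. norm (G e x) \<le> 2 * B"
    proof (rule AE_I2)
      fix x assume x: "x \<in> space M"
      have "norm (G e x) \<le> norm ((\<integral>y. v y \<partial>\<kappa> x) - u x)" unfolding G_def using Basis_le_norm[OF e] by simp
      also have "\<dots> \<le> 2 * B" using vkb[OF x] ub[OF x] norm_triangle_ineq4[of "\<integral>y. v y \<partial>\<kappa> x" "u x"] by simp
      finally show "norm (G e x) \<le> 2 * B" .
    qed
  qed simp
  have int: "(\<integral>z. indicator A (fst z) * ((v (snd z) - u (fst z)) \<bullet> e) \<partial>kernel_prod M N \<kappa>)
      = (\<integral>x. indicator A x * G e x \<partial>M)" if A[measurable]: "A \<in> sets M" and e: "e \<in> Basis" for A e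
  proof -
    have "(\<integral>z. indicator A (fst z) * ((v (snd z) - u (fst z)) \<bullet> e) \<partial>kernel_prod M N \<kappa>)
        = (\<integral>x. \<integral>y. indicator A (fst (x, y)) * ((v (snd (x, y)) - u (fst (x, y))) \<bullet> e) \<partial>\<kappa> x \<partial>M)"
    proof (rule integral_kernel_prod[OF M k])
      fix z assume z: "z \<in> space (M \<Otimes>\<^sub>M N)"
      then have s: "fst z \<in> space M" "snd z \<in> space N" by (auto simp: space_pair_measure)
      have "\<bar>indicator A (fst z) * ((v (snd z) - u (fst z)) \<bullet> e)\<bar> \<le> \<bar>(v (snd z) - u (fst z)) \<bullet> e\<bar>"
        by (auto simp: indicator_def)
      also have "\<dots> \<le> norm (v (snd z) - u (fst z))" by (rule Basis_le_norm[OF e])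
      also have "\<dots> \<le> 2 * B"
        using vb[OF s(2)] ub[OF s(1)] norm_triangle_ineq4[of "v (snd z)" "u (fst z)"] by simp
      finally show "\<bar>indicator A (fst z) * ((v (snd z) - u (fst z)) \<bullet> e)\<bar> \<le> 2 * B" .
    qed measurable
    also have "\<dots> = (\<integral>x. indicator A x * G e x \<partial>M)"
    proof (rule Bochner_Integration.integral_cong)
      fix x assume x: "x \<in> space M"
      interpret K: prob_space "\<kappa> x" by (rule k1[OF x])
      show "(\<integral>y. indicator A (fst (x, y)) * ((v (snd (x, y)) - u (fst (x, y))) \<bullet> e) \<partial>\<kappa> x) = indicator A x * G e x"
        using vint[OF x] by (simp add: G_def inner_diff_left K.prob_space)
    qed simp
    finally show ?thesis .
  qed
  show ?thesis
  proof (intro iffI ballI)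
    fix A and e :: 'a assume AE: "AE x in M. (\<integral>y. v y \<partial>\<kappa> x) = u x" and A[measurable]: "A \<in> sets M" and e: "e \<in> Basis"
    have "(\<integral>x. indicator A x * G e x \<partial>M) = (\<integral>x. 0 \<partial>M)"
      by (intro integral_cong_AE eventually_mono[OF AE]) (auto simp: G_def)
    then show "(\<integral>z. indicator A (fst z) * ((v (snd z) - u (fst z)) \<bullet> e) \<partial>kernel_prod M N \<kappa>) = 0"
      by (simp add: int[OF A e])
  next
    assume *: "\<forall>A\<in>sets M. \<forall>e\<in>Basis.
      (\<integral>z. indicator A (fst z) * ((v (snd z) - u (fst z)) \<bullet> e) \<partial>kernel_prod M N \<kappa>) = 0"
    have "AE x in M. G e x = 0" if e: "e \<in> Basis" for e
    proof (rule density_unique_real[OF Gi[OF e]])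
      show "(\<integral>x\<in>A. G e x \<partial>M) = (\<integral>x\<in>A. 0 \<partial>M)" if A: "A \<in> sets M" for A
        using * int[OF A e] A e by (simp add: set_lebesgue_integral_def)
    qed simp
    then have "AE x in M. \<forall>e\<in>Basis. G e x = 0" by (simp add: AE_finite_all)
    then show "AE x in M. (\<integral>y. v y \<partial>\<kappa> x) = u x"
      by (rule eventually_mono) (auto simp: G_def inner_diff_left intro: euclidean_eqI)
  qed
qed

text \<open>Needed twice: to forget future times in a disintegration, and to turn the conditional
  law of a real parameter into that of a path. \<open>L\<close> is fixed only up to its sets because
  product spaces formed with a measure or with its base space must both be accepted.\<close>

lemma distr_kernel_prod:
  assumes M: "prob_space M" and k: "\<kappa> \<in> M \<rightarrow>\<^sub>M prob_algebra N" and f[measurable]: "f \<in> N \<rightarrow>\<^sub>M N'"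
    and L: "sets L = sets (M \<Otimes>\<^sub>M N')"
  shows "distr (kernel_prod M N \<kappa>) L (\<lambda>(a, b). (a, f b)) = kernel_prod M N' (\<lambda>x. distr (\<kappa> x) N' f)"
proof -
  have m: "(\<lambda>(a, b). (a, f b)) \<in> M \<Otimes>\<^sub>M N \<rightarrow>\<^sub>M L"
    unfolding measurable_cong_sets[OF refl L] by measurable
  have "distr (kernel_prod M N \<kappa>) L (\<lambda>(a, b). (a, f b))
      = M \<bind> (\<lambda>x. distr (distr (\<kappa> x) (M \<Otimes>\<^sub>M N) (Pair x)) L (\<lambda>(a, b). (a, f b)))"
    unfolding kernel_prod_def
    by (rule distr_bind[OF measurable_prob_algebraD[OF kernel_prod_measurable[OF k]] prob_space.not_empty[OF M] m])
  also have "\<dots> = kernel_prod M N' (\<lambda>x. distr (\<kappa> x) N' f)" unfolding kernel_prod_def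
  proof (rule bind_cong[OF refl])
    fix x assume x: "x \<in> space M"
    have s[measurable_cong]: "sets (\<kappa> x) = sets N"
      using measurable_space[OF k x] by (simp add: space_prob_algebra)
    have "distr (distr (\<kappa> x) (M \<Otimes>\<^sub>M N) (Pair x)) L (\<lambda>(a, b). (a, f b)) = distr (\<kappa> x) L (\<lambda>y. (x, f y))"
      by (subst distr_distr[OF m]) (use x in \<open>auto simp: o_def cong: measurable_cong_sets\<close>)
    also have "\<dots> = distr (\<kappa> x) (M \<Otimes>\<^sub>M N') (\<lambda>y. (x, f y))"
      by (rule distr_cong) (auto simp: L)
    also have "\<dots> = distr (distr (\<kappa> x) N' f) (M \<Otimes>\<^sub>M N') (Pair x)"
      by (subst distr_distr) (use x in \<open>auto simp: o_def\<close>)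
    finally show "distr (distr (\<kappa> x) (M \<Otimes>\<^sub>M N) (Pair x)) L (\<lambda>(a, b). (a, f b))
        = distr (distr (\<kappa> x) N' f) (M \<Otimes>\<^sub>M N') (Pair x)" .
  qed
  finally show ?thesis .
qed

section \<open>Path laws and their projections\<close>

lemma space_path_space: "space (path_space X I) = PiE I X"
  by (auto simp: path_space_def space_PiM space_restrict_space cong: PiE_cong)

lemma measurable_restrict_path[measurable]:
  "J \<subseteq> I \<Longrightarrow> (\<lambda>x. restrict x J) \<in> path_space X I \<rightarrow>\<^sub>M path_space X J"
  unfolding path_space_def by (rule measurable_restrict_subset)

lemma measurable_path_coordinate:
  fixes X :: "nat \<Rightarrow> 'a::euclidean_space set"
  assumes "i \<in> I"
  shows "(\<lambda>x. x i) \<in> path_space X I \<rightarrow>\<^sub>M borel_on (X i)" "(\<lambda>x. x i) \<in> borel_measurable (path_space X I)"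
proof -
  show "(\<lambda>x. x i) \<in> path_space X I \<rightarrow>\<^sub>M borel_on (X i)"
    using assms unfolding path_space_def by (rule measurable_component_singleton)
  then show "(\<lambda>x. x i) \<in> borel_measurable (path_space X I)"
    by (rule measurable_restrict_space2_iff[THEN iffD1, THEN conjunct1])
qed

lemma couplingsD:
  assumes "\<pi> \<in> couplings X I \<mu>"
  shows "prob_space \<pi>" "sets \<pi> = sets (path_space X I)" "space \<pi> = PiE I X"
    "i \<in> I \<Longrightarrow> distr \<pi> (borel_on (X i)) (\<lambda>x. x i) = \<mu> i"
proof -
  show s: "sets \<pi> = sets (path_space X I)" using assms by (simp add: couplings_def space_prob_algebra)
  show "space \<pi> = PiE I X" using sets_eq_imp_space_eq[OF s] by (simp add: space_path_space)
qed (use assms in \<open>auto simp: couplings_def space_prob_algebra\<close>)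

lemma sets_Proj[simp, measurable_cong]: "sets (Proj X J \<pi>) = sets (path_space X J)"
  by (simp add: Proj_def)

lemma prob_space_Proj:
  assumes "prob_space \<pi>" "sets \<pi> = sets (path_space X I)" "J \<subseteq> I"
  shows "prob_space (Proj X J \<pi>)"
  unfolding Proj_def
  by (intro prob_space.prob_space_distr assms(1))
     (simp add: measurable_restrict_path assms(3) measurable_cong_sets[OF assms(2) refl])

lemma Proj_Proj:
  assumes "sets \<pi> = sets (path_space X I)" "J \<subseteq> I'" "I' \<subseteq> I"
  shows "Proj X J (Proj X I' \<pi>) = Proj X J \<pi>"
proof -
  have "(\<lambda>x. restrict x I') \<in> \<pi> \<rightarrow>\<^sub>M path_space X I'"
    by (simp add: measurable_restrict_path assms(3) measurable_cong_sets[OF assms(1) refl])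
  moreover have "I' \<inter> J = J" using assms(2) by auto
  ultimately show ?thesis
    unfolding Proj_def by (subst distr_distr) (auto simp: o_def assms(2))
qed

lemma Proj_couplings:
  assumes \<pi>: "\<pi> \<in> couplings X I \<mu>" and J: "J \<subseteq> I"
  shows "Proj X J \<pi> \<in> couplings X J \<mu>"
proof -
  note D = couplingsD[OF \<pi>]
  have r: "(\<lambda>x. restrict x J) \<in> \<pi> \<rightarrow>\<^sub>M path_space X J"
    by (simp add: measurable_restrict_path J measurable_cong_sets[OF D(2) refl])
  have "distr (Proj X J \<pi>) (borel_on (X i)) (\<lambda>x. x i) = \<mu> i" if i: "i \<in> J" for i
  proof -
    have "distr (Proj X J \<pi>) (borel_on (X i)) (\<lambda>x. x i) = distr \<pi> (borel_on (X i)) (\<lambda>x. x i)"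
      unfolding Proj_def using i by (subst distr_distr[OF measurable_path_coordinate(1) r]) (auto simp: o_def)
    then show ?thesis using D(4) i J by auto
  qed
  then show ?thesis
    using prob_space_Proj[OF D(1,2) J] by (simp add: couplings_def space_prob_algebra)
qed

text \<open>The hypothesis \<open>J\<close> says that only times after i are dropped. The
  conditioning is then unchanged and the kernel is just pushed forward.\<close>

lemma disintegrates_Proj:
  assumes \<pi>: "prob_space \<pi>" "sets \<pi> = sets (path_space X I)" and I': "I' \<subseteq> I"
    and J: "{k\<in>I'. k \<le> i} = {k\<in>I. k \<le> i}"
    and d: "disintegrates X I i \<pi> \<kappa>"
  shows "disintegrates X I' i (Proj X I' \<pi>)
           (\<lambda>x. distr (\<kappa> x) (path_space X {k\<in>I'. i < k}) (\<lambda>y. restrict y {k\<in>I'. i < k}))"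
proof -
  define J K K' where JK: "J = {k\<in>I. k \<le> i}" "K = {k\<in>I. i < k}" "K' = {k\<in>I'. i < k}"
  have sub: "K' \<subseteq> K" "J \<subseteq> I" "K \<subseteq> I" "J \<subseteq> I'" "K' \<subseteq> I'" using I' J by (auto simp: JK)
  have k[measurable]: "\<kappa> \<in> path_space X J \<rightarrow>\<^sub>M prob_algebra (path_space X K)"
    and eq: "distr \<pi> (path_space X J \<Otimes>\<^sub>M path_space X K) (\<lambda>x. (restrict x J, restrict x K))
          = kernel_prod (Proj X J \<pi>) (path_space X K) \<kappa>"
    using d by (auto simp: disintegrates_def Let_def JK)
  have k': "\<kappa> \<in> Proj X J \<pi> \<rightarrow>\<^sub>M prob_algebra (path_space X K)" by measurable
  note [measurable_cong] = \<pi>(2)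
  have [measurable]: "(\<lambda>y. restrict y K') \<in> path_space X K \<rightarrow>\<^sub>M path_space X K'"
    "(\<lambda>y. restrict y J) \<in> path_space X I \<rightarrow>\<^sub>M path_space X J" "(\<lambda>y. restrict y K) \<in> path_space X I \<rightarrow>\<^sub>M path_space X K"
    "(\<lambda>y. restrict y I') \<in> path_space X I \<rightarrow>\<^sub>M path_space X I'"
    "(\<lambda>y. restrict y J) \<in> path_space X I' \<rightarrow>\<^sub>M path_space X J" "(\<lambda>y. restrict y K') \<in> path_space X I' \<rightarrow>\<^sub>M path_space X K'"
    using sub I' by (simp_all add: measurable_restrict_path)
  have int: "I' \<inter> J = J" "I' \<inter> K' = K'" "K \<inter> K' = K'" using sub by auto
  have "distr (Proj X I' \<pi>) (path_space X J \<Otimes>\<^sub>M path_space X K') (\<lambda>x. (restrict x J, restrict x K'))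
      = distr \<pi> (path_space X J \<Otimes>\<^sub>M path_space X K') (\<lambda>x. (restrict x J, restrict x K'))"
    unfolding Proj_def by (subst distr_distr) (auto simp: o_def int)
  also have "\<dots> = distr (distr \<pi> (path_space X J \<Otimes>\<^sub>M path_space X K) (\<lambda>x. (restrict x J, restrict x K)))
      (path_space X J \<Otimes>\<^sub>M path_space X K') (\<lambda>(a, b). (a, restrict b K'))"
    by (subst distr_distr) (auto simp: o_def int)
  also have "\<dots> = kernel_prod (Proj X J \<pi>) (path_space X K') (\<lambda>x. distr (\<kappa> x) (path_space X K') (\<lambda>y. restrict y K'))"
    unfolding eq by (rule distr_kernel_prod[OF prob_space_Proj[OF \<pi> sub(2)] k'])
      (auto intro!: sets_pair_measure_cong)
  finally show ?thesis
    using measurable_compose[OF k measurable_distr_prob_space[of "\<lambda>y. restrict y K'" "path_space X K" "path_space X K'"]]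
    unfolding disintegrates_def Let_def J JK(1)[symmetric] JK(3)[symmetric]
    by (simp add: Proj_Proj[OF \<pi>(2) sub(4) I'])
qed

section \<open>The martingale property as orthogonality of increments to the past\<close>

lemma compact_paths_bounded:
  fixes X :: "nat \<Rightarrow> 'a::euclidean_space set"
  assumes "finite I" "\<And>i. i \<in> I \<Longrightarrow> compact (X i)"
  shows "\<exists>B. \<forall>i\<in>I. \<forall>y\<in>X i. norm y \<le> B"
proof -
  have "bounded (\<Union>i\<in>I. X i)" using assms by (intro bounded_UN) (auto intro: compact_imp_bounded)
  then show ?thesis by (auto simp: bounded_iff)
qed

text \<open>The right-hand side depends on \<open>\<pi>\<close> alone, so it can be transported
  between laws without comparing kernels. This is the form in which the martingale property is used
  and verified below.\<close>

lemma disintegrates_barycenter_iff: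
  fixes X :: "nat \<Rightarrow> 'a::euclidean_space set"
  assumes \<pi>: "prob_space \<pi>" "sets \<pi> = sets (path_space X I)"
    and I: "finite I" "\<And>i. i \<in> I \<Longrightarrow> compact (X i)"
    and d: "disintegrates X I i \<pi> \<kappa>" and ij: "i \<in> I" "j \<in> I" "i < j"
  shows "(AE x in Proj X {k\<in>I. k \<le> i} \<pi>. (\<integral>y. y j \<partial>\<kappa> x) = x i) \<longleftrightarrow>
    (\<forall>A\<in>sets (path_space X {k\<in>I. k \<le> i}). \<forall>e\<in>Basis.
      (\<integral>x. indicator A (restrict x {k\<in>I. k \<le> i}) * ((x j - x i) \<bullet> e) \<partial>\<pi>) = 0)"
proof -
  define J K where JK: "J = {k\<in>I. k \<le> i}" "K = {k\<in>I. i < k}"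
  have sub: "J \<subseteq> I" "K \<subseteq> I" "i \<in> J" "j \<in> K" using ij by (auto simp: JK)
  obtain B where B: "\<And>i y. i \<in> I \<Longrightarrow> y \<in> X i \<Longrightarrow> norm y \<le> B" 
    using compact_paths_bounded[of I X] I by blast
  have k[measurable]: "\<kappa> \<in> path_space X J \<rightarrow>\<^sub>M prob_algebra (path_space X K)"
    and eq: "distr \<pi> (path_space X J \<Otimes>\<^sub>M path_space X K) (\<lambda>x. (restrict x J, restrict x K))
          = kernel_prod (Proj X J \<pi>) (path_space X K) \<kappa>"
    using d by (auto simp: disintegrates_def Let_def JK)
  note [measurable_cong] = \<pi>(2)
  note coord[measurable] = measurable_path_coordinate(2)[OF sub(3), of X] measurable_path_coordinate(2)[OF sub(4), of X]
  have rm[measurable]: "(\<lambda>y. restrict y J) \<in> path_space X I \<rightarrow>\<^sub>M path_space X J" "(\<lambda>y. restrict y K) \<in> path_space X I \<rightarrow>\<^sub>M path_space X K"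
    using sub by (simp_all add: measurable_restrict_path)
  have spP: "space (Proj X J \<pi>) = PiE J X" by (simp add: Proj_def space_path_space)
  have "(AE x in Proj X J \<pi>. (\<integral>y. y j \<partial>\<kappa> x) = x i) \<longleftrightarrow>
    (\<forall>A\<in>sets (Proj X J \<pi>). \<forall>e\<in>Basis.
      (\<integral>z. indicator A (fst z) * ((snd z j - fst z i) \<bullet> e) \<partial>kernel_prod (Proj X J \<pi>) (path_space X K) \<kappa>) = 0)"
  proof (rule kernel_barycenter_iff[OF prob_space_Proj[OF \<pi> sub(1)], where B = B])
    show "norm (x i) \<le> B" if "x \<in> space (Proj X J \<pi>)" for x
      using that sub B[of i "x i"] ij by (auto simp: spP)
    show "norm (y j) \<le> B" if "y \<in> space (path_space X K)" for y
      using that sub B[of j "y j"] ij by (auto simp: space_path_space)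
  qed measurable
  also have "\<dots> \<longleftrightarrow> (\<forall>A\<in>sets (path_space X J). \<forall>e\<in>Basis.
      (\<integral>x. indicator A (restrict x J) * ((x j - x i) \<bullet> e) \<partial>\<pi>) = 0)"
  proof -
    have "(\<integral>z. indicator A (fst z) * ((snd z j - fst z i) \<bullet> e) \<partial>kernel_prod (Proj X J \<pi>) (path_space X K) \<kappa>)
        = (\<integral>x. indicator A (restrict x J) * ((x j - x i) \<bullet> e) \<partial>\<pi>)"
      if [measurable]: "A \<in> sets (path_space X J)" for A e
      unfolding eq[symmetric] using sub by (subst integral_distr) auto
    then show ?thesis by simp
  qed
  finally show ?thesis unfolding JK(1) .
qed

lemma borel_measurable_increment:
  fixes X :: "nat \<Rightarrow> 'a::euclidean_space set"
  assumes ij: "i \<in> I" "j \<in> I" and J: "J \<subseteq> I" and A: "A \<in> sets (path_space X J)"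
  shows "(\<lambda>x. indicator A (restrict x J) * ((x j - x i) \<bullet> e) :: real) \<in> borel_measurable (path_space X I)"
  by (intro borel_measurable_times borel_measurable_inner borel_measurable_diff borel_measurable_const
      measurable_path_coordinate(2) ij measurable_compose[OF measurable_restrict_path[OF J] borel_measurable_indicator[OF A]])

lemma integrable_increment:
  fixes X :: "nat \<Rightarrow> 'a::euclidean_space set"
  assumes \<pi>: "prob_space \<pi>" "sets \<pi> = sets (path_space X I)"
    and I: "finite I" "\<And>i. i \<in> I \<Longrightarrow> compact (X i)" and ij: "i \<in> I" "j \<in> I" and e: "e \<in> Basis"
    and J: "J \<subseteq> I" and A: "A \<in> sets (path_space X J)"
  shows "integrable \<pi> (\<lambda>x. indicator A (restrict x J) * ((x j - x i) \<bullet> e))"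
proof -
  interpret prob_space \<pi> by fact
  obtain B where B: "\<And>i y. i \<in> I \<Longrightarrow> y \<in> X i \<Longrightarrow> norm y \<le> B"
    using compact_paths_bounded[of I X] I by blast
  show ?thesis
  proof (rule integrable_const_bound[of _ "2 * B"])
    show "AE x in \<pi>. norm (indicator A (restrict x J) * ((x j - x i) \<bullet> e)) \<le> 2 * B"
    proof (rule AE_I2)
      fix x assume "x \<in> space \<pi>"
      then have "x \<in> PiE I X" using sets_eq_imp_space_eq[OF \<pi>(2)] by (simp add: space_path_space)
      then have b: "norm (x j) \<le> B" "norm (x i) \<le> B" using B ij by auto
      have "norm (indicator A (restrict x J) * ((x j - x i) \<bullet> e)) \<le> \<bar>(x j - x i) \<bullet> e\<bar>"
        by (auto simp: indicator_def)
      also have "\<dots> \<le> norm (x j - x i)" by (rule Basis_le_norm[OF e])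
      also have "\<dots> \<le> 2 * B" using b norm_triangle_ineq4[of "x j" "x i"] by simp
      finally show "norm (indicator A (restrict x J) * ((x j - x i) \<bullet> e)) \<le> 2 * B" .
    qed
  qed (simp add: measurable_cong_sets[OF \<pi>(2) refl] borel_measurable_increment[OF ij J A])
qed

text \<open>Each increment is orthogonal to its whole past, hence to functions of x_1; telescoping
  makes x_i - x_1 orthogonal to them too. A disintegration of the projection comes from the one of
  \<open>\<pi>\<close> at time 1 by forgetting the other times.\<close>

lemma Proj_mart_couplings:
  fixes X :: "nat \<Rightarrow> 'a::euclidean_space set"
  assumes X: "\<And>i. i \<in> {1..n} \<Longrightarrow> compact (X i)"
    and mart: "\<pi> \<in> mart_couplings X {1..n} \<mu>" and i: "i \<in> {2..n}"
  shows "Proj X {1, i} \<pi> \<in> mart_couplings X {1, i} \<mu>"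
proof -
  have \<pi>: "\<pi> \<in> couplings X {1..n} \<mu>" using mart by (simp add: mart_couplings_def)
  note D = couplingsD[OF \<pi>]
  have C: "\<exists>\<kappa>. disintegrates X {1..n} k \<pi> \<kappa> \<and>
      (AE x in Proj X {l\<in>{1..n}. l \<le> k} \<pi>. (\<integral>y. y (Suc k) \<partial>\<kappa> x) = x k)" if "1 \<le> k" "k < n" for k
  proof -
    have "k \<in> {1..n}" "Suc k \<in> {1..n}" "k < Suc k \<and> {k<..<Suc k} \<inter> {1..n} = {}" using that by auto
    then show ?thesis using mart unfolding mart_couplings_def by blast
  qed
  have sub: "{1, i} \<subseteq> {1..n}" using i by auto
  have J1: "{l\<in>{1..n}. l \<le> 1} = {1}" "{l\<in>{1, i}. l \<le> 1} = {1}" using i by auto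
  have inc1: "(\<integral>x. indicator A (restrict x {1}) * ((x (Suc k) - x k) \<bullet> e) \<partial>\<pi>) = 0"
    if k: "1 \<le> k" "k < n" and A[measurable]: "A \<in> sets (path_space X {1})" and e: "e \<in> Basis" for A k e
  proof -
    let ?J = "{l\<in>{1..n}. l \<le> k}"
    obtain \<kappa> where "disintegrates X {1..n} k \<pi> \<kappa>" "AE x in Proj X ?J \<pi>. (\<integral>y. y (Suc k) \<partial>\<kappa> x) = x k"
      using C[OF k] by blast
    then have *: "\<forall>A\<in>sets (path_space X ?J). \<forall>e\<in>Basis.
      (\<integral>x. indicator A (restrict x ?J) * ((x (Suc k) - x k) \<bullet> e) \<partial>\<pi>) = 0"
      using disintegrates_barycenter_iff[OF D(1,2) _ X, of k \<kappa> "Suc k"] k by auto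
    \<comment> \<open>An event of time 1 is read as an event of the past up to k.\<close>
    define A' where "A' = (\<lambda>y. restrict y {1}) -` A \<inter> space (path_space X ?J)"
    have "A' \<in> sets (path_space X ?J)" unfolding A'_def
      by (rule measurable_sets[OF measurable_restrict_path A]) (use k in auto)
    then have "(\<integral>x. indicator A' (restrict x ?J) * ((x (Suc k) - x k) \<bullet> e) \<partial>\<pi>) = 0" using * e by blast
    moreover have "indicator A' (restrict x ?J) = (indicator A (restrict x {1}) :: real)" if "x \<in> space \<pi>" for x
    proof -
      have "restrict x ?J \<in> space (path_space X ?J)" using that by (auto simp: D(3) space_path_space)
      moreover have "?J \<inter> {1} = {1}" using k by auto
      ultimately show ?thesis by (simp add: A'_def indicator_def)
    qed
    ultimately show ?thesis by (simp cong: Bochner_Integration.integral_cong)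
  qed
  have inc: "(\<integral>x. indicator A (restrict x {1}) * ((x k - x 1) \<bullet> e) \<partial>\<pi>) = 0"
    if A: "A \<in> sets (path_space X {1})" and e: "e \<in> Basis" and k: "1 \<le> k" "k \<le> n" for A e k
    using k
  proof (induction k rule: dec_induct)
    case (step k)
    have I: "integrable \<pi> (\<lambda>x. indicator A (restrict x {1}) * ((x j - x i) \<bullet> e))" if "i \<in> {1..n}" "j \<in> {1..n}" for i j
      using that i by (intro integrable_increment[OF D(1,2) _ X _ _ e _ A]) auto
    have "(\<integral>x. indicator A (restrict x {1}) * ((x (Suc k) - x 1) \<bullet> e) \<partial>\<pi>)
      = (\<integral>x. indicator A (restrict x {1}) * ((x (Suc k) - x k) \<bullet> e) + indicator A (restrict x {1}) * ((x k - x 1) \<bullet> e) \<partial>\<pi>)"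
      by (intro Bochner_Integration.integral_cong) (auto simp: inner_diff_left algebra_simps)
    also have "\<dots> = 0"
    proof -
      have "1 \<in> {1..n}" "k \<in> {1..n}" "Suc k \<in> {1..n}" "1 \<le> k" "k < n" "k \<le> n" using step by auto
      then show ?thesis
        using step.IH inc1[OF _ _ A e, of k]
        by (simp only: Bochner_Integration.integral_add[OF I I] add_0)
    qed
    finally show ?case .
  qed simp
  obtain \<kappa> where \<kappa>: "disintegrates X {1..n} 1 \<pi> \<kappa>" using C[of 1] i by auto
  define \<kappa>' where "\<kappa>' = (\<lambda>x. distr (\<kappa> x) (path_space X {k\<in>{1, i}. 1 < k}) (\<lambda>y. restrict y {k\<in>{1, i}. 1 < k}))"
  have d: "disintegrates X {1, i} 1 (Proj X {1, i} \<pi>) \<kappa>'"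
    unfolding \<kappa>'_def by (rule disintegrates_Proj[OF D(1,2) sub _ \<kappa>]) (use J1 in simp)
  have r: "(\<lambda>x. restrict x {1, i}) \<in> \<pi> \<rightarrow>\<^sub>M path_space X {1, i}"
    by (simp only: measurable_restrict_path[OF sub] measurable_cong_sets[OF D(2) refl])
  have "(\<integral>x. indicator A (restrict x {1}) * ((x i - x 1) \<bullet> e) \<partial>Proj X {1, i} \<pi>) = 0"
    if A[measurable]: "A \<in> sets (path_space X {1})" and e: "e \<in> Basis" for A e
  proof -
    have m: "(\<lambda>x. indicator A (restrict x {1}) * ((x i - x 1) \<bullet> e)) \<in> borel_measurable (path_space X {1, i})"
      by (rule borel_measurable_increment[OF _ _ _ A]) auto
    have "{1, i} \<inter> {1} = {1}" by auto
    then show ?thesis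
      unfolding Proj_def integral_distr[OF r m] using inc[OF A e, of i] i by simp
  qed
  moreover have "(AE x in Proj X {1} (Proj X {1, i} \<pi>). (\<integral>y. y i \<partial>\<kappa>' x) = x 1) \<longleftrightarrow>
    (\<forall>A\<in>sets (path_space X {1}). \<forall>e\<in>Basis.
      (\<integral>x. indicator A (restrict x {1}) * ((x i - x 1) \<bullet> e) \<partial>Proj X {1, i} \<pi>) = 0)"
    by (rule disintegrates_barycenter_iff[OF prob_space_Proj[OF D(1,2) sub] sets_Proj _ _ d, of i, unfolded J1(2)])
       (use X i in auto)
  ultimately have "AE x in Proj X {1} (Proj X {1, i} \<pi>). (\<integral>y. y i \<partial>\<kappa>' x) = x 1" by blast
  then have AE: "AE x in Proj X {l\<in>{1, i}. l \<le> 1} (Proj X {1, i} \<pi>). (\<integral>y. y i \<partial>\<kappa>' x) = x 1"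
    by (simp only: J1)
  have ex: "\<exists>\<kappa>. disintegrates X {1, i} k (Proj X {1, i} \<pi>) \<kappa> \<and>
      (AE x in Proj X {l\<in>{1, i}. l \<le> k} (Proj X {1, i} \<pi>). (\<integral>y. y j \<partial>\<kappa> x) = x k)"
    if "k \<in> {1, i}" "j \<in> {1, i}" "k < j" for k j
  proof -
    have "k = 1" "j = i" using that i by auto
    then show ?thesis using AE d by blast
  qed
  show ?thesis unfolding mart_couplings_def mem_Collect_eq
  proof (intro conjI ballI impI Proj_couplings[OF \<pi> sub])
    fix k j assume "k \<in> {1, i}" "j \<in> {1, i}" "k < j \<and> {k<..<j} \<inter> {1, i} = {}"
    then show "\<exists>\<kappa>. disintegrates X {1, i} k (Proj X {1, i} \<pi>) \<kappa> \<and>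
        (AE x in Proj X {l\<in>{1, i}. l \<le> k} (Proj X {1, i} \<pi>). (\<integral>y. y j \<partial>\<kappa> x) = x k)"
      by (intro ex) auto
  qed
qed

section \<open>Continuous functions on the compact path space, and disintegrations\<close>

lemma compact_PiE_paths:
  fixes X :: "nat \<Rightarrow> 'a::euclidean_space set"
  assumes "\<And>i. i \<in> I \<Longrightarrow> compact (X i)"
  shows "compact (PiE I X)"
proof -
  \<comment> \<open>Outside \<open>I\<close> an extensional path has the single value
    \<open>undefined\<close>, so Tychonoff is applied with singletons there.\<close>
  have "compactin (product_topology (\<lambda>i::nat. euclidean :: 'a topology) UNIV)
      (PiE UNIV (\<lambda>i. if i \<in> I then X i else {undefined}))"
    unfolding compactin_PiE using assms by auto
  moreover have "PiE UNIV (\<lambda>i. if i \<in> I then X i else {undefined}) = PiE I X"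
    by (auto simp: PiE_iff extensional_def split: if_splits)
  ultimately show ?thesis by (simp add: euclidean_product_topology)
qed

lemma continuous_on_restrict_path: "continuous_on UNIV (\<lambda>x :: nat \<Rightarrow> 'a::euclidean_space. restrict x J)"
proof (rule continuous_on_coordinatewise_then_product)
  fix i show "continuous_on UNIV (\<lambda>x :: nat \<Rightarrow> 'a. restrict x J i)"
    by (cases "i \<in> J") auto
qed

lemma continuous_on_comp_restrict:
  fixes f :: "(nat \<Rightarrow> 'a::euclidean_space) \<Rightarrow> 'b::topological_space"
  assumes "continuous_on UNIV f"
  shows "continuous_on A (\<lambda>x. f (restrict x J))"
  using continuous_on_compose2[OF assms continuous_on_restrict_path[of J]]
  by (auto intro: continuous_on_subset)

lemma borel_measurable_path_continuous:
  fixes f :: "(nat \<Rightarrow> 'a::euclidean_space) \<Rightarrow> 'b::topological_space"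
  assumes "continuous_on UNIV f"
  shows "f \<in> borel_measurable (path_space X I)"
  using measurable_compose[OF measurable_path_borel borel_measurable_continuous_onI[OF assms]] by simp

lemma bounded_path_continuous:
  fixes X :: "nat \<Rightarrow> 'a::euclidean_space set" and f :: "(nat \<Rightarrow> 'a) \<Rightarrow> 'b::real_normed_vector"
  assumes "\<And>i. i \<in> I \<Longrightarrow> compact (X i)" "continuous_on UNIV f"
  shows "\<exists>B. \<forall>x\<in>PiE I X. norm (f x) \<le> B"
proof -
  have "bounded (f ` PiE I X)"
    by (intro compact_imp_bounded compact_continuous_image continuous_on_subset[OF assms(2)]
        compact_PiE_paths assms(1)) auto
  then show ?thesis by (auto simp: bounded_iff)
qed

lemma integrable_path_bounded:
  fixes f :: "(nat \<Rightarrow> 'a::euclidean_space) \<Rightarrow> real"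
  assumes \<pi>: "prob_space \<pi>" "sets \<pi> = sets (path_space X I)"
    and f: "f \<in> borel_measurable (path_space X I)" "\<And>x. x \<in> PiE I X \<Longrightarrow> \<bar>f x\<bar> \<le> B"
  shows "integrable \<pi> f"
proof -
  interpret prob_space \<pi> by fact
  show ?thesis
    using sets_eq_imp_space_eq[OF \<pi>(2)] f
    by (intro integrable_const_bound[of _ B])
       (auto intro!: AE_I2 simp: space_path_space measurable_cong_sets[OF \<pi>(2) refl])
qed

lemma integrable_path_continuous:
  fixes X :: "nat \<Rightarrow> 'a::euclidean_space set" and f :: "(nat \<Rightarrow> 'a) \<Rightarrow> real"
  assumes "prob_space \<pi>" "sets \<pi> = sets (path_space X I)" "\<And>i. i \<in> I \<Longrightarrow> compact (X i)" "continuous_on UNIV f"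
  shows "integrable \<pi> f"
proof -
  obtain B where "\<forall>x\<in>PiE I X. norm (f x) \<le> B" using bounded_path_continuous[of I X f] assms by blast
  then show ?thesis
    by (intro integrable_path_bounded[OF assms(1,2) borel_measurable_path_continuous[OF assms(4)], of B]) auto
qed

lemma measurable_into_path_space:
  fixes X :: "nat \<Rightarrow> 'a::euclidean_space set"
  assumes T: "T \<in> borel_measurable M" and r: "range T \<subseteq> PiE I X"
  shows "T \<in> M \<rightarrow>\<^sub>M path_space X I"
proof -
  have "(\<lambda>t i. T t i) \<in> M \<rightarrow>\<^sub>M path_space X I" unfolding path_space_def
  proof (rule measurable_PiM_single')
    fix i assume i: "i \<in> I"
    have "(\<lambda>t. T t i) \<in> borel_measurable M"
      using measurable_compose[OF T borel_measurable_continuous_onI[OF continuous_on_product_coordinates[of i]]] by simp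
    then show "(\<lambda>t. T t i) \<in> M \<rightarrow>\<^sub>M borel_on (X i)"
      using r i by (intro measurable_restrict_space2) auto
  qed (use r in \<open>auto simp: space_restrict_space\<close>)
  then show ?thesis by simp
qed

text \<open>Past and future are both functions of the real parameter. The conditional law of the
  parameter given the past, pushed forward by the future \<open>F\<close>, is therefore a
  conditional law of the future.\<close>

lemma disintegration_exists:
  fixes X :: "nat \<Rightarrow> 'a::euclidean_space set"
  assumes L: "real_distribution L" "AE t in L. 0 \<le> t \<and> t \<le> 1"
    and T[measurable]: "T \<in> borel \<rightarrow>\<^sub>M path_space X I"
  shows "\<exists>\<kappa>. disintegrates X I i (distr L (path_space X I) T) \<kappa>"
proof -
  interpret L: real_distribution L by fact
  define J K where JK: "J = {k\<in>I. k \<le> i}" "K = {k\<in>I. i < k}"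
  have [measurable]: "(\<lambda>y. restrict y J) \<in> path_space X I \<rightarrow>\<^sub>M path_space X J"
    "(\<lambda>y. restrict y K) \<in> path_space X I \<rightarrow>\<^sub>M path_space X K"
    by (auto simp: JK intro!: measurable_restrict_path)
  define G where "G t = restrict (T t) J" for t
  define F where "F t = restrict (T t) K" for t
  have [measurable]: "G \<in> borel \<rightarrow>\<^sub>M path_space X J" "F \<in> borel \<rightarrow>\<^sub>M path_space X K"
    unfolding G_def F_def
    by (auto simp: JK intro!: measurable_compose[OF T measurable_restrict_path])
  obtain \<eta> where \<eta>[measurable]: "\<eta> \<in> path_space X J \<rightarrow>\<^sub>M prob_algebra borel"
    and eq: "distr L (path_space X J \<Otimes>\<^sub>M borel) (\<lambda>t. (G t, t)) = kernel_prod (distr L (path_space X J) G) borel \<eta>"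
    using conditional_law_exists[OF L \<open>G \<in> borel \<rightarrow>\<^sub>M path_space X J\<close>] by (elim exE conjE) (rule that)
  define \<rho> where "\<rho> = distr L (path_space X I) T"
  have M: "Proj X J \<rho> = distr L (path_space X J) G"
    unfolding Proj_def \<rho>_def by (subst distr_distr) (auto simp: o_def G_def[abs_def])
  have "distr \<rho> (path_space X J \<Otimes>\<^sub>M path_space X K) (\<lambda>x. (restrict x J, restrict x K))
      = distr L (path_space X J \<Otimes>\<^sub>M path_space X K) (\<lambda>t. (G t, F t))"
    unfolding \<rho>_def by (subst distr_distr) (auto simp: o_def G_def F_def)
  also have "\<dots> = distr (distr L (path_space X J \<Otimes>\<^sub>M borel) (\<lambda>t. (G t, t)))
      (path_space X J \<Otimes>\<^sub>M path_space X K) (\<lambda>(a, b). (a, F b))"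
    by (subst distr_distr) (auto simp: o_def)
  also have "\<dots> = kernel_prod (Proj X J \<rho>) (path_space X K) (\<lambda>x. distr (\<eta> x) (path_space X K) F)"
    unfolding eq M
  proof (rule distr_kernel_prod)
    show "prob_space (distr L (path_space X J) G)" by (rule L.prob_space_distr) simp
  qed (auto intro!: sets_pair_measure_cong)
  finally have eq': "distr \<rho> (path_space X J \<Otimes>\<^sub>M path_space X K) (\<lambda>x. (restrict x J, restrict x K))
      = kernel_prod (Proj X J \<rho>) (path_space X K) (\<lambda>x. distr (\<eta> x) (path_space X K) F)" .
  have "(\<lambda>x. distr (\<eta> x) (path_space X K) F) \<in> path_space X J \<rightarrow>\<^sub>M prob_algebra (path_space X K)"
    by (rule measurable_compose[OF \<eta> measurable_distr_prob_space]) simp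
  with eq' show ?thesis
    unfolding disintegrates_def Let_def JK[symmetric] \<rho>_def[symmetric] by blast
qed

text \<open>
  A bounded signed weight \<open>D\<close> that integrates to zero against all continuous functions of the past
  does so against all measurable ones: shifted by a constant, \<open>D\<close> is the density of a measure.
\<close>

lemma weight_orthogonal_extend:
  fixes X :: "nat \<Rightarrow> 'a::euclidean_space set" and D :: "(nat \<Rightarrow> 'a) \<Rightarrow> real"
  assumes \<pi>: "prob_space \<pi>" "sets \<pi> = sets (path_space X I)" and J: "J \<subseteq> I"
    and I: "finite I" "\<And>i. i \<in> I \<Longrightarrow> compact (X i)"
    and Dm: "D \<in> borel_measurable (path_space X I)" and Db: "\<And>x. x \<in> PiE I X \<Longrightarrow> \<bar>D x\<bar> \<le> B"
    and orth: "\<And>f :: (nat \<Rightarrow> 'a) \<Rightarrow> real. continuous_on UNIV f \<Longrightarrow> (\<integral>x. f (restrict x J) * D x \<partial>\<pi>) = 0"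
    and A: "A \<in> sets (path_space X J)"
  shows "(\<integral>x. indicator A (restrict x J) * D x \<partial>\<pi>) = 0"
proof -
  interpret prob_space \<pi> by fact
  note \<pi>(2)[measurable_cong] Dm[measurable]
  have r[measurable]: "(\<lambda>y. restrict y J) \<in> path_space X I \<rightarrow>\<^sub>M path_space X J"
    using J by (rule measurable_restrict_path)
  have sp: "space \<pi> = PiE I X" using sets_eq_imp_space_eq[OF \<pi>(2)] by (simp add: space_path_space)
  have ne: "space \<pi> \<noteq> {}" by (rule not_empty)
  then obtain x where "x \<in> PiE I X" using sp by blast
  then have B0: "0 \<le> B" using Db[of x] abs_ge_zero[of "D x"] by linarith
  define Q where "Q w = distr (density \<pi> (\<lambda>x. ennreal (w x))) (path_space X J) (\<lambda>x. restrict x J)" for w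
  have int: "(\<integral>x. h x \<partial>Q w) = (\<integral>x. w x * h (restrict x J) \<partial>\<pi>)"
    if h[measurable]: "h \<in> borel_measurable (path_space X J)" and w[measurable]: "w \<in> borel_measurable (path_space X I)"
      and w0: "\<And>x. x \<in> PiE I X \<Longrightarrow> 0 \<le> w x" for h w
  proof -
    have "(\<integral>x. h x \<partial>Q w) = (\<integral>x. h (restrict x J) \<partial>density \<pi> (\<lambda>x. ennreal (w x)))"
      unfolding Q_def by (rule integral_distr) measurable
    also have "\<dots> = (\<integral>x. w x * h (restrict x J) \<partial>\<pi>)"
      by (rule integral_real_density) (use w0 sp in \<open>auto intro!: AE_I2\<close>)
    finally show ?thesis .
  qed
  have fin: "finite_measure (Q w)"
    if w[measurable]: "w \<in> borel_measurable (path_space X I)" and wb: "\<And>x. x \<in> PiE I X \<Longrightarrow> w x \<le> 2 * B" for w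
  proof -
    have "(\<integral>\<^sup>+x. ennreal (w x) \<partial>\<pi>) \<le> (\<integral>\<^sup>+x. ennreal (2 * B) \<partial>\<pi>)"
      using wb sp by (intro nn_integral_mono ennreal_leI) auto
    also have "\<dots> < \<infinity>" by (simp add: emeasure_space_1)
    finally have "finite_measure (density \<pi> (\<lambda>x. ennreal (w x)))"
      by (intro finite_measureI) (simp add: emeasure_density cong: nn_integral_cong)
    then show ?thesis unfolding Q_def by (rule finite_measure.finite_measure_distr) measurable
  qed
  let ?D = "\<lambda>x. D x + B"
  have D0: "0 \<le> D x + B" "D x + B \<le> 2 * B" if "x \<in> PiE I X" for x using Db[OF that] by auto
  have ib: "integrable \<pi> (\<lambda>x. h (restrict x J))" "integrable \<pi> (\<lambda>x. h (restrict x J) * D x)"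
    if h[measurable]: "h \<in> borel_measurable (path_space X J)" and hb: "\<And>x. 0 \<le> h x \<and> h x \<le> 1" for h
  proof -
    show "integrable \<pi> (\<lambda>x. h (restrict x J))"
      by (rule integrable_path_bounded[OF \<pi>, of _ 1]) (use hb in \<open>auto simp: abs_le_iff intro: order_trans[of _ 0]\<close>)
    show "integrable \<pi> (\<lambda>x. h (restrict x J) * D x)"
    proof (rule integrable_path_bounded[OF \<pi>, of _ B])
      fix x assume x: "x \<in> PiE I X"
      have "\<bar>h (restrict x J) * D x\<bar> \<le> 1 * B"
        unfolding abs_mult using hb[of "restrict x J"] Db[OF x] by (intro mult_mono) auto
      then show "\<bar>h (restrict x J) * D x\<bar> \<le> B" by simp
    qed measurable
  qed
  have diff: "(\<integral>x. h x \<partial>Q ?D) = (\<integral>x. h (restrict x J) * D x \<partial>\<pi>) + (\<integral>x. h x \<partial>Q (\<lambda>_. B))"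
    if h: "h \<in> borel_measurable (path_space X J)" and hb: "\<And>x. 0 \<le> h x \<and> h x \<le> 1" for h
  proof -
    have "(\<integral>x. h x \<partial>Q ?D) = (\<integral>x. h (restrict x J) * D x + B * h (restrict x J) \<partial>\<pi>)"
      using D0 Dm by (subst int[OF h]) (auto simp: algebra_simps)
    also have "\<dots> = (\<integral>x. h (restrict x J) * D x \<partial>\<pi>) + (\<integral>x. B * h (restrict x J) \<partial>\<pi>)"
      using ib[OF h hb] by (intro Bochner_Integration.integral_add) auto
    also have "(\<integral>x. B * h (restrict x J) \<partial>\<pi>) = (\<integral>x. h x \<partial>Q (\<lambda>_. B))"
      using B0 by (subst int[OF h]) auto
    finally show ?thesis .
  qed
  have "Q ?D = Q (\<lambda>_. B)"
  proof (rule path_measure_eqI_continuous[where X = X and I = J])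
    show "finite J" using I J finite_subset by blast
    show "closed (X i)" if "i \<in> J" for i using I J that compact_imp_closed by blast
    show "finite_measure (Q ?D)" "finite_measure (Q (\<lambda>_. B))"
      using D0 B0 Dm by (auto intro!: fin)
    show "sets (Q ?D) = sets (path_space X J)" "sets (Q (\<lambda>_. B)) = sets (path_space X J)"
      by (simp_all only: Q_def sets_distr)
    fix f :: "(nat \<Rightarrow> 'a) \<Rightarrow> real" assume f: "continuous_on UNIV f" "\<And>x. 0 \<le> f x \<and> f x \<le> 1"
    show "(\<integral>x. f x \<partial>Q ?D) = (\<integral>x. f x \<partial>Q (\<lambda>_. B))"
      using diff[OF borel_measurable_path_continuous[OF f(1)] f(2)] orth[OF f(1)] by simp
  qed
  moreover have "indicator A \<in> borel_measurable (path_space X J)" using A by simp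
  ultimately show ?thesis using diff[of "indicator A"] by simp
qed

section \<open>Gluing\<close>

text \<open>Inverse of reading off \<open>(x 1, x i)\<close>. It translates between
  \<open>P i\<close>, a law on paths, and the kernels, which are laws on points.\<close>

definition pair_path :: "nat \<Rightarrow> 'a \<Rightarrow> 'a \<Rightarrow> nat \<Rightarrow> 'a" where
  "pair_path i a b = (\<lambda>k\<in>{1, i}. if k = 1 then a else b)"

lemma pair_path_eq:
  assumes "x \<in> extensional {1, i}" "i \<noteq> 1"
  shows "pair_path i (x 1) (x i) = x"
  using assms by (auto simp: pair_path_def extensional_def fun_eq_iff)

lemma measurable_pair_path:
  fixes X :: "nat \<Rightarrow> 'a::euclidean_space set"
  shows "(\<lambda>z. pair_path i (fst z) (snd z)) \<in> borel_measurable (borel_on (X 1) \<Otimes>\<^sub>M borel_on (X i))"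
proof (rule measurable_coordinatewise_then_product)
  fix k
  have f: "fst \<in> borel_measurable (borel_on (X 1) \<Otimes>\<^sub>M borel_on (X i))"
    by (rule measurable_restrict_space2_iff[THEN iffD1, THEN conjunct1, OF measurable_fst])
  have s: "snd \<in> borel_measurable (borel_on (X 1) \<Otimes>\<^sub>M borel_on (X i))"
    by (rule measurable_restrict_space2_iff[THEN iffD1, THEN conjunct1, OF measurable_snd])
  show "(\<lambda>z. pair_path i (fst z) (snd z) k) \<in> borel_measurable (borel_on (X 1) \<Otimes>\<^sub>M borel_on (X i))"
    using f s by (cases "k = 1"; cases "k = i") (auto simp: pair_path_def)
qed

text \<open>
  The constraints on a law on \<open>\<Pi>\<^sub>E i\<in>{1..n}. X i\<close> to be a martingale with bivariate marginals \<open>P i\<close>,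
  tested against continuous functions.
\<close>

definition glue_test ::
  "nat \<Rightarrow> (nat \<Rightarrow> (nat \<Rightarrow> 'a::euclidean_space) measure) \<Rightarrow> (nat \<Rightarrow> (nat \<Rightarrow> 'a) \<Rightarrow> real) \<Rightarrow>
     (nat \<Rightarrow> (nat \<Rightarrow> 'a) \<Rightarrow> 'a) \<Rightarrow> (nat \<Rightarrow> 'a) \<Rightarrow> real" where
  "glue_test n P f g x =
     (\<Sum>i=2..n. f i (restrict x {1, i}) - (\<integral>y. f i y \<partial>P i)) +
     (\<Sum>i=1..<n. g i (restrict x {1..i}) \<bullet> (x (Suc i) - x i))"

definition glue_tests ::
  "nat \<Rightarrow> (nat \<Rightarrow> (nat \<Rightarrow> 'a::euclidean_space) measure) \<Rightarrow> ((nat \<Rightarrow> 'a) \<Rightarrow> real) set" where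
  "glue_tests n P = {h. \<exists>f g. h = glue_test n P f g \<and>
      (\<forall>i. continuous_on UNIV (f i)) \<and> (\<forall>i. continuous_on UNIV (g i))}"

section \<open>The linear space of tests\<close>

lemma glue_testsI:
  assumes "\<And>i. continuous_on UNIV (f i)" "\<And>i. continuous_on UNIV (g i)"
  shows "glue_test n P f g \<in> glue_tests n P"
  using assms by (auto simp: glue_tests_def)

lemma continuous_on_glue_tests:
  assumes "h \<in> glue_tests n P"
  shows "continuous_on S h"
proof -
  obtain f g where h: "h = glue_test n P f g"
    and f: "\<And>i. continuous_on UNIV (f i)" and g: "\<And>i. continuous_on UNIV (g i)"
    using assms by (auto simp: glue_tests_def)
  have c: "continuous_on S (\<lambda>x :: nat \<Rightarrow> 'a. x i)" for i
    using continuous_on_product_coordinates[of i] by (rule continuous_on_subset) simp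
  show ?thesis unfolding h glue_test_def
    by (intro continuous_intros continuous_on_comp_restrict f g c)
qed

lemma glue_tests_add:
  assumes P: "\<And>i f. i \<in> {2..n} \<Longrightarrow> continuous_on UNIV (f :: (nat \<Rightarrow> 'a::euclidean_space) \<Rightarrow> real) \<Longrightarrow> integrable (P i) f"
    and "h \<in> glue_tests n P" "h' \<in> glue_tests n P"
  shows "(\<lambda>x. h x + h' x) \<in> glue_tests n P"
proof -
  obtain f g where h: "h = glue_test n P f g"
    and f: "\<And>i. continuous_on UNIV (f i)" and g: "\<And>i. continuous_on UNIV (g i)"
    using assms(2) by (auto simp: glue_tests_def)
  obtain f' g' where h': "h' = glue_test n P f' g'"
    and f': "\<And>i. continuous_on UNIV (f' i)" and g': "\<And>i. continuous_on UNIV (g' i)"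
    using assms(3) by (auto simp: glue_tests_def)
  have "(\<lambda>x. h x + h' x) = glue_test n P (\<lambda>i y. f i y + f' i y) (\<lambda>i y. g i y + g' i y)"
  proof
    fix x
    have "(\<Sum>i=2..n. (f i (restrict x {1, i}) + f' i (restrict x {1, i})) - (\<integral>y. f i y + f' i y \<partial>P i))
      = (\<Sum>i=2..n. (f i (restrict x {1, i}) - (\<integral>y. f i y \<partial>P i)) + (f' i (restrict x {1, i}) - (\<integral>y. f' i y \<partial>P i)))"
      by (rule sum.cong) (auto simp: Bochner_Integration.integral_add[OF P[OF _ f] P[OF _ f']])
    then show "h x + h' x = glue_test n P (\<lambda>i y. f i y + f' i y) (\<lambda>i y. g i y + g' i y) x"
      by (simp add: h h' glue_test_def sum.distrib inner_add_left)
  qed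
  then show ?thesis using f f' g g' by (auto intro!: glue_testsI continuous_intros)
qed

lemma glue_tests_scale:
  assumes "h \<in> glue_tests n P"
  shows "(\<lambda>x. a * h x) \<in> glue_tests n P"
proof -
  obtain f g where h: "h = glue_test n P f g"
    and f: "\<And>i. continuous_on UNIV (f i)" and g: "\<And>i. continuous_on UNIV (g i)"
    using assms by (auto simp: glue_tests_def)
  have "(\<lambda>x. a * h x) = glue_test n P (\<lambda>i y. a * f i y) (\<lambda>i y. a *\<^sub>R g i y)"
    by (simp add: fun_eq_iff h glue_test_def distrib_left sum_distrib_left right_diff_distrib)
  then show ?thesis using f g by (auto intro!: glue_testsI continuous_intros)
qed

text \<open>The martingale property provides some disintegration on paths, not the given
  \<open>\<kappa>\<close>. Both barycenter conditions are equivalent to the same integrals under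
  \<open>P\<close>, so uniqueness of disintegrations is not invoked.\<close>

lemma kernel_barycenter:
  fixes X :: "nat \<Rightarrow> 'a::euclidean_space set"
  assumes X: "compact (X 1)" "compact (X i)" and i: "1 < i"
    and \<mu>: "\<mu> 1 \<in> space (prob_algebra (borel_on (X 1)))"
    and kernel: "\<kappa> \<in> borel_on (X 1) \<rightarrow>\<^sub>M prob_algebra (borel_on (X i))"
    and P_kernel: "distr P (borel_on (X 1) \<Otimes>\<^sub>M borel_on (X i)) (\<lambda>x. (x 1, x i))
          = kernel_prod (\<mu> 1) (borel_on (X i)) \<kappa>"
    and P: "P \<in> mart_couplings X {1, i} \<mu>"
  shows "AE x in \<mu> 1. (\<integral>y. y \<partial>\<kappa> x) = x"
proof -
  have Pc: "P \<in> couplings X {1, i} \<mu>" using P by (simp add: mart_couplings_def)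
  note D = couplingsD[OF Pc]
  have X': "compact (X k)" if "k \<in> {1, i}" for k using X that by auto
  have J1: "{l\<in>{1, i}. l \<le> 1} = {1}" using i by auto
  have \<mu>p: "prob_space (\<mu> 1)" and \<mu>s[measurable_cong]: "sets (\<mu> 1) = sets (borel_on (X 1))"
    using \<mu> by (auto simp: space_prob_algebra)
  obtain \<eta> where \<eta>: "disintegrates X {1, i} 1 P \<eta>"
    and AE: "AE x in Proj X {l\<in>{1, i}. l \<le> 1} P. (\<integral>y. y i \<partial>\<eta> x) = x 1"
  proof -
    have "1 \<in> {1, i}" "i \<in> {1, i}" "1 < i \<and> {1<..<i} \<inter> {1, i} = {}" using i by auto
    then show ?thesis using P that unfolding mart_couplings_def by blast
  qed
  have "(AE x in Proj X {1} P. (\<integral>y. y i \<partial>\<eta> x) = x 1) \<longleftrightarrow>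
    (\<forall>A\<in>sets (path_space X {1}). \<forall>e\<in>Basis.
      (\<integral>x. indicator A (restrict x {1}) * ((x i - x 1) \<bullet> e) \<partial>P) = 0)"
    by (rule disintegrates_barycenter_iff[OF D(1,2) _ X' \<eta>, of i, unfolded J1]) (use i in auto)
  with AE[unfolded J1] have inc: "\<forall>A\<in>sets (path_space X {1}). \<forall>e\<in>Basis.
      (\<integral>x. indicator A (restrict x {1}) * ((x i - x 1) \<bullet> e) \<partial>P) = 0"
    by blast
  obtain B where B: "\<And>k y. k \<in> {1, i} \<Longrightarrow> y \<in> X k \<Longrightarrow> norm y \<le> B"
    using compact_paths_bounded[of "{1, i}" X] X' by blast
  have id: "(\<lambda>x. x) \<in> borel_measurable (borel_on S)" for S :: "'a set"
    by (rule measurable_restrict_space1) simp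
  have k': "\<kappa> \<in> \<mu> 1 \<rightarrow>\<^sub>M prob_algebra (borel_on (X i))" using kernel by (simp only: measurable_cong_sets[OF \<mu>s refl])
  have "(AE x in \<mu> 1. (\<integral>y. y \<partial>\<kappa> x) = x) \<longleftrightarrow>
    (\<forall>A\<in>sets (\<mu> 1). \<forall>e\<in>Basis.
      (\<integral>z. indicator A (fst z) * ((snd z - fst z) \<bullet> e) \<partial>kernel_prod (\<mu> 1) (borel_on (X i)) \<kappa>) = 0)"
  proof (rule kernel_barycenter_iff[OF \<mu>p k', where B = B])
    show "(\<lambda>x. x) \<in> borel_measurable (\<mu> 1)" using id[of "X 1"] by (simp only: measurable_cong_sets[OF \<mu>s refl])
    show "norm x \<le> B" if "x \<in> space (\<mu> 1)" for x
      using that sets_eq_imp_space_eq[OF \<mu>s] by (intro B[of 1]) (auto simp: space_restrict_space)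
    show "norm y \<le> B" if "y \<in> space (borel_on (X i))" for y
      using that by (intro B[of i]) (auto simp: space_restrict_space)
  qed (rule id)
  moreover have "(\<integral>z. indicator A (fst z) * ((snd z - fst z) \<bullet> e) \<partial>kernel_prod (\<mu> 1) (borel_on (X i)) \<kappa>) = 0"
    if A: "A \<in> sets (\<mu> 1)" and e: "e \<in> Basis" for A e
  proof -
    have A1: "A \<in> sets (borel_on (X 1))" using A \<mu>s by simp
    have c: "(\<lambda>x. x 1) \<in> path_space X {1} \<rightarrow>\<^sub>M borel_on (X 1)" by (rule measurable_path_coordinate) simp
    define A' where "A' = (\<lambda>x. x 1) -` A \<inter> space (path_space X {1})"
    have A': "A' \<in> sets (path_space X {1})" unfolding A'_def by (rule measurable_sets[OF c A1])
    have f: "fst \<in> borel_measurable (borel_on (X 1) \<Otimes>\<^sub>M borel_on (X i))"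
      "snd \<in> borel_measurable (borel_on (X 1) \<Otimes>\<^sub>M borel_on (X i))"
      by (rule measurable_restrict_space2_iff[THEN iffD1, THEN conjunct1, OF measurable_fst]
          measurable_restrict_space2_iff[THEN iffD1, THEN conjunct1, OF measurable_snd])+
    have m: "(\<lambda>z. indicator A (fst z) * ((snd z - fst z) \<bullet> e) :: real) \<in> borel_measurable (borel_on (X 1) \<Otimes>\<^sub>M borel_on (X i))"
      by (intro borel_measurable_times borel_measurable_inner borel_measurable_diff borel_measurable_const f
          measurable_compose[OF measurable_fst borel_measurable_indicator[OF A1]])
    have r: "(\<lambda>x. (x 1, x i)) \<in> P \<rightarrow>\<^sub>M borel_on (X 1) \<Otimes>\<^sub>M borel_on (X i)"
      unfolding measurable_cong_sets[OF D(2) refl]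
      by (intro measurable_Pair measurable_path_coordinate) auto
    have "(\<integral>z. indicator A (fst z) * ((snd z - fst z) \<bullet> e) \<partial>kernel_prod (\<mu> 1) (borel_on (X i)) \<kappa>)
        = (\<integral>x. indicator A (x 1) * ((x i - x 1) \<bullet> e) \<partial>P)"
      unfolding P_kernel[symmetric] integral_distr[OF r m] by simp
    also have "\<dots> = (\<integral>x. indicator A' (restrict x {1}) * ((x i - x 1) \<bullet> e) \<partial>P)"
      by (intro Bochner_Integration.integral_cong)
         (auto simp: A'_def D(3) space_path_space indicator_def)
    finally show ?thesis using inc A' e by simp
  qed
  ultimately show ?thesis by blast
qed

text \<open>By compactness a strictly negative test is at most -e. For almost every starting point
  a, duality along the chain \<open>\<kappa> 2 a\<close>, ..., \<open>\<kappa> n a\<close> bounds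
  the sum of the integrals \<open>I i a\<close> by the sum of the constants \<open>Cst i\<close>
  minus e. Integrated over a, the left side becomes the sum of the \<open>Cst i\<close>, a
  contradiction.\<close>

lemma glue_tests_nonneg:
  fixes X :: "nat \<Rightarrow> 'a::euclidean_space set"
  assumes n: "2 \<le> n"
    and compact: "\<And>i. i \<in> {1..n} \<Longrightarrow> compact (X i)"
    and \<mu>: "\<mu> 1 \<in> space (prob_algebra (borel_on (X 1)))"
    and kernel: "\<And>i. i \<in> {2..n} \<Longrightarrow> \<kappa> i \<in> borel_on (X 1) \<rightarrow>\<^sub>M prob_algebra (borel_on (X i))"
    and P_kernel: "\<And>i. i \<in> {2..n} \<Longrightarrow>
        distr (P i) (borel_on (X 1) \<Otimes>\<^sub>M borel_on (X i)) (\<lambda>x. (x 1, x i))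
          = kernel_prod (\<mu> 1) (borel_on (X i)) (\<kappa> i)"
    and P: "\<And>i. i \<in> {2..n} \<Longrightarrow> P i \<in> mart_couplings X {1, i} \<mu>"
    and kernel_order: "\<And>i. i \<in> {2..<n} \<Longrightarrow> AE x in \<mu> 1. \<kappa> i x \<preceq>\<^sub>c \<kappa> (i + 1) x"
    and h: "h \<in> glue_tests n P"
  shows "\<exists>x\<in>PiE {1..n} X. 0 \<le> h x"
proof (rule ccontr)
  assume neg: "\<not> (\<exists>x\<in>PiE {1..n} X. 0 \<le> h x)"
  obtain f g where h_eq: "h = glue_test n P f g"
    and f: "\<And>i. continuous_on UNIV (f i)" and g: "\<And>i. continuous_on UNIV (g i)"
    using h by (auto simp: glue_tests_def)
  interpret M: prob_space "\<mu> 1" using \<mu> by (simp add: space_prob_algebra)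
  have \<mu>s: "sets (\<mu> 1) = sets (borel_on (X 1))" using \<mu> by (simp add: space_prob_algebra)
  have sp\<mu>: "space (\<mu> 1) = X 1" "space (\<mu> (Suc 0)) = X (Suc 0)"
    using sets_eq_imp_space_eq[OF \<mu>s] by (simp_all add: space_restrict_space)
  have Pc: "P i \<in> couplings X {1, i} \<mu>" if "i \<in> {2..n}" for i using P[OF that] by (simp add: mart_couplings_def)
  note D = couplingsD[OF Pc]
  obtain e where e: "e > 0" "\<And>x. x \<in> PiE {1..n} X \<Longrightarrow> h x \<le> - e"
  proof (cases "PiE {1..n} X = {}")
    case False
    then obtain x where "x \<in> PiE {1..n} X" "\<forall>y\<in>PiE {1..n} X. h y \<le> h x"
      using continuous_attains_sup[OF compact_PiE_paths[of "{1..n}" X] False continuous_on_glue_tests[OF h]] compact by auto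
    then show ?thesis using neg that[of "- h x"] by force
  qed (use that[of 1] in simp)
  define Cst where "Cst i = (\<integral>y. f i y \<partial>P i)" for i
  define F where "F i z = f i (pair_path i (fst z) (snd z))" for i and z :: "'a \<times> 'a"
  have Fm: "F i \<in> borel_measurable (borel_on (X 1) \<Otimes>\<^sub>M borel_on (X i))" for i
    unfolding F_def by (rule measurable_compose[OF measurable_pair_path borel_measurable_continuous_onI[OF f]])
  have "\<exists>B. \<forall>x\<in>PiE {1, i} X. \<bar>f i x\<bar> \<le> B" if "i \<in> {2..n}" for i
  proof -
    have "compact (X k)" if "k \<in> {1, i}" for k using that \<open>i \<in> {2..n}\<close> by (intro compact) auto
    from bounded_path_continuous[of "{1, i}" X "f i", OF this f] show ?thesis by (simp only: real_norm_def)
  qed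
  then obtain Bf where Bf: "\<And>i x. i \<in> {2..n} \<Longrightarrow> x \<in> PiE {1, i} X \<Longrightarrow> \<bar>f i x\<bar> \<le> Bf i" by metis
  have Fb: "\<bar>F i (a, y)\<bar> \<le> Bf i" if "i \<in> {2..n}" "a \<in> X 1" "y \<in> X i" for i a y
    unfolding F_def using that by (intro Bf) (auto simp: pair_path_def)
  have k: "\<kappa> i \<in> \<mu> 1 \<rightarrow>\<^sub>M prob_algebra (borel_on (X i))" if "i \<in> {2..n}" for i
    using kernel[OF that] by (simp only: measurable_cong_sets[OF \<mu>s refl])
  have kx: "\<kappa> i a \<in> space (prob_algebra (borel_on (X i)))" if "i \<in> {2..n}" "a \<in> X 1" for i a
    by (rule measurable_space[OF k[OF that(1)]]) (simp only: sp\<mu> that)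
  have Fm\<mu>: "F i \<in> borel_measurable (\<mu> 1 \<Otimes>\<^sub>M borel_on (X i))" for i
    using Fm[of i] \<mu>s by (simp cong: measurable_cong_sets sets_pair_measure_cong)
  have CF: "Cst i = (\<integral>a. \<integral>y. F i (a, y) \<partial>\<kappa> i a \<partial>\<mu> 1)" if i: "i \<in> {2..n}" for i
  proof -
    have r: "(\<lambda>x. (x 1, x i)) \<in> P i \<rightarrow>\<^sub>M borel_on (X 1) \<Otimes>\<^sub>M borel_on (X i)"
      unfolding measurable_cong_sets[OF D(2)[OF i] refl]
      by (intro measurable_Pair measurable_path_coordinate) auto
    have "Cst i = (\<integral>x. F i (x 1, x i) \<partial>P i)" unfolding Cst_def
    proof (rule Bochner_Integration.integral_cong)
      fix x assume "x \<in> space (P i)"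
      then have "x \<in> extensional {1, i}" by (auto simp: D(3)[OF i] PiE_def)
      then show "f i x = F i (x 1, x i)" using pair_path_eq[of x i] i by (simp add: F_def)
    qed simp
    also have "\<dots> = (\<integral>z. F i z \<partial>kernel_prod (\<mu> 1) (borel_on (X i)) (\<kappa> i))"
      unfolding P_kernel[OF i, symmetric] integral_distr[OF r Fm] ..
    also have "\<dots> = (\<integral>a. \<integral>y. F i (a, y) \<partial>\<kappa> i a \<partial>\<mu> 1)"
      using Fb[OF i]
      by (intro integral_kernel_prod[OF M.prob_space_axioms k[OF i] Fm\<mu>, of "Bf i"])
         (auto simp: space_pair_measure sp\<mu> space_restrict_space)
    finally show ?thesis .
  qed
  define I where "I i a = (\<integral>y. F i (a, y) \<partial>\<kappa> i a)" for i a
  have Ii: "integrable (\<mu> 1) (I i)" if i: "i \<in> {2..n}" for i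
  proof (rule M.integrable_const_bound[of _ "Bf i"])
    show "I i \<in> borel_measurable (\<mu> 1)"
      unfolding I_def by (rule kernel_integral_measurable[OF k[OF i] Fm\<mu>])
    show "AE a in \<mu> 1. norm (I i a) \<le> Bf i"
    proof (rule AE_I2)
      fix a assume a: "a \<in> space (\<mu> 1)"
      interpret K: prob_space "\<kappa> i a" using kx[OF i] a by (simp add: sp\<mu> space_prob_algebra)
      have s: "sets (\<kappa> i a) = sets (borel_on (X i))" using kx[OF i] a by (simp add: sp\<mu> space_prob_algebra)
      have b: "norm (F i (a, y)) \<le> Bf i" if "y \<in> space (\<kappa> i a)" for y
        using that Fb[OF i] a sets_eq_imp_space_eq[OF s] by (simp add: sp\<mu> space_restrict_space)
      have m: "(\<lambda>y. F i (a, y)) \<in> borel_measurable (\<kappa> i a)"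
        using measurable_compose[OF measurable_Pair1'[OF a] Fm\<mu>] by (simp add: measurable_cong_sets[OF s refl])
      have "norm (I i a) \<le> (\<integral>y. norm (F i (a, y)) \<partial>\<kappa> i a)" unfolding I_def by (rule integral_norm_bound)
      also have "\<dots> \<le> Bf i"
      proof (rule K.integral_le_const)
        show "integrable (\<kappa> i a) (\<lambda>y. norm (F i (a, y)))"
          using b m by (intro integrable_norm K.integrable_const_bound[of _ "Bf i"]) (auto intro!: AE_I2)
      qed (use b in \<open>auto intro!: AE_I2\<close>)
      finally show "norm (I i a) \<le> Bf i" .
    qed
  qed
  have main: "(\<Sum>i=2..n. I i a) \<le> (\<Sum>i=2..n. Cst i) - e"
    if a: "a \<in> X 1" and bary: "(\<integral>y. y \<partial>\<kappa> 2 a) = a" and ord: "\<And>i. i \<in> {2..<n} \<Longrightarrow> \<kappa> i a \<preceq>\<^sub>c \<kappa> (Suc i) a" for a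
  proof -
    \<comment> \<open>With a fixed, the first increment contributes an affine function of x_2 whose
      slope depends on a only. It is absorbed into the function at time 2, where the barycenter a of
      \<open>\<kappa> 2 a\<close> makes its integral vanish, so the chain can start at time
      2.\<close>
    define G where "G = g 1 (restrict (\<lambda>_. a) {1..1})"
    define f' where "f' i y = F i (a, y) + (if i = 2 then G \<bullet> (y - a) else 0)" for i y
    define g' where "g' i x = g i (restrict (x(1 := a)) {1..i})" for i x
    have Fam: "(\<lambda>y. F i (a, y)) \<in> borel_measurable (borel_on (X i))" for i
    proof -
      have "a \<in> space (borel_on (X 1))" using a by (simp add: space_restrict_space)
      from measurable_compose[OF measurable_Pair1'[OF this] Fm] show ?thesis .
    qed
    have Fab: "bounded ((\<lambda>y. F i (a, y)) ` X i)" if "i \<in> {2..n}" for i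
      unfolding bounded_iff using Fb[OF that a] by (intro exI[of _ "Bf i"]) auto
    have Gm: "(\<lambda>y. G \<bullet> (y - a)) \<in> borel_measurable (borel_on S)" for S
      by (rule measurable_restrict_space1) measurable
    have Gb: "bounded ((\<lambda>y. G \<bullet> (y - a)) ` X i)" if "i \<in> {2..n}" for i
      using that by (intro compact_imp_bounded compact_continuous_image continuous_intros compact) auto
    have "(\<Sum>i=2..n. \<integral>y. f' i y \<partial>\<kappa> i a) \<le> (\<Sum>i=2..n. Cst i) - e"
    proof (rule convex_order_chain_duality[where X = X and g = g'])
      show "2 \<le> n" by (rule n)
      show "compact (X i)" if "i \<in> {2..n}" for i using that by (intro compact) auto
      show "\<kappa> i a \<in> space (prob_algebra (borel_on (X i)))" if "i \<in> {2..n}" for i by (rule kx[OF that a])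
      show "\<kappa> i a \<preceq>\<^sub>c \<kappa> (Suc i) a" if "i \<in> {2..<n}" for i by (rule ord[OF that])
      show "f' i \<in> borel_measurable (borel_on (X i))" if "i \<in> {2..n}" for i
        unfolding f'_def using Fam[of i] Gm[of "X i"] by (cases "i = 2") auto
      show "bounded (f' i ` X i)" if "i \<in> {2..n}" for i
        unfolding f'_def using bounded_plus_comp[OF Fab[OF that] Gb[OF that]] Fab[OF that] by (cases "i = 2") auto
      show "g' i x = g' i y" if "i \<in> {2..<n}" "\<And>k. k \<in> {2..i} \<Longrightarrow> x k = y k" for i x y
      proof -
        have "restrict (x(1 := a)) {1..i} = restrict (y(1 := a)) {1..i}"
          using that(2) by (auto simp: restrict_def fun_eq_iff)
        then show ?thesis by (simp add: g'_def)
      qed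
      show "bounded (g' i ` {x. \<forall>k\<in>{2..i}. x k \<in> X k})" if "i \<in> {2..<n}" for i
      proof -
        have "compact (X k)" if "k \<in> {1..i}" for k
          using that \<open>i \<in> {2..<n}\<close> by (intro compact) auto
        then obtain B where B: "\<forall>x\<in>PiE {1..i} X. norm (g i x) \<le> B"
          using bounded_path_continuous[of "{1..i}" X "g i", OF _ g] by blast
        have "restrict (x(1 := a)) {1..i} \<in> PiE {1..i} X" if "\<forall>k\<in>{2..i}. x k \<in> X k" for x
          using that a by auto
        then have "norm (g' i x) \<le> B" if "\<forall>k\<in>{2..i}. x k \<in> X k" for x
          unfolding g'_def using B that by blast
        then show ?thesis unfolding bounded_iff by blast
      qed
      fix x assume x: "\<And>i. i \<in> {2..n} \<Longrightarrow> x i \<in> X i"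
      define z where "z = restrict (x(1 := a)) {1..n}"
      have "z \<in> PiE {1..n} X" using x a by (auto simp: z_def)
      then have "h z \<le> - e" by (rule e(2))
      then have "(\<Sum>i=2..n. f i (restrict z {1, i})) + (\<Sum>i=1..<n. g i (restrict z {1..i}) \<bullet> (z (Suc i) - z i))
          \<le> (\<Sum>i=2..n. Cst i) - e"
        by (simp add: h_eq glue_test_def sum_subtractf Cst_def)
      moreover have "(\<Sum>i=2..n. f i (restrict z {1, i})) = (\<Sum>i=2..n. F i (a, x i))"
      proof (rule sum.cong)
        fix i assume "i \<in> {2..n}"
        then have "restrict z {1, i} = pair_path i a (x i)" by (auto simp: z_def pair_path_def restrict_def fun_eq_iff)
        then show "f i (restrict z {1, i}) = F i (a, x i)" by (simp add: F_def)
      qed simp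
      moreover have "(\<Sum>i=1..<n. g i (restrict z {1..i}) \<bullet> (z (Suc i) - z i))
          = G \<bullet> (x 2 - a) + (\<Sum>i=2..<n. g' i x \<bullet> (x (Suc i) - x i))"
      proof -
        have rz: "restrict z {1..i} = restrict (x(1 := a)) {1..i}" if "i < n" for i
          using that by (auto simp: z_def restrict_def fun_eq_iff)
        have "(\<Sum>i=1..<n. g i (restrict z {1..i}) \<bullet> (z (Suc i) - z i))
            = g 1 (restrict z {1..1}) \<bullet> (z (Suc 1) - z 1) + (\<Sum>i=Suc 1..<n. g i (restrict z {1..i}) \<bullet> (z (Suc i) - z i))"
          using n by (intro sum.atLeast_Suc_lessThan) simp
        moreover have "restrict z {1..1} = restrict (\<lambda>_. a) {1..1}" using n by (auto simp: z_def restrict_def fun_eq_iff)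
        moreover have "z (Suc 1) = x 2" "z 1 = a" using n by (auto simp: z_def numeral_2_eq_2)
        moreover have "(\<Sum>i=Suc 1..<n. g i (restrict z {1..i}) \<bullet> (z (Suc i) - z i)) = (\<Sum>i=2..<n. g' i x \<bullet> (x (Suc i) - x i))"
          by (rule sum.cong) (auto simp: rz g'_def z_def)
        ultimately show ?thesis by (simp add: G_def)
      qed
      moreover have "(\<Sum>i=2..n. f' i (x i)) = (\<Sum>i=2..n. F i (a, x i)) + G \<bullet> (x 2 - a)"
      proof -
        have "(\<Sum>i=2..n. f' i (x i)) = (\<Sum>i=2..n. F i (a, x i) + (if i = 2 then G \<bullet> (x 2 - a) else 0))"
          by (rule sum.cong) (auto simp: f'_def)
        then show ?thesis using n by (simp add: sum.distrib)
      qed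
      ultimately show "(\<Sum>i=2..n. f' i (x i)) + (\<Sum>i=2..<n. g' i x \<bullet> (x (Suc i) - x i)) \<le> (\<Sum>i=2..n. Cst i) - e"
        by simp
    qed
    moreover have "(\<integral>y. f' i y \<partial>\<kappa> i a) = I i a" if i: "i \<in> {2..n}" for i
    proof -
      have Fi: "integrable (\<kappa> i a) (\<lambda>y. F i (a, y))" by (rule integrable_bounded_borel_on[OF kx[OF i a] Fam Fab[OF i]])
      show ?thesis
      proof (cases "i = 2")
        case True
        interpret K: prob_space "\<kappa> 2 a" using kx[OF i a] True by (simp add: space_prob_algebra)
        have s: "sets (\<kappa> 2 a) = sets (borel_on (X 2))" using kx[OF i a] True by (simp add: space_prob_algebra)
        have idm: "(\<lambda>y. y) \<in> borel_measurable (\<kappa> 2 a)"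
          unfolding measurable_cong_sets[OF s refl] by (rule measurable_restrict_space1) simp
        have "bounded (X 2)" using compact[of 2] n compact_imp_bounded by auto
        then obtain K where K: "\<And>y. y \<in> X 2 \<Longrightarrow> norm y \<le> K" by (auto simp: bounded_iff)
        have idi: "integrable (\<kappa> 2 a) (\<lambda>y. y)"
          using K sets_eq_imp_space_eq[OF s]
          by (intro K.integrable_const_bound[OF _ idm, of K]) (auto intro!: AE_I2 simp: space_restrict_space)
        have Gi: "integrable (\<kappa> 2 a) (\<lambda>y. G \<bullet> (y - a))"
          using idi by simp
        have "(\<integral>y. G \<bullet> (y - a) \<partial>\<kappa> 2 a) = G \<bullet> ((\<integral>y. y \<partial>\<kappa> 2 a) - a)"
          using idi by (simp add: K.prob_space)
        then have "(\<integral>y. G \<bullet> (y - a) \<partial>\<kappa> 2 a) = 0" using bary by simp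
        then show ?thesis
          using Fi Gi True by (simp add: f'_def I_def)
      qed (simp add: f'_def I_def)
    qed
    ultimately show ?thesis by simp
  qed
  have "AE a in \<mu> 1. (\<integral>y. y \<partial>\<kappa> 2 a) = a"
  proof (rule kernel_barycenter[of X 2 \<mu>, OF _ _ _ \<mu>])
    show "compact (X 1)" "compact (X 2)" using n by (auto intro: compact)
    have "2 \<in> {2..n}" using n by simp
    note this[THEN kernel] this[THEN P_kernel] this[THEN P]
    then show "\<kappa> 2 \<in> borel_on (X 1) \<rightarrow>\<^sub>M prob_algebra (borel_on (X 2))"
      "distr (P 2) (borel_on (X 1) \<Otimes>\<^sub>M borel_on (X 2)) (\<lambda>x. (x 1, x 2)) = kernel_prod (\<mu> 1) (borel_on (X 2)) (\<kappa> 2)"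
      "P 2 \<in> mart_couplings X {1, 2} \<mu>" by simp_all
  qed simp
  moreover have "AE a in \<mu> 1. \<forall>i\<in>{2..<n}. \<kappa> i a \<preceq>\<^sub>c \<kappa> (Suc i) a"
    using kernel_order by (intro AE_finite_allI) auto
  ultimately have "AE a in \<mu> 1. (\<Sum>i=2..n. I i a) \<le> (\<Sum>i=2..n. Cst i) - e"
    using AE_space by eventually_elim (intro main, auto simp: sp\<mu>)
  then have "(\<integral>a. (\<Sum>i=2..n. I i a) \<partial>\<mu> 1) \<le> (\<Sum>i=2..n. Cst i) - e"
    using Ii by (intro M.integral_le_const) auto
  moreover have "(\<integral>a. (\<Sum>i=2..n. I i a) \<partial>\<mu> 1) = (\<Sum>i=2..n. Cst i)"
  proof -
    have "(\<integral>a. (\<Sum>i=2..n. I i a) \<partial>\<mu> 1) = (\<Sum>i=2..n. \<integral>a. I i a \<partial>\<mu> 1)"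
      by (rule Bochner_Integration.integral_sum) (rule Ii)
    then show ?thesis by (simp only: I_def CF cong: sum.cong)
  qed
  ultimately show False using e(1) by simp
qed

text \<open>The annihilating measure for the tests is read off by special choices: one nonzero f
  identifies a projection, and one nonzero g shows an increment to be orthogonal to continuous
  functions of its past. The one-dimensional marginals follow from the projections.\<close>

lemma glued_coupling_exists:
  fixes X :: "nat \<Rightarrow> 'a::euclidean_space set"
  assumes n: "2 \<le> n"
    and compact: "\<And>i. i \<in> {1..n} \<Longrightarrow> compact (X i)"
    and \<mu>: "\<mu> 1 \<in> space (prob_algebra (borel_on (X 1)))"
    and kernel: "\<And>i. i \<in> {2..n} \<Longrightarrow> \<kappa> i \<in> borel_on (X 1) \<rightarrow>\<^sub>M prob_algebra (borel_on (X i))"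
    and P_kernel: "\<And>i. i \<in> {2..n} \<Longrightarrow>
        distr (P i) (borel_on (X 1) \<Otimes>\<^sub>M borel_on (X i)) (\<lambda>x. (x 1, x i))
          = kernel_prod (\<mu> 1) (borel_on (X i)) (\<kappa> i)"
    and P: "\<And>i. i \<in> {2..n} \<Longrightarrow> P i \<in> mart_couplings X {1, i} \<mu>"
    and kernel_order: "\<And>i. i \<in> {2..<n} \<Longrightarrow> AE x in \<mu> 1. \<kappa> i x \<preceq>\<^sub>c \<kappa> (i + 1) x"
  shows "\<exists>\<rho>\<in>mart_couplings X {1..n} \<mu>. \<forall>i\<in>{2..n}. Proj X {1, i} \<rho> = P i"
proof -
  have Pc: "P i \<in> couplings X {1, i} \<mu>" if "i \<in> {2..n}" for i using P[OF that] by (simp add: mart_couplings_def)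
  note D = couplingsD[OF Pc]
  have compact': "compact (X k)" if "i \<in> {2..n}" "k \<in> {1, i}" for i k
    using that by (intro compact) auto
  have Pi: "integrable (P i) f" if "i \<in> {2..n}" "continuous_on UNIV (f :: (nat \<Rightarrow> 'a) \<Rightarrow> real)" for i f
    by (rule integrable_path_continuous[OF D(1,2)[OF that(1)] compact'[OF that(1)] that(2)])
  have "\<exists>L T. real_distribution L \<and> (AE t in L. 0 \<le> t \<and> t \<le> 1) \<and>
      T \<in> borel_measurable borel \<and> range T \<subseteq> PiE {1..n} X \<and> (\<forall>h\<in>glue_tests n P. (\<integral>t. h (T t) \<partial>L) = 0)"
  proof (rule annihilating_measure_exists)
    show "compact (PiE {1..n} X)" by (rule compact_PiE_paths[OF compact])
    have "glue_test n P (\<lambda>_ _. 0) (\<lambda>_ _. 0) \<in> glue_tests n P" by (rule glue_testsI) auto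
    moreover have "glue_test n P (\<lambda>_ _. 0) (\<lambda>_ _. 0) = (\<lambda>_. 0)" by (simp add: fun_eq_iff glue_test_def)
    ultimately show "(\<lambda>_. 0) \<in> glue_tests n P" by simp
    show "(\<lambda>x. g x + h x) \<in> glue_tests n P" if "g \<in> glue_tests n P" "h \<in> glue_tests n P" for g h
      by (rule glue_tests_add[OF Pi that])
    show "\<exists>x\<in>PiE {1..n} X. 0 \<le> h x" if "h \<in> glue_tests n P" for h
      by (rule glue_tests_nonneg[OF n compact \<mu> kernel P_kernel P kernel_order that])
  qed (auto intro: continuous_on_glue_tests glue_tests_scale)
  then obtain L T where L: "real_distribution L" "AE t in L. 0 \<le> t \<and> t \<le> 1"
    and T: "T \<in> borel_measurable borel" "range T \<subseteq> PiE {1..n} X"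
    and zero: "\<And>h. h \<in> glue_tests n P \<Longrightarrow> (\<integral>t. h (T t) \<partial>L) = 0" by blast
  interpret L: real_distribution L by fact
  have T': "T \<in> borel \<rightarrow>\<^sub>M path_space X {1..n}" by (rule measurable_into_path_space[OF T])
  then have T'': "T \<in> L \<rightarrow>\<^sub>M path_space X {1..n}" by simp
  define \<rho> where "\<rho> = distr L (path_space X {1..n}) T"
  have \<rho>: "prob_space \<rho>" "sets \<rho> = sets (path_space X {1..n})"
    unfolding \<rho>_def by (rule L.prob_space_distr[OF T''], simp)
  have sp: "space \<rho> = PiE {1..n} X" using sets_eq_imp_space_eq[OF \<rho>(2)] by (simp add: space_path_space)
  interpret R: prob_space \<rho> by (rule \<rho>)
  have zero\<rho>: "(\<integral>x. h x \<partial>\<rho>) = 0" if "h \<in> glue_tests n P" for h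
    unfolding \<rho>_def
    using zero[OF that] borel_measurable_path_continuous[OF continuous_on_glue_tests[OF that]]
    by (subst integral_distr[OF T'']) auto
  have rm: "(\<lambda>x. restrict x J) \<in> \<rho> \<rightarrow>\<^sub>M path_space X J" if "J \<subseteq> {1..n}" for J
    unfolding measurable_cong_sets[OF \<rho>(2) refl] using that by (rule measurable_restrict_path)
  have int\<rho>: "integrable \<rho> f" if "continuous_on UNIV f" for f :: "(nat \<Rightarrow> 'a) \<Rightarrow> real"
    by (rule integrable_path_continuous[OF \<rho> compact that])
  have proj: "Proj X {1, i} \<rho> = P i" if i: "i \<in> {2..n}" for i
  proof (rule path_measure_eqI_continuous[where X = X and I = "{1, i}"])
    have sub: "{1, i} \<subseteq> {1..n}" using i by auto
    show "closed (X k)" if "k \<in> {1, i}" for k using compact'[OF i that] by (rule compact_imp_closed)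
    show "finite_measure (Proj X {1, i} \<rho>)" "finite_measure (P i)"
      using prob_space_Proj[OF \<rho> sub] D(1)[OF i] by (simp_all add: prob_space.finite_measure)
    show "sets (P i) = sets (path_space X {1, i})" by (rule D(2)[OF i])
    fix f :: "(nat \<Rightarrow> 'a) \<Rightarrow> real" assume f: "continuous_on UNIV f"
    define F where "F = (\<lambda>j. if j = i then f else (\<lambda>_. 0))"
    have h: "glue_test n P F (\<lambda>_ _. 0) \<in> glue_tests n P"
      by (rule glue_testsI) (auto simp: F_def f)
    have "glue_test n P F (\<lambda>_ _. 0) x = f (restrict x {1, i}) - (\<integral>y. f y \<partial>P i)" for x
    proof -
      have "(\<Sum>j=2..n. F j (restrict x {1, j}) - (\<integral>y. F j y \<partial>P j))
        = (\<Sum>j=2..n. if j = i then f (restrict x {1, i}) - (\<integral>y. f y \<partial>P i) else 0)"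
        by (rule sum.cong) (auto simp: F_def)
      then show ?thesis using i by (simp add: glue_test_def)
    qed
    then have "(\<integral>x. f (restrict x {1, i}) - (\<integral>y. f y \<partial>P i) \<partial>\<rho>) = 0" using zero\<rho>[OF h] by simp
    moreover have "integrable \<rho> (\<lambda>x. f (restrict x {1, i}))" by (rule int\<rho>[OF continuous_on_comp_restrict[OF f]])
    ultimately have "(\<integral>x. f (restrict x {1, i}) \<partial>\<rho>) = (\<integral>y. f y \<partial>P i)" by (simp add: R.prob_space)
    then show "(\<integral>x. f x \<partial>Proj X {1, i} \<rho>) = (\<integral>x. f x \<partial>P i)"
      unfolding Proj_def by (subst integral_distr[OF rm[OF sub] borel_measurable_path_continuous[OF f]])
  qed simp_all
  have coup: "\<rho> \<in> couplings X {1..n} \<mu>"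
  proof -
    have "distr \<rho> (borel_on (X k)) (\<lambda>x. x k) = \<mu> k" if k: "k \<in> {1..n}" for k
    proof -
      \<comment> \<open>Every time belongs to some pair {1, i} with i \<ge> 2; for k = 1 such a pair
        exists because 2 \<le> n.\<close>
      obtain i where i: "i \<in> {2..n}" "k \<in> {1, i}" using n k by (cases "k = 1") auto
      then have sub: "{1, i} \<subseteq> {1..n}" by auto
      have "distr \<rho> (borel_on (X k)) (\<lambda>x. x k) = distr (Proj X {1, i} \<rho>) (borel_on (X k)) (\<lambda>x. x k)"
        unfolding Proj_def using i(2)
        by (subst distr_distr[OF measurable_path_coordinate(1) rm[OF sub]]) (auto simp: o_def)
      then show ?thesis using D(4)[OF i] proj[OF i(1)] by simp
    qed
    then show ?thesis using \<rho> by (simp add: couplings_def space_prob_algebra)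
  qed
  obtain B where B: "\<And>i y. i \<in> {1..n} \<Longrightarrow> y \<in> X i \<Longrightarrow> norm y \<le> B"
    using compact_paths_bounded[of "{1..n}" X] compact by blast
  have inc: "(\<integral>x. indicator A (restrict x {1..i}) * ((x (Suc i) - x i) \<bullet> e) \<partial>\<rho>) = 0"
    if i: "1 \<le> i" "i < n" and A: "A \<in> sets (path_space X {1..i})" and e: "e \<in> Basis" for i A e
  proof (rule weight_orthogonal_extend[OF \<rho> _ _ compact _ _ _ A, where B = "2 * B"])
    show "{1..i} \<subseteq> {1..n}" using i by auto
    show "(\<lambda>x. (x (Suc i) - x i) \<bullet> e) \<in> borel_measurable (path_space X {1..n})"
      using i by (intro borel_measurable_inner borel_measurable_diff borel_measurable_const measurable_path_coordinate) auto
    show "\<bar>(x (Suc i) - x i) \<bullet> e\<bar> \<le> 2 * B" if "x \<in> PiE {1..n} X" for x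
    proof -
      have "x (Suc i) \<in> X (Suc i)" "x i \<in> X i" using that i by auto
      then have "norm (x (Suc i)) \<le> B" "norm (x i) \<le> B" using B[of "Suc i"] B[of i] i by auto
      then show ?thesis
        using Basis_le_norm[OF e, of "x (Suc i) - x i"] norm_triangle_ineq4[of "x (Suc i)" "x i"] by linarith
    qed
    fix f :: "(nat \<Rightarrow> 'a) \<Rightarrow> real" assume f: "continuous_on UNIV f"
    \<comment> \<open>A scalar function of the past times the basis vector e singles out one
      coordinate of one increment.\<close>
    define g where "g = (\<lambda>j x. if j = i then f x *\<^sub>R e else 0)"
    have h: "glue_test n P (\<lambda>_ _. 0) g \<in> glue_tests n P"
    proof (rule glue_testsI)
      show "continuous_on UNIV (g j)" for j
        unfolding g_def by (cases "j = i") (auto intro!: continuous_intros f)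
    qed auto
    have "glue_test n P (\<lambda>_ _. 0) g x = f (restrict x {1..i}) * ((x (Suc i) - x i) \<bullet> e)" for x
    proof -
      have "(\<Sum>j=1..<n. g j (restrict x {1..j}) \<bullet> (x (Suc j) - x j))
        = (\<Sum>j=1..<n. if j = i then f (restrict x {1..i}) * ((x (Suc i) - x i) \<bullet> e) else 0)"
        by (rule sum.cong) (auto simp: g_def inner_commute)
      then show ?thesis using i by (simp add: glue_test_def)
    qed
    then show "(\<integral>x. f (restrict x {1..i}) * ((x (Suc i) - x i) \<bullet> e) \<partial>\<rho>) = 0" using zero\<rho>[OF h] by simp
  qed simp_all
  have "\<rho> \<in> mart_couplings X {1..n} \<mu>" unfolding mart_couplings_def mem_Collect_eq
  proof (intro conjI ballI impI coup)
    fix i j assume ij: "i \<in> {1..n}" "j \<in> {1..n}" "i < j \<and> {i<..<j} \<inter> {1..n} = {}"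
    have j: "j = Suc i"
    proof (rule ccontr)
      assume "j \<noteq> Suc i"
      then have "Suc i \<in> {i<..<j} \<inter> {1..n}" using ij(1,2) conjunct1[OF ij(3)] by auto
      then show False using ij by blast
    qed
    have J: "{k\<in>{1..n}. k \<le> i} = {1..i}" using ij by auto
    obtain \<eta> where \<eta>: "disintegrates X {1..n} i \<rho> \<eta>"
      using disintegration_exists[OF L T', of i] unfolding \<rho>_def by blast
    have "(AE x in Proj X {1..i} \<rho>. (\<integral>y. y (Suc i) \<partial>\<eta> x) = x i) \<longleftrightarrow>
      (\<forall>A\<in>sets (path_space X {1..i}). \<forall>e\<in>Basis.
        (\<integral>x. indicator A (restrict x {1..i}) * ((x (Suc i) - x i) \<bullet> e) \<partial>\<rho>) = 0)"
      by (rule disintegrates_barycenter_iff[OF \<rho> _ compact \<eta>, of "Suc i", unfolded J]) (use ij j in auto)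
    moreover have "1 \<le> i" "i < n" using ij by auto
    ultimately have "AE x in Proj X {1..i} \<rho>. (\<integral>y. y (Suc i) \<partial>\<eta> x) = x i" using inc by blast
    then show "\<exists>\<eta>. disintegrates X {1..n} i \<rho> \<eta> \<and>
        (AE x in Proj X {k\<in>{1..n}. k \<le> i} \<rho>. (\<integral>y. y j \<partial>\<eta> x) = x i)"
      unfolding J j using \<eta> by blast
  qed
  then show ?thesis using proj by blast
qed

section \<open>Additive costs and the two optimality statements\<close>

lemma coupling_cost_integral:
  fixes X :: "nat \<Rightarrow> 'a::euclidean_space set"
  assumes \<pi>: "\<pi> \<in> couplings X {1..n} \<mu>" and X: "\<And>i. i \<in> {1..n} \<Longrightarrow> compact (X i)"
    and c: "\<And>i. i \<in> {2..n} \<Longrightarrow> continuous_on (X 1 \<times> X i) (c i :: 'a \<times> 'a \<Rightarrow> real)"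
  shows "(\<integral>x. (\<Sum>i=2..n. c i (x 1, x i)) \<partial>\<pi>) = (\<Sum>i=2..n. \<integral>x. c i (x 1, x i) \<partial>Proj X {1, i} \<pi>)"
proof -
  note D = couplingsD[OF \<pi>]
  interpret prob_space \<pi> by (rule D(1))
  have *: "integrable \<pi> (\<lambda>x. c i (x 1, x i)) \<and> (\<integral>x. c i (x 1, x i) \<partial>\<pi>) = (\<integral>x. c i (x 1, x i) \<partial>Proj X {1, i} \<pi>)"
    if i: "i \<in> {2..n}" for i
  proof
    have sub: "{1, i} \<subseteq> {1..n}" using i by auto
    have m: "(\<lambda>x. c i (x 1, x i)) \<in> borel_measurable (path_space X I)" if I: "1 \<in> I" "i \<in> I" for I
    proof -
      have "(\<lambda>x. (x 1, x i)) \<in> path_space X I \<rightarrow>\<^sub>M restrict_space borel (X 1 \<times> X i)"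
      proof (rule measurable_restrict_space2)
        show "(\<lambda>x. (x 1, x i)) \<in> borel_measurable (path_space X I)"
          using I by (intro borel_measurable_Pair measurable_path_coordinate)
      qed (use I in \<open>auto simp: space_path_space\<close>)
      then show ?thesis
        by (rule measurable_compose[OF _ borel_measurable_continuous_on_restrict[OF c[OF i]]])
    qed
    obtain K where K: "\<forall>x\<in>X 1. \<forall>y\<in>X i. \<bar>c i (x, y)\<bar> \<le> K"
      using bounded_pair_continuous[OF X X c[OF i]] i by auto
    show "integrable \<pi> (\<lambda>x. c i (x 1, x i))"
    proof (rule integrable_path_bounded[OF D(1,2) m])
      show "1 \<in> {1..n}" "i \<in> {1..n}" using sub by auto
      fix x assume "x \<in> PiE {1..n} X"
      then have "x 1 \<in> X 1" "x i \<in> X i" using sub by auto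
      then show "\<bar>c i (x 1, x i)\<bar> \<le> K" using K by blast
    qed
    have r: "(\<lambda>x. restrict x {1, i}) \<in> \<pi> \<rightarrow>\<^sub>M path_space X {1, i}"
      unfolding measurable_cong_sets[OF D(2) refl] by (rule measurable_restrict_path[OF sub])
    show "(\<integral>x. c i (x 1, x i) \<partial>\<pi>) = (\<integral>x. c i (x 1, x i) \<partial>Proj X {1, i} \<pi>)"
      unfolding Proj_def by (subst integral_distr[OF r m]) auto
  qed
  then show ?thesis by (simp add: Bochner_Integration.integral_sum)
qed

theorem proposition2p5:
  fixes n :: nat
    and X :: "nat \<Rightarrow> 'a::euclidean_space set"
    and \<mu> :: "nat \<Rightarrow> 'a measure"
    and c :: "nat \<Rightarrow> 'a \<times> 'a \<Rightarrow> real"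
    and \<kappa> :: "nat \<Rightarrow> 'a \<Rightarrow> 'a measure"
    and P :: "nat \<Rightarrow> (nat \<Rightarrow> 'a) measure"
  assumes n: "1 \<le> n"
    and compact: "\<And>i. i \<in> {1..n} \<Longrightarrow> compact (X i)"
    and prob: "\<And>i. i \<in> {1..n} \<Longrightarrow> \<mu> i \<in> space (prob_algebra (borel_on (X i)))"
    and order: "\<And>i. i \<in> {1..<n} \<Longrightarrow> \<mu> i \<preceq>\<^sub>c \<mu> (i + 1)"
    and cont: "\<And>i. i \<in> {2..n} \<Longrightarrow> continuous_on (X 1 \<times> X i) (c i)"
    and kernel: "\<And>i. i \<in> {2..n} \<Longrightarrow> \<kappa> i \<in> borel_on (X 1) \<rightarrow>\<^sub>M prob_algebra (borel_on (X i))"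
    and P_kernel: "\<And>i. i \<in> {2..n} \<Longrightarrow>
        distr (P i) (borel_on (X 1) \<Otimes>\<^sub>M borel_on (X i)) (\<lambda>x. (x 1, x i))
          = kernel_prod (\<mu> 1) (borel_on (X i)) (\<kappa> i)"
    and P_optimal: "\<And>i. i \<in> {2..n} \<Longrightarrow>
        mot_optimal X {1, i} \<mu> (\<lambda>x. c i (x 1, x i)) (P i)"
    and kernel_order: "\<And>i. i \<in> {2..<n} \<Longrightarrow> AE x in \<mu> 1. \<kappa> i x \<preceq>\<^sub>c \<kappa> (i + 1) x"
  shows "(\<forall>\<pi> \<in> mart_couplings X {1..n} \<mu>.
            (\<forall>i\<in>{2..n}. Proj X {1, i} \<pi> = P i) \<longrightarrow>
            mot_optimal X {1..n} \<mu> (\<lambda>x. \<Sum>i=2..n. c i (x 1, x i)) \<pi>)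
       \<and> (\<forall>\<pi>. mot_optimal X {1..n} \<mu> (\<lambda>x. \<Sum>i=2..n. c i (x 1, x i)) \<pi> \<longrightarrow>
            (\<forall>i\<in>{2..n}. mot_optimal X {1, i} \<mu> (\<lambda>x. c i (x 1, x i)) (Proj X {1, i} \<pi>)))"
proof -
  define J where "J i \<pi> = (\<integral>x. c i (x 1, x i) \<partial>\<pi>)" for i \<pi>
  have cost: "(\<integral>x. (\<Sum>i=2..n. c i (x 1, x i)) \<partial>\<pi>) = (\<Sum>i=2..n. J i (Proj X {1, i} \<pi>))"
    if "\<pi> \<in> mart_couplings X {1..n} \<mu>" for \<pi>
    unfolding J_def using that
    by (intro coupling_cost_integral[where \<mu> = \<mu>] compact cont) (auto simp: mart_couplings_def)
  have P: "P i \<in> mart_couplings X {1, i} \<mu>" "\<And>\<rho>. \<rho> \<in> mart_couplings X {1, i} \<mu> \<Longrightarrow> J i (P i) \<le> J i \<rho>"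
    if "i \<in> {2..n}" for i
    using P_optimal[OF that] by (auto simp: mot_optimal_def J_def)
  have proj: "Proj X {1, i} \<pi> \<in> mart_couplings X {1, i} \<mu>"
    if "\<pi> \<in> mart_couplings X {1..n} \<mu>" "i \<in> {2..n}" for \<pi> i
    by (rule Proj_mart_couplings[OF compact that])
  show ?thesis
  proof (intro conjI ballI allI impI)
    fix \<pi> assume \<pi>: "\<pi> \<in> mart_couplings X {1..n} \<mu>" and glued: "\<forall>i\<in>{2..n}. Proj X {1, i} \<pi> = P i"
    have "(\<Sum>i=2..n. J i (Proj X {1, i} \<pi>)) \<le> (\<Sum>i=2..n. J i (Proj X {1, i} \<rho>))"
      if "\<rho> \<in> mart_couplings X {1..n} \<mu>" for \<rho>
      using glued P(2) proj[OF that] by (intro sum_mono) auto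
    then show "mot_optimal X {1..n} \<mu> (\<lambda>x. \<Sum>i=2..n. c i (x 1, x i)) \<pi>"
      using \<pi> cost by (simp add: mot_optimal_def)
  next
    fix \<pi> i assume opt: "mot_optimal X {1..n} \<mu> (\<lambda>x. \<Sum>i=2..n. c i (x 1, x i)) \<pi>" and i: "i \<in> {2..n}"
    then have \<pi>: "\<pi> \<in> mart_couplings X {1..n} \<mu>" by (simp add: mot_optimal_def)
    \<comment> \<open>For n = 1 there is no index i, so the gluing is needed only for n at least
      2.\<close>
    have n2: "2 \<le> n" using i by auto
    have "\<mu> 1 \<in> space (prob_algebra (borel_on (X 1)))" using prob[of 1] n by simp
    then obtain \<rho> where \<rho>: "\<rho> \<in> mart_couplings X {1..n} \<mu>" "\<And>i. i \<in> {2..n} \<Longrightarrow> Proj X {1, i} \<rho> = P i"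
      using glued_coupling_exists[OF n2 compact _ kernel P_kernel P(1) kernel_order] by blast
    have "(\<Sum>i=2..n. J i (Proj X {1, i} \<pi>)) \<le> (\<Sum>i=2..n. J i (Proj X {1, i} \<rho>))"
      unfolding cost[OF \<pi>, symmetric] cost[OF \<rho>(1), symmetric]
      using opt \<rho>(1) unfolding mot_optimal_def by blast
    also have "\<dots> = (\<Sum>i=2..n. J i (P i))" using \<rho>(2) by simp
    finally have le: "(\<Sum>i=2..n. J i (Proj X {1, i} \<pi>)) \<le> (\<Sum>i=2..n. J i (P i))" .
    have ge: "J k (P k) \<le> J k (Proj X {1, k} \<pi>)" if "k \<in> {2..n}" for k
      using P(2) proj[OF \<pi>] that by blast
    \<comment> \<open>The total cost of \<open>\<pi>\<close> does not exceed the sum of the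
      two-period minima, while no single term is below its minimum. A strict excess in one term
      would make the total too large.\<close>
    have "J i (Proj X {1, i} \<pi>) \<le> J i (P i)"
    proof (rule ccontr)
      assume "\<not> J i (Proj X {1, i} \<pi>) \<le> J i (P i)"
      then have "(\<Sum>i=2..n. J i (P i)) < (\<Sum>i=2..n. J i (Proj X {1, i} \<pi>))"
        using ge i by (intro sum_strict_mono_ex1) (auto intro!: bexI[of _ i])
      then show False using le by simp
    qed
    then show "mot_optimal X {1, i} \<mu> (\<lambda>x. c i (x 1, x i)) (Proj X {1, i} \<pi>)"
      using P(2)[OF i] proj[OF \<pi> i] unfolding mot_optimal_def J_def by force
  qed
qed

end
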